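(* Let $G=(V,E)$ be any directed graph with all self-loops (i.e. $i\to i\in E$ for every $i\in V$) on $p\ge 2$ nodes with no isolated nodes. Then the off-diagonal modified Jacobian $\mathcal{J}^G_{\mathrm{off}}(S,T,R)$ of the second-, third- and fourth-order cumulants generically has full rank, equal to $|E|$. It follows that the corresponding fourth-order discrete Lyapunov model is locally identifiable from its second-, third- and fourth-order cumulants.
   Context: $V=\{0,\dots,p-1\}$, $E\subseteq V\times V$; cycles are allowed. A node is isolated if no edge connects it to a different node. $\mathbb{R}^E$ is the set of real $p\times p$ matrices $A=(a_{ji})$ with $a_{ji}=0$ whenever $i\to j\notin E$; $\mathbb{R}^E_{\mathrm{stab}}\subseteq\mathbb{R}^E$ is the subset of Schur stable matrices (all complex eigenvalues of absolute value $<1$). Parameter space: $\Theta=\mathbb{R}^E_{\mathrm{stab}}\times\mathbb{R}_+^p\times(\mathbb{R}\setminus\{0\})^p\times\mathbb{R}_+^p$, with elements $\theta=(A,\Omega^{(2)},\Omega^{(3)},\Omega^{(4)})$, where $\mathbb{R}_+$ denotes the positive reals and the vectors are the diagonals of diagonal tensors $\Omega^{(m)}$ of order $m$ on $\mathbb{R}^p$. Let $\varphi(\theta)=(S,T,R)=(T_2,T_3,T_4)$ be given by $\mathrm{vec}(T_m)=(I-A^{\otimes m})^{-1}\mathrm{vec}(\Omega^{(m)})$ for $m=2,3,4$, where $A^{\otimes m}$ is the $m$-fold Kronecker power. Modified Jacobian: let $E_{\beta\alpha}$ be the $p\times p$ matrix with a $1$ in position $(\beta,\alpha)$ and $0$ elsewhere.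 For $m=2,3,4$ let $J_m^G$ be the matrix with rows indexed by $m$-tuples $i_1\le\cdots\le i_m$ in $V$ and columns indexed by the edges $\alpha\to\beta\in E$, whose column $\alpha\to\beta$ consists of the corresponding entries of $\left(\sum_{k=1}^m A^{\otimes(k-1)}\otimes E_{\beta\alpha}\otimes A^{\otimes(m-k)}\right)\mathrm{vec}(T_m)$. $\mathcal{J}^G_{\mathrm{off}}(S,T,R)$ is obtained by stacking, for $m=2,3,4$, the rows $(i_1,\dots,i_m)$ of $J^G_m$ with $i_1,\dots,i_m$ not all equal. "Generically" means for all $\theta$ outside a proper algebraic subset of $\Theta$. "Locally identifiable" means: there is a proper algebraic subset $Z$ of $\Theta$ such that $\varphi^{-1}(\varphi(\theta))$ is finite for all $\theta\in\Theta\setminus Z$. *)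

theory Defs
  imports
    "Jordan_Normal_Form.Char_Poly"
    "Jordan_Normal_Form.Gauss_Jordan_Elimination"
    "Jordan_Normal_Form.DL_Rank"
begin

section \<open>Graphs and stable matrices\<close>

text \<open>The nodes are the numbers below p, and a graph is its edge set;
  a pair \<^term>\<open>(i, j)\<close> in E is the edge from i to j.\<close>

definition isolated :: "nat \<Rightarrow> (nat \<times> nat) set \<Rightarrow> nat \<Rightarrow> bool" where
  "isolated p E i \<longleftrightarrow> \<not> (\<exists>j<p. j \<noteq> i \<and> ((i, j) \<in> E \<or> (j, i) \<in> E))"

text \<open>The edge from i to j carries the matrix entry in row j and column i.\<close>

definition edge_mats :: "nat \<Rightarrow> (nat \<times> nat) set \<Rightarrow> real mat set" where
  "edge_mats p E =
     {A \<in> carrier_mat p p. \<forall>i<p. \<forall>j<p. (i, j) \<notin> E \<longrightarrow> A $$ (j, i) = 0}"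

definition schur_stable :: "real mat \<Rightarrow> bool" where
  "schur_stable A \<longleftrightarrow>
     (\<forall>k::complex. eigenvalue (map_mat complex_of_real A) k \<longrightarrow> cmod k < 1)"

section \<open>Kronecker products and vectorised tensors\<close>

definition kron :: "'a::semiring_1 mat \<Rightarrow> 'a mat \<Rightarrow> 'a mat" where
  "kron A B = mat (dim_row A * dim_row B) (dim_col A * dim_col B)
     (\<lambda>(i, j). A $$ (i div dim_row B, j div dim_col B) * B $$ (i mod dim_row B, j mod dim_col B))"

fun kron_pow :: "'a::semiring_1 mat \<Rightarrow> nat \<Rightarrow> 'a mat" where
  "kron_pow A 0 = 1\<^sub>m 1"
| "kron_pow A (Suc m) = kron A (kron_pow A m)"

text \<open>A tensor of order m on the p-dimensional space is represented by its vectorisation, of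
  dimension \<^term>\<open>p ^ m\<close>. The entry at a tuple of indices sits at the position whose base-p
  digits are the tuple, first index most significant. This is the order for which row
  \<^term>\<open>(i\<^sub>1, i\<^sub>2)\<close> and column \<^term>\<open>(j\<^sub>1, j\<^sub>2)\<close> of \<^term>\<open>kron A B\<close> is
  \<^term>\<open>A $$ (i\<^sub>1, j\<^sub>1) * B $$ (i\<^sub>2, j\<^sub>2)\<close>. The opposite order would give the same cumulants
  and Jacobian, since all tensors involved are symmetric.\<close>

definition tuple_index :: "nat \<Rightarrow> nat list \<Rightarrow> nat" where
  "tuple_index p t = foldl (\<lambda>n i. n * p + i) 0 t"

definition diag_tensor :: "nat \<Rightarrow> nat \<Rightarrow> real vec \<Rightarrow> real vec" where
  "diag_tensor p m w =
     vec (p ^ m) (\<lambda>n. \<Sum>i<p. if n = tuple_index p (replicate m i) then w $ i else 0)"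

section \<open>The fourth-order discrete Lyapunov model\<close>

text \<open>A parameter consists of the matrix A and the diagonals of the tensors of order 2, 3, 4.\<close>

type_synonym param = "real mat \<times> real vec \<times> real vec \<times> real vec"

definition param_space :: "nat \<Rightarrow> (nat \<times> nat) set \<Rightarrow> param set" where
  "param_space p E =
     {A \<in> edge_mats p E. schur_stable A} \<times>
     {w \<in> carrier_vec p. \<forall>i<p. 0 < w $ i} \<times>
     {w \<in> carrier_vec p. \<forall>i<p. w $ i \<noteq> 0} \<times>
     {w \<in> carrier_vec p. \<forall>i<p. 0 < w $ i}"

text \<open>For Schur stable A the matrix inverted here is invertible, so \<^const>\<open>the\<close> is applied to a
  genuine inverse.\<close>

definition cumulant :: "nat \<Rightarrow> nat \<Rightarrow> real mat \<Rightarrow> real vec \<Rightarrow> real vec" where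
  "cumulant p m A w =
     the (mat_inverse (1\<^sub>m (p ^ m) - kron_pow A m)) *\<^sub>v diag_tensor p m w"

definition cumulants :: "nat \<Rightarrow> param \<Rightarrow> real vec \<times> real vec \<times> real vec" where
  "cumulants p = (\<lambda>(A, w2, w3, w4). (cumulant p 2 A w2, cumulant p 3 A w3, cumulant p 4 A w4))"

section \<open>The modified Jacobian\<close>

definition edge_list :: "nat \<Rightarrow> (nat \<times> nat) set \<Rightarrow> (nat \<times> nat) list" where
  "edge_list p E = filter (\<lambda>e. e \<in> E) (List.product [0..<p] [0..<p])"

definition sorted_tuples :: "nat \<Rightarrow> nat \<Rightarrow> nat list list" where
  "sorted_tuples p m = filter sorted (List.n_lists m [0..<p])"

definition unit_mat :: "nat \<Rightarrow> nat \<Rightarrow> nat \<Rightarrow> real mat" where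
  "unit_mat p b a = mat p p (\<lambda>(r, c). if r = b \<and> c = a then 1 else 0)"

definition kron_pow_deriv :: "nat \<Rightarrow> real mat \<Rightarrow> nat \<Rightarrow> nat \<times> nat \<Rightarrow> real mat" where
  "kron_pow_deriv p A m = (\<lambda>(a, b). mat (p ^ m) (p ^ m) (\<lambda>ij.
     \<Sum>k = 1..m. kron (kron_pow A (k - 1)) (kron (unit_mat p b a) (kron_pow A (m - k))) $$ ij))"

definition jacobian :: "nat \<Rightarrow> (nat \<times> nat) set \<Rightarrow> real mat \<Rightarrow> nat \<Rightarrow> real vec \<Rightarrow> real mat" where
  "jacobian p E A m T = mat (length (sorted_tuples p m)) (length (edge_list p E))
     (\<lambda>(r, c). (kron_pow_deriv p A m (edge_list p E ! c) *\<^sub>v T)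
                 $ tuple_index p (sorted_tuples p m ! r))"

definition off_rows :: "nat \<Rightarrow> (nat \<times> nat) set \<Rightarrow> real mat \<Rightarrow> nat \<Rightarrow> real vec \<Rightarrow> real vec list" where
  "off_rows p E A m T =
     [row (jacobian p E A m T) r.
        r \<leftarrow> [0..<length (sorted_tuples p m)], 1 < card (set (sorted_tuples p m ! r))]"

definition jacobian_off ::
  "nat \<Rightarrow> (nat \<times> nat) set \<Rightarrow> real mat \<Rightarrow> real vec \<times> real vec \<times> real vec \<Rightarrow> real mat" where
  "jacobian_off p E A = (\<lambda>(S, T, R). mat_of_rows (length (edge_list p E))
     (off_rows p E A 2 S @ off_rows p E A 3 T @ off_rows p E A 4 R))"

definition mat_rank :: "real mat \<Rightarrow> nat" where
  "mat_rank M = vec_space.rank (dim_row M) M"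

section \<open>Genericity and local identifiability\<close>

text \<open>Real polynomials in the coordinates of the linear space containing the parameter space:
  the entries of A on the edges, and the three diagonals.\<close>

inductive_set param_polys :: "nat \<Rightarrow> (nat \<times> nat) set \<Rightarrow> (param \<Rightarrow> real) set"
  for p :: nat and E :: "(nat \<times> nat) set" where
  const: "(\<lambda>_. c) \<in> param_polys p E"
| edge: "(i, j) \<in> E \<Longrightarrow> (\<lambda>(A, w2, w3, w4). A $$ (j, i)) \<in> param_polys p E"
| diag2: "i < p \<Longrightarrow> (\<lambda>(A, w2, w3, w4). w2 $ i) \<in> param_polys p E"
| diag3: "i < p \<Longrightarrow> (\<lambda>(A, w2, w3, w4). w3 $ i) \<in> param_polys p E"
| diag4: "i < p \<Longrightarrow> (\<lambda>(A, w2, w3, w4). w4 $ i) \<in> param_polys p E"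
| add: "f \<in> param_polys p E \<Longrightarrow> g \<in> param_polys p E \<Longrightarrow> (\<lambda>x. f x + g x) \<in> param_polys p E"
| mult: "f \<in> param_polys p E \<Longrightarrow> g \<in> param_polys p E \<Longrightarrow> (\<lambda>x. f x * g x) \<in> param_polys p E"

definition proper_algebraic_subset :: "nat \<Rightarrow> (nat \<times> nat) set \<Rightarrow> param set \<Rightarrow> bool" where
  "proper_algebraic_subset p E Z \<longleftrightarrow>
     (\<exists>F. finite F \<and> F \<subseteq> param_polys p E \<and> Z = {x \<in> param_space p E. \<forall>f\<in>F. f x = 0}) \<and>
     Z \<noteq> param_space p E"

definition generically :: "nat \<Rightarrow> (nat \<times> nat) set \<Rightarrow> (param \<Rightarrow> bool) \<Rightarrow> bool" where
  "generically p E P \<longleftrightarrow>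
     (\<exists>Z. proper_algebraic_subset p E Z \<and> (\<forall>x \<in> param_space p E - Z. P x))"

definition locally_identifiable :: "nat \<Rightarrow> (nat \<times> nat) set \<Rightarrow> bool" where
  "locally_identifiable p E \<longleftrightarrow>
     generically p E (\<lambda>x. finite {y \<in> param_space p E. cumulants p y = cumulants p x})"

end

theory Submission
  imports Defs "Jordan_Normal_Form.Spectral_Radius"
begin

text \<open>
  Both claims reduce to one parameter at which the off-diagonal Jacobian is injective. Start at A = aI
  with unit noise, move in the direction of an orientation of the proper edges, and rescale the
  self-loop columns by the inverse step length. In the limit, the rows (i, ..., i, j) of orders 2, 3, 4
  decouple into one linear system per pair of nodes. The second difference of this system in the order
  carries the factor a^2 (1 - a)^2, so a pair joined by an edge forces the unknowns of that edge and
  of both self-loops to vanish. As no node is isolated, the limit is injective, hence so is the Jacobian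
  after a small step. Its Gram determinant is a rational function of the parameter, which gives
  generic full rank.

  Differentiating the equation T - (A x ... x A) T = Omega shows that the derivative of the cumulant
  map is injective at the same point. So some affine combinations of the cumulants agree with the
  coordinates to first order there. Their monomials are linearly independent, and a dimension count then
  makes every coordinate algebraic over them, with a coefficient that does not vanish identically.
  Where it does not vanish, the coordinate takes finitely many values on the fibre.
\<close>

section \<open>Polynomial and rational functions in finitely many coordinates\<close>

text \<open>At A = aI every cumulant is a diagonal tensor, and so is the Jacobian column of every
  self-loop. The off-diagonal rows do not see these columns at all, so full rank is a first-order
  effect in the step away from aI. Rescaling the columns by nonzero factors does not affect
  injectivity but keeps this effect visible in the limit. Three orders are called for because an
  edge brings three unknowns: its own and those of the self-loops at its two ends. At aI the order 2
  row of a pair cannot tell i -> j from j -> i, whereas the rows of orders 3 and 4 can.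

  Local identifiability asks for fibres that are finite in the whole parameter space. An injective
  derivative only separates nearby points, so an algebraic relation for each coordinate takes the
  place of the inverse function theorem. The off-diagonal Jacobian suffices for the derivative of
  the cumulants because noise enters the differentiated equation only in diagonal positions: the
  other positions determine the edge components, and the diagonal ones are left to determine the
  noise.\<close>

inductive_set polyfun :: "'i set \<Rightarrow> (('i \<Rightarrow> real) \<Rightarrow> real) set" for I :: "'i set" where
  const: "(\<lambda>_. c) \<in> polyfun I"
| coord: "i \<in> I \<Longrightarrow> (\<lambda>x. x i) \<in> polyfun I"
| add: "f \<in> polyfun I \<Longrightarrow> g \<in> polyfun I \<Longrightarrow> (\<lambda>x. f x + g x) \<in> polyfun I"
| mult: "f \<in> polyfun I \<Longrightarrow> g \<in> polyfun I \<Longrightarrow> (\<lambda>x. f x * g x) \<in> polyfun I"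

lemma polyfun_sum: "(\<And>a. a \<in> S \<Longrightarrow> f a \<in> polyfun I) \<Longrightarrow> (\<lambda>x. \<Sum>a\<in>S. f a x) \<in> polyfun I"
  by (induction S rule: infinite_finite_induct) (auto intro: polyfun.intros)

lemma polyfun_prod: "(\<And>a. a \<in> S \<Longrightarrow> f a \<in> polyfun I) \<Longrightarrow> (\<lambda>x. \<Prod>a\<in>S. f a x) \<in> polyfun I"
  by (induction S rule: infinite_finite_induct) (auto intro: polyfun.intros)

lemma polyfun_power: "f \<in> polyfun I \<Longrightarrow> (\<lambda>x. f x ^ k) \<in> polyfun I"
  by (induction k) (auto intro: polyfun.intros)

lemma polyfun_diff: "f \<in> polyfun I \<Longrightarrow> g \<in> polyfun I \<Longrightarrow> (\<lambda>x. f x - g x) \<in> polyfun I"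
  using polyfun.add[of f I "\<lambda>x. (-1) * g x"] polyfun.mult[OF polyfun.const[of "-1"], of g] by simp

lemma polyfun_cong: "f \<in> polyfun I \<Longrightarrow> (\<And>i. i \<in> I \<Longrightarrow> x i = y i) \<Longrightarrow> f x = f y"
  by (induction rule: polyfun.induct) auto

definition line :: "('i \<Rightarrow> real) \<Rightarrow> ('i \<Rightarrow> real) \<Rightarrow> real \<Rightarrow> 'i \<Rightarrow> real" where
  "line x v t = (\<lambda>i. x i + t * v i)"

lemma polyfun_line:
  assumes "f \<in> polyfun I"
  shows "\<exists>q. \<forall>t. f (line x v t) = poly q t"
  using assms
proof induction
  case (const c)
  show ?case by (intro exI[of _ "[:c:]"]) auto
next
  case (coord i)
  show ?case by (intro exI[of _ "[:x i, v i:]"]) (auto simp: line_def)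
next
  case (add f g)
  then obtain q r where "\<And>t. f (line x v t) = poly q t" "\<And>t. g (line x v t) = poly r t" by blast
  then show ?case by (intro exI[of _ "q + r"]) simp
next
  case (mult f g)
  then obtain q r where "\<And>t. f (line x v t) = poly q t" "\<And>t. g (line x v t) = poly r t" by blast
  then show ?case by (intro exI[of _ "q * r"]) simp
qed

text \<open>On the segment joining a point where the earlier product is nonzero to one where the new
  factor is nonzero, both are nonzero univariate polynomials, so only finitely many points are bad.
  Convexity of \<open>U\<close> keeps the segment inside \<open>U\<close>.\<close>

lemma polyfun_prod_nonzero:
  fixes U :: "('i \<Rightarrow> real) set"
  assumes "finite S" and "\<And>a. a \<in> S \<Longrightarrow> g a \<in> polyfun I"
    and "\<And>a. a \<in> S \<Longrightarrow> \<exists>x\<in>U. g a x \<noteq> 0"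
    and "U \<noteq> {}"
    and conv: "\<And>x y t. x \<in> U \<Longrightarrow> y \<in> U \<Longrightarrow> 0 < t \<Longrightarrow> t < 1 \<Longrightarrow> line x (\<lambda>i. y i - x i) t \<in> U"
  shows "\<exists>x\<in>U. (\<Prod>a\<in>S. g a x) \<noteq> 0"
  using assms(1-3)
proof induction
  case empty
  then show ?case using assms(4) by auto
next
  case (insert a S)
  then obtain x where x: "x \<in> U" "(\<Prod>a\<in>S. g a x) \<noteq> 0" by auto
  obtain y where y: "y \<in> U" "g a y \<noteq> 0" using insert.prems by blast
  let ?v = "\<lambda>i. y i - x i"
  have 0: "line x ?v 0 = x" and 1: "line x ?v 1 = y" by (auto simp: line_def)
  have "(\<lambda>x. \<Prod>a\<in>S. g a x) \<in> polyfun I"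
    by (rule polyfun_prod) (use insert in auto)
  from polyfun_line[OF this] obtain q where q: "\<And>t. (\<Prod>a\<in>S. g a (line x ?v t)) = poly q t"
    by blast
  obtain r where r: "\<And>t. g a (line x ?v t) = poly r t"
    using polyfun_line[of "g a" I] insert.prems by blast
  have "q \<noteq> 0" "r \<noteq> 0" using q[of 0] r[of 1] x y 0 1 by auto
  hence "finite {t. poly (q * r) t = 0}" by (intro poly_roots_finite) auto
  hence "infinite ({0<..<1} - {t. poly (q * r) t = 0})"
    by (intro Diff_infinite_finite infinite_Ioo) auto
  then obtain t where t: "t \<in> {0<..<1} - {t. poly (q * r) t = 0}"
    using infinite_imp_nonempty by blast
  have "(\<Prod>b\<in>insert a S. g b (line x ?v t)) = poly (q * r) t"
    using insert.hyps by (simp add: q r mult.commute)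
  moreover have "line x ?v t \<in> U" by (rule conv) (use x y t in auto)
  ultimately show ?case using t by (intro bexI[of _ "line x ?v t"]) auto
qed

text \<open>One linear form \<open>l\<close> serves all directions \<open>v\<close>. This linearity
  is what later turns the derivative of the cumulants into a matrix with a left inverse.\<close>

lemma polyfun_has_gradient:
  assumes "finite I" "f \<in> polyfun I"
  shows "\<exists>l. \<forall>v. ((\<lambda>t. f (line x v t)) has_real_derivative (\<Sum>i\<in>I. l i * v i)) (at 0)"
  using assms(2)
proof induction
  case (const c)
  show ?case by (intro exI[of _ "\<lambda>_. 0"]) simp
next
  case (coord i)
  have "((\<lambda>t. x i + t * v i) has_real_derivative v i) (at 0)" for v
    by (auto intro!: derivative_eq_intros)
  moreover have "(\<Sum>j\<in>I. (if j = i then 1 else 0) * v j) = v i" for v :: "'a \<Rightarrow> real"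
  proof -
    have "(\<Sum>j\<in>I. (if j = i then 1 else 0) * v j) = (\<Sum>j\<in>I. if j = i then v j else 0)"
      by (intro sum.cong) auto
    then show ?thesis using coord assms(1) by simp
  qed
  ultimately show ?case
    by (intro exI[of _ "\<lambda>j. if j = i then 1 else 0"]) (simp add: line_def)
next
  case (add f g)
  then obtain l k where
    l: "\<And>v. ((\<lambda>t. f (line x v t)) has_real_derivative (\<Sum>i\<in>I. l i * v i)) (at 0)" and
    k: "\<And>v. ((\<lambda>t. g (line x v t)) has_real_derivative (\<Sum>i\<in>I. k i * v i)) (at 0)"
    by blast
  show ?case
    using DERIV_add[OF l k]
    by (intro exI[of _ "\<lambda>i. l i + k i"]) (simp add: sum.distrib distrib_right)
next
  case (mult f g)
  then obtain l k where
    l: "\<And>v. ((\<lambda>t. f (line x v t)) has_real_derivative (\<Sum>i\<in>I. l i * v i)) (at 0)" and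
    k: "\<And>v. ((\<lambda>t. g (line x v t)) has_real_derivative (\<Sum>i\<in>I. k i * v i)) (at 0)"
    by blast
  have 0: "line x v 0 = x" for v by (auto simp: line_def)
  have "((\<lambda>t. f (line x v t) * g (line x v t)) has_real_derivative
      (\<Sum>i\<in>I. (l i * g x + k i * f x) * v i)) (at 0)" for v
    using DERIV_mult[OF l[of v] k[of v]]
    by (simp add: 0 sum.distrib algebra_simps sum_distrib_left)
  then show ?case by (intro exI[of _ "\<lambda>i. l i * g x + k i * f x"]) simp
qed

section \<open>Rational functions without poles on a given set\<close>

text \<open>The identity between numerator and denominator is required on \<open>D\<close> only.
  Elsewhere the function is arbitrary, which suits cumulants: outside the stable parameters the
  inverse in their definition need not exist.\<close>

definition ratfun :: "'i set \<Rightarrow> ('i \<Rightarrow> real) set \<Rightarrow> (('i \<Rightarrow> real) \<Rightarrow> real) \<Rightarrow> bool" where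
  "ratfun I D f \<longleftrightarrow>
     (\<exists>num\<in>polyfun I. \<exists>den\<in>polyfun I. \<forall>x\<in>D. den x \<noteq> 0 \<and> f x * den x = num x)"

lemma ratfun_polyfun: "f \<in> polyfun I \<Longrightarrow> ratfun I D f"
  unfolding ratfun_def by (intro bexI[of _ f] bexI[of _ "\<lambda>_. 1"]) (auto intro: polyfun.const)

lemma ratfunI:
  assumes "num \<in> polyfun I" "den \<in> polyfun I"
    and "\<And>x. x \<in> D \<Longrightarrow> den x \<noteq> 0" "\<And>x. x \<in> D \<Longrightarrow> f x * den x = num x"
  shows "ratfun I D f"
  using assms unfolding ratfun_def by blast

lemma ratfunE:
  assumes "ratfun I D f"
  obtains num den where "num \<in> polyfun I" "den \<in> polyfun I"
    "\<And>x. x \<in> D \<Longrightarrow> den x \<noteq> 0" "\<And>x. x \<in> D \<Longrightarrow> f x * den x = num x"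
  using assms unfolding ratfun_def by blast

lemma ratfun_add:
  assumes "ratfun I D f" "ratfun I D g" shows "ratfun I D (\<lambda>x. f x + g x)"
proof -
  obtain n d where 1: "n \<in> polyfun I" "d \<in> polyfun I"
    "\<And>x. x \<in> D \<Longrightarrow> d x \<noteq> 0" "\<And>x. x \<in> D \<Longrightarrow> f x * d x = n x"
    using assms(1) by (elim ratfunE) (rule that)
  obtain m e where 2: "m \<in> polyfun I" "e \<in> polyfun I"
    "\<And>x. x \<in> D \<Longrightarrow> e x \<noteq> 0" "\<And>x. x \<in> D \<Longrightarrow> g x * e x = m x"
    using assms(2) by (elim ratfunE) (rule that)
  show ?thesis
  proof (rule ratfunI)
    show "(\<lambda>x. n x * e x + m x * d x) \<in> polyfun I" "(\<lambda>x. d x * e x) \<in> polyfun I"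
      by (intro polyfun.intros 1 2)+
  qed (simp_all add: 1(3) 2(3) 1(4)[symmetric] 2(4)[symmetric] algebra_simps)
qed

lemma ratfun_mult:
  assumes "ratfun I D f" "ratfun I D g" shows "ratfun I D (\<lambda>x. f x * g x)"
proof -
  obtain n d where 1: "n \<in> polyfun I" "d \<in> polyfun I"
    "\<And>x. x \<in> D \<Longrightarrow> d x \<noteq> 0" "\<And>x. x \<in> D \<Longrightarrow> f x * d x = n x"
    using assms(1) by (elim ratfunE) (rule that)
  obtain m e where 2: "m \<in> polyfun I" "e \<in> polyfun I"
    "\<And>x. x \<in> D \<Longrightarrow> e x \<noteq> 0" "\<And>x. x \<in> D \<Longrightarrow> g x * e x = m x"
    using assms(2) by (elim ratfunE) (rule that)
  show ?thesis
  proof (rule ratfunI)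
    show "(\<lambda>x. n x * m x) \<in> polyfun I" "(\<lambda>x. d x * e x) \<in> polyfun I"
      by (intro polyfun.intros 1 2)+
  qed (simp_all add: 1(3) 2(3) 1(4)[symmetric] 2(4)[symmetric] algebra_simps)
qed

lemma ratfun_const: "ratfun I D (\<lambda>_. c)"
  by (intro ratfun_polyfun polyfun.const)

lemma ratfun_diff:
  assumes "ratfun I D f" "ratfun I D g" shows "ratfun I D (\<lambda>x. f x - g x)"
  using ratfun_add[OF assms(1) ratfun_mult[OF ratfun_const[of _ _ "-1"] assms(2)]] by simp

lemma ratfun_sum: "(\<And>a. a \<in> S \<Longrightarrow> ratfun I D (f a)) \<Longrightarrow> ratfun I D (\<lambda>x. \<Sum>a\<in>S. f a x)"
  by (induction S rule: infinite_finite_induct) (auto intro: ratfun_add ratfun_const)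

lemma ratfun_prod: "(\<And>a. a \<in> S \<Longrightarrow> ratfun I D (f a)) \<Longrightarrow> ratfun I D (\<lambda>x. \<Prod>a\<in>S. f a x)"
  by (induction S rule: infinite_finite_induct) (auto intro: ratfun_mult ratfun_const)

lemma ratfun_cong: "(\<And>x. x \<in> D \<Longrightarrow> f x = g x) \<Longrightarrow> ratfun I D f \<longleftrightarrow> ratfun I D g"
  unfolding ratfun_def by auto

lemma ratfun_divide_polyfun:
  assumes "ratfun I D (\<lambda>x. f x * d x)" "d \<in> polyfun I" "\<And>x. x \<in> D \<Longrightarrow> d x \<noteq> 0"
  shows "ratfun I D f"
proof -
  obtain n e where "n \<in> polyfun I" "e \<in> polyfun I"
    "\<And>x. x \<in> D \<Longrightarrow> e x \<noteq> 0" "\<And>x. x \<in> D \<Longrightarrow> f x * d x * e x = n x"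
    using assms(1) by (elim ratfunE) (rule that)
  then show ?thesis
    by (intro ratfunI[of n _ "\<lambda>x. d x * e x"] polyfun.mult assms)
      (simp_all add: assms(3) mult.assoc)
qed

lemma ratfun_common_denominator:
  assumes "finite S" "\<And>a. a \<in> S \<Longrightarrow> ratfun I D (f a)"
  obtains den num where "den \<in> polyfun I" "\<And>a. a \<in> S \<Longrightarrow> num a \<in> polyfun I"
    "\<And>x. x \<in> D \<Longrightarrow> den x \<noteq> 0" "\<And>a x. a \<in> S \<Longrightarrow> x \<in> D \<Longrightarrow> f a x * den x = num a x"
proof -
  have "\<exists>nd. fst nd \<in> polyfun I \<and> snd nd \<in> polyfun I \<and>
      (\<forall>x\<in>D. snd nd x \<noteq> 0 \<and> f a x * snd nd x = fst nd x)" if "a \<in> S" for a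
  proof -
    obtain n d where "n \<in> polyfun I" "d \<in> polyfun I"
      "\<And>x. x \<in> D \<Longrightarrow> d x \<noteq> 0" "\<And>x. x \<in> D \<Longrightarrow> f a x * d x = n x"
      using assms(2)[OF \<open>a \<in> S\<close>] by (elim ratfunE) (rule that)
    then show ?thesis by (intro exI[of _ "(n, d)"]) simp
  qed
  then have "\<forall>a\<in>S. \<exists>nd. fst nd \<in> polyfun I \<and> snd nd \<in> polyfun I \<and>
      (\<forall>x\<in>D. snd nd x \<noteq> 0 \<and> f a x * snd nd x = fst nd x)" by simp
  from bchoice[OF this] obtain nd where nd': "\<forall>a\<in>S. fst (nd a) \<in> polyfun I \<and> snd (nd a) \<in> polyfun I \<and>
      (\<forall>x\<in>D. snd (nd a) x \<noteq> 0 \<and> f a x * snd (nd a) x = fst (nd a) x)" ..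
  define n where "n a = fst (nd a)" for a
  define d where "d a = snd (nd a)" for a
  have nd: "\<And>a. a \<in> S \<Longrightarrow> n a \<in> polyfun I" "\<And>a. a \<in> S \<Longrightarrow> d a \<in> polyfun I"
      "\<And>a x. a \<in> S \<Longrightarrow> x \<in> D \<Longrightarrow> d a x \<noteq> 0"
      "\<And>a x. a \<in> S \<Longrightarrow> x \<in> D \<Longrightarrow> f a x * d a x = n a x"
    using nd' unfolding n_def d_def by simp_all
  show ?thesis
  proof (rule that[of "\<lambda>x. \<Prod>a\<in>S. d a x" "\<lambda>a x. n a x * (\<Prod>b\<in>S-{a}. d b x)"])
    show "(\<lambda>x. \<Prod>a\<in>S. d a x) \<in> polyfun I" by (intro polyfun_prod nd)
    show "(\<lambda>x. n a x * (\<Prod>b\<in>S-{a}. d b x)) \<in> polyfun I" if "a \<in> S" for a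
      by (intro polyfun.mult polyfun_prod nd that) auto
    show "(\<Prod>a\<in>S. d a x) \<noteq> 0" if "x \<in> D" for x using nd(3) that assms(1) by simp
    show "f a x * (\<Prod>a\<in>S. d a x) = n a x * (\<Prod>b\<in>S-{a}. d b x)" if "a \<in> S" "x \<in> D" for a x
      using nd(4)[OF that, symmetric] prod.remove[OF assms(1) that(1), of "\<lambda>a. d a x"] by simp
  qed
qed

lemma ratfun_has_gradient:
  assumes "finite I" "ratfun I D f" and near: "\<And>v. \<forall>\<^sub>F t in at 0. line x v t \<in> D" and "x \<in> D"
  shows "\<exists>l. \<forall>v. ((\<lambda>t. f (line x v t)) has_real_derivative (\<Sum>i\<in>I. l i * v i)) (at 0)"
proof -
  obtain n d where nd: "n \<in> polyfun I" "d \<in> polyfun I"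
    "\<And>x. x \<in> D \<Longrightarrow> d x \<noteq> 0" "\<And>x. x \<in> D \<Longrightarrow> f x * d x = n x"
    using assms(2) by (elim ratfunE) (rule that)
  obtain l where l: "\<And>v. ((\<lambda>t. n (line x v t)) has_real_derivative (\<Sum>i\<in>I. l i * v i)) (at 0)"
    using polyfun_has_gradient[OF assms(1) nd(1)] by blast
  obtain k where k: "\<And>v. ((\<lambda>t. d (line x v t)) has_real_derivative (\<Sum>i\<in>I. k i * v i)) (at 0)"
    using polyfun_has_gradient[OF assms(1) nd(2)] by blast
  have x0: "line x v 0 = x" for v by (auto simp: line_def)
  have eq: "f (line x v t) = n (line x v t) / d (line x v t)" if "line x v t \<in> D" for v t
    using nd(3,4)[OF that] by (simp add: field_simps)
  show ?thesis
  proof (intro exI allI)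
    fix v
    have "((\<lambda>t. n (line x v t) / d (line x v t)) has_real_derivative
       ((\<Sum>i\<in>I. l i * v i) * d x - n x * (\<Sum>i\<in>I. k i * v i)) / (d x * d x)) (at 0)"
      using DERIV_divide[OF l[of v] k[of v]] nd(3) assms(4) by (simp add: x0)
    also have "((\<Sum>i\<in>I. l i * v i) * d x - n x * (\<Sum>i\<in>I. k i * v i)) / (d x * d x)
      = (\<Sum>i\<in>I. (l i * d x - n x * k i) / (d x * d x) * v i)"
      unfolding sum_distrib_left sum_distrib_right sum_subtractf[symmetric] sum_divide_distrib
      by (intro sum.cong refl) (simp add: algebra_simps)
    finally have *: "((\<lambda>t. n (line x v t) / d (line x v t)) has_real_derivative
       (\<Sum>i\<in>I. (l i * d x - n x * k i) / (d x * d x) * v i)) (at 0)" .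
    have "\<forall>\<^sub>F t in nhds 0. line x v t \<in> D"
      using near[of v] x0[of v] assms(4) by (simp add: eventually_nhds_conv_at)
    then have "\<forall>\<^sub>F t in nhds 0. f (line x v t) = n (line x v t) / d (line x v t)"
      by eventually_elim (simp add: eq)
    from DERIV_cong_ev[OF refl this refl] *
    show "((\<lambda>t. f (line x v t)) has_real_derivative
       (\<Sum>i\<in>I. (l i * d x - n x * k i) / (d x * d x) * v i)) (at 0)" by simp
  qed
qed

section \<open>Algebraic dependence\<close>

text \<open>Gaussian elimination over the equations \<open>J\<close>: with a pivot
  \<open>m i0 j0\<close>, equation \<open>j0\<close> eliminates the unknown \<open>i0\<close>,
  leaving one equation and one unknown fewer. The value of \<open>c'\<close> at \<open>i0\<close> is
  the one that restores equation \<open>j0\<close>.\<close>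

lemma homogeneous_system_nontrivial:
  fixes m :: "'a \<Rightarrow> 'b \<Rightarrow> real"
  assumes "finite J" "finite I" "card J < card I"
  shows "\<exists>c. (\<exists>i\<in>I. c i \<noteq> 0) \<and> (\<forall>j\<in>J. (\<Sum>i\<in>I. c i * m i j) = 0)"
  using assms
proof (induction J arbitrary: I m)
  case empty
  then have "I \<noteq> {}" by auto
  then show ?case by (intro exI[of _ "\<lambda>_. 1"]) auto
next
  case (insert j0 J)
  show ?case
  proof (cases "\<forall>i\<in>I. m i j0 = 0")
    case True
    have "card J < card I" using insert.prems insert.hyps by simp
    from insert.IH[OF insert.prems(1) this, of m] obtain c
      where c: "\<exists>i\<in>I. c i \<noteq> 0" "\<forall>j\<in>J. (\<Sum>i\<in>I. c i * m i j) = 0" by blast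
    then show ?thesis using True by (intro exI[of _ c]) simp
  next
    case False
    then obtain i0 where i0: "i0 \<in> I" "m i0 j0 \<noteq> 0" by blast
    let ?I = "I - {i0}"
    let ?m = "\<lambda>i j. m i j - m i j0 / m i0 j0 * m i0 j"
    have "finite ?I" "card J < card ?I" using insert.prems insert.hyps i0 by simp_all
    from insert.IH[OF this, of ?m] obtain c
      where c: "\<exists>i\<in>?I. c i \<noteq> 0" "\<forall>j\<in>J. (\<Sum>i\<in>?I. c i * ?m i j) = 0" by blast
    define c' where "c' i = (if i = i0 then - (\<Sum>i\<in>?I. c i * m i j0 / m i0 j0) else c i)" for i
    have "(\<Sum>i\<in>I. c' i * m i j) = (\<Sum>i\<in>?I. c i * ?m i j)" for j
    proof -
      have "(\<Sum>i\<in>I. c' i * m i j) = c' i0 * m i0 j + (\<Sum>i\<in>?I. c i * m i j)"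
        using insert.prems(1) i0(1)
        by (subst sum.remove[of I i0]) (auto simp: c'_def intro!: sum.cong)
      then show ?thesis
        by (simp add: c'_def sum_distrib_right sum_distrib_left right_diff_distrib sum_subtractf mult_ac)
    qed
    moreover have "(\<Sum>i\<in>?I. c i * ?m i j0) = 0" using i0 by simp
    moreover have "\<exists>i\<in>I. c' i \<noteq> 0" using c(1) by (auto simp: c'_def)
    ultimately show ?thesis using c(2) by (intro exI[of _ c']) auto
  qed
qed

section \<open>Degrees in single coordinates and vanishing on grids\<close>

text \<open>The functions carry no syntactic polynomial, so the degree is read off on coordinate
  lines. Bounding each coordinate separately, and not the total degree, fits the grid argument
  below.\<close>

definition coord_degree_le :: "'i set \<Rightarrow> nat \<Rightarrow> (('i \<Rightarrow> real) \<Rightarrow> real) \<Rightarrow> bool" where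
  "coord_degree_le I N f \<longleftrightarrow>
     (\<forall>i\<in>I. \<forall>x. \<exists>q. degree q \<le> N \<and> (\<forall>t. f (x(i := t)) = poly q t))"

lemma coord_degree_le_mono: "coord_degree_le I N f \<Longrightarrow> N \<le> M \<Longrightarrow> coord_degree_le I M f"
  unfolding coord_degree_le_def by (meson order_trans)

lemma coord_degree_le_const: "coord_degree_le I N (\<lambda>_. c)"
  unfolding coord_degree_le_def by (auto intro!: exI[of _ "[:c:]"])

lemma coord_degree_le_coord: "coord_degree_le I 1 (\<lambda>x. x i)"
  unfolding coord_degree_le_def
proof (intro ballI allI)
  fix j and x :: "'a \<Rightarrow> real"
  show "\<exists>q. degree q \<le> 1 \<and> (\<forall>t. (x(j := t)) i = poly q t)"
    by (intro exI[of _ "if i = j then [:0, 1:] else [:x i:]"]) auto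
qed

lemma coord_degree_le_add:
  assumes "coord_degree_le I N f" "coord_degree_le I N g"
  shows "coord_degree_le I N (\<lambda>x. f x + g x)"
  unfolding coord_degree_le_def
proof (intro ballI allI)
  fix i x assume "i \<in> I"
  then obtain q r where "degree q \<le> N" "\<And>t. f (x(i := t)) = poly q t"
    "degree r \<le> N" "\<And>t. g (x(i := t)) = poly r t"
    using assms unfolding coord_degree_le_def by metis
  then show "\<exists>q. degree q \<le> N \<and> (\<forall>t. f (x(i := t)) + g (x(i := t)) = poly q t)"
    by (intro exI[of _ "q + r"]) (auto intro: degree_add_le)
qed

lemma coord_degree_le_mult:
  assumes "coord_degree_le I N f" "coord_degree_le I M g"
  shows "coord_degree_le I (N + M) (\<lambda>x. f x * g x)"
  unfolding coord_degree_le_def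
proof (intro ballI allI)
  fix i x assume "i \<in> I"
  then obtain q r where "degree q \<le> N" "\<And>t. f (x(i := t)) = poly q t"
    "degree r \<le> M" "\<And>t. g (x(i := t)) = poly r t"
    using assms unfolding coord_degree_le_def by metis
  then show "\<exists>q. degree q \<le> N + M \<and> (\<forall>t. f (x(i := t)) * g (x(i := t)) = poly q t)"
    by (intro exI[of _ "q * r"]) (auto intro: order_trans[OF degree_mult_le])
qed

lemma coord_degree_le_sum:
  "(\<And>a. a \<in> S \<Longrightarrow> coord_degree_le I N (f a)) \<Longrightarrow> coord_degree_le I N (\<lambda>x. \<Sum>a\<in>S. f a x)"
  by (induction S rule: infinite_finite_induct)
    (auto intro: coord_degree_le_add coord_degree_le_const)

lemma coord_degree_le_prod:
  "(\<And>a. a \<in> S \<Longrightarrow> coord_degree_le I (N a) (f a)) \<Longrightarrow>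
    coord_degree_le I (\<Sum>a\<in>S. N a) (\<lambda>x. \<Prod>a\<in>S. f a x)"
  by (induction S rule: infinite_finite_induct)
    (auto intro: coord_degree_le_mult coord_degree_le_const)

lemma coord_degree_le_power:
  "coord_degree_le I N f \<Longrightarrow> coord_degree_le I (k * N) (\<lambda>x. f x ^ k)"
  by (induction k) (auto intro: coord_degree_le_mult coord_degree_le_const)

lemma polyfun_coord_degree: "f \<in> polyfun I \<Longrightarrow> \<exists>N. coord_degree_le I N f"
proof (induction rule: polyfun.induct)
  case (add f g)
  then obtain N M where "coord_degree_le I N f" "coord_degree_le I M g" by blast
  then have "coord_degree_le I (max N M) (\<lambda>x. f x + g x)"
    by (intro coord_degree_le_add) (auto intro: coord_degree_le_mono)
  then show ?case by blast
qed (blast intro: coord_degree_le_const coord_degree_le_coord coord_degree_le_mult)+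

text \<open>The coordinates in \<open>S\<close> are released from the grid one at a time. On each
  coordinate line the function has degree at most \<open>N\<close> and the N + 1 roots 0, ..., N, so
  it vanishes on the whole line.\<close>

lemma polynomial_vanishing_on_grid:
  assumes "finite I" "coord_degree_le I N f"
    and "\<And>x. (\<And>i. i \<in> I \<Longrightarrow> x i \<in> real ` {..N}) \<Longrightarrow> f x = 0"
  shows "f x = 0"
proof -
  have "\<forall>x. (\<forall>i\<in>I - S. x i \<in> real ` {..N}) \<longrightarrow> f x = 0" if "finite S" "S \<subseteq> I" for S
    using that
  proof induction
    case empty
    then show ?case using assms(3) by auto
  next
    case (insert a S)
    show ?case
    proof (intro allI impI)
      fix x assume x: "\<forall>i\<in>I - insert a S. x i \<in> real ` {..N}"
      obtain q where q: "degree q \<le> N" "\<And>t. f (x(a := t)) = poly q t"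
        using assms(2) insert.prems unfolding coord_degree_le_def by blast
      have "poly q t = 0" if "t \<in> real ` {..N}" for t
        using insert.IH insert.prems x that unfolding q(2)[symmetric] by auto
      then have "real ` {..N} \<subseteq> {t. poly q t = 0}" by blast
      moreover have "card (real ` {..N}) = Suc N" by (subst card_image) (auto intro: inj_onI)
      ultimately have "q = 0"
        using q(1) poly_roots_degree[of q] card_mono[OF poly_roots_finite[of q]]
        by (metis Suc_n_not_le_n order_trans)
      then show "f x = 0" using q(2)[of "x a"] by simp
    qed
  qed
  from this[OF assms(1) subset_refl] show ?thesis by simp
qed

text \<open>Induction over the variables: the sum is a univariate polynomial in the value of the new
  variable \<open>a\<close>, with sums of the same kind in the old variables as coefficients. The
  induction hypothesis makes the coefficient at exponent \<open>j0\<close> nonzero, and then all but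
  finitely many values of the new variable will do.\<close>

lemma monomials_independent:
  fixes c :: "('i \<Rightarrow> nat) \<Rightarrow> real"
  assumes "finite I" "\<exists>\<alpha>\<in>PiE I (\<lambda>_. {..k}). c \<alpha> \<noteq> 0"
  shows "\<exists>v. (\<Sum>\<alpha>\<in>PiE I (\<lambda>_. {..k}). c \<alpha> * (\<Prod>i\<in>I. v i ^ \<alpha> i)) \<noteq> 0"
  using assms
proof (induction I arbitrary: c)
  case empty
  then show ?case by (auto simp: PiE_empty_domain)
next
  case (insert a I)
  let ?P = "PiE I (\<lambda>_. {..k})"
  from insert.prems obtain \<alpha> where \<alpha>: "\<alpha> \<in> PiE (insert a I) (\<lambda>_. {..k})" "c \<alpha> \<noteq> 0" by blast
  obtain j0 \<beta> where "j0 \<le> k" "\<beta> \<in> ?P" "\<alpha> = \<beta>(a := j0)"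
    using \<alpha>(1) unfolding PiE_insert_eq by auto
  with \<alpha> have "\<exists>\<beta>\<in>?P. c (\<beta>(a := j0)) \<noteq> 0" by blast
  from insert.IH[OF this] obtain v
    where v: "(\<Sum>\<beta>\<in>?P. c (\<beta>(a := j0)) * (\<Prod>i\<in>I. v i ^ \<beta> i)) \<noteq> 0" by blast
  define q where "q = (\<Sum>j\<le>k. monom (\<Sum>\<beta>\<in>?P. c (\<beta>(a := j)) * (\<Prod>i\<in>I. v i ^ \<beta> i)) j)"
  have "coeff q j0 \<noteq> 0" using v \<open>j0 \<le> k\<close> by (simp add: q_def coeff_sum coeff_monom)
  then have "q \<noteq> 0" by auto
  then have "finite {t. poly q t = 0}" by (rule poly_roots_finite)
  then obtain t where t: "poly q t \<noteq> 0" using infinite_UNIV_char_0 by (metis (mono_tags) UNIV_eq_I mem_Collect_eq)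
  have "(\<Sum>\<alpha>\<in>PiE (insert a I) (\<lambda>_. {..k}). c \<alpha> * (\<Prod>i\<in>insert a I. (v(a := t)) i ^ \<alpha> i))
     = (\<Sum>(j, \<beta>)\<in>{..k} \<times> ?P. c (\<beta>(a := j)) * (\<Prod>i\<in>insert a I. (v(a := t)) i ^ (\<beta>(a := j)) i))"
    unfolding PiE_insert_eq
    by (subst sum.reindex[OF inj_combinator[OF insert.hyps(2)]]) (simp add: case_prod_unfold comp_def)
  also have "\<dots> = (\<Sum>(j, \<beta>)\<in>{..k} \<times> ?P. c (\<beta>(a := j)) * (\<Prod>i\<in>I. v i ^ \<beta> i) * t ^ j)"
  proof (intro sum.cong refl, clarify)
    fix j \<beta>
    have "(\<Prod>i\<in>I. (v(a := t)) i ^ (\<beta>(a := j)) i) = (\<Prod>i\<in>I. v i ^ \<beta> i)"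
      using insert.hyps by (intro prod.cong) auto
    then show "c (\<beta>(a := j)) * (\<Prod>i\<in>insert a I. (v(a := t)) i ^ (\<beta>(a := j)) i)
      = c (\<beta>(a := j)) * (\<Prod>i\<in>I. v i ^ \<beta> i) * t ^ j"
      using insert.hyps by simp
  qed
  also have "\<dots> = poly q t"
    by (simp add: q_def poly_sum poly_monom sum.cartesian_product sum_distrib_right)
  finally show ?case using t by (intro exI[of _ "v(a := t)"]) simp
qed

text \<open>On a line through x0 at step t, a monomial of degree d in the functions is t ^ d times the same
  monomial in the direction, up to higher order in t. So the lowest-degree part of a relation is a
  polynomial vanishing at all directions.\<close>

lemma near_identity_independent:
  fixes \<psi> :: "'i \<Rightarrow> ('i \<Rightarrow> real) \<Rightarrow> real" and c :: "('i \<Rightarrow> nat) \<Rightarrow> real"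
  assumes "finite I" "\<exists>\<alpha>\<in>PiE I (\<lambda>_. {..k}). c \<alpha> \<noteq> 0"
    and near: "\<And>v. \<forall>\<^sub>F t in at 0. line x0 v t \<in> U"
    and deriv: "\<And>v i. i \<in> I \<Longrightarrow> ((\<lambda>t. \<psi> i (line x0 v t) / t) \<longlongrightarrow> v i) (at 0)"
  shows "\<exists>x\<in>U. (\<Sum>\<alpha>\<in>PiE I (\<lambda>_. {..k}). c \<alpha> * (\<Prod>i\<in>I. \<psi> i x ^ \<alpha> i)) \<noteq> 0"
proof -
  let ?P = "PiE I (\<lambda>_. {..k})"
  define deg where "deg \<alpha> = (\<Sum>i\<in>I. \<alpha> i)" for \<alpha> :: "'i \<Rightarrow> nat"
  define d where "d = (LEAST d. \<exists>\<alpha>\<in>?P. c \<alpha> \<noteq> 0 \<and> deg \<alpha> = d)"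
  have "\<exists>d. \<exists>\<alpha>\<in>?P. c \<alpha> \<noteq> 0 \<and> deg \<alpha> = d" using assms(2) by blast
  from LeastI_ex[OF this] obtain \<alpha>0 where \<alpha>0: "\<alpha>0 \<in> ?P" "c \<alpha>0 \<noteq> 0" "deg \<alpha>0 = d"
    unfolding d_def by blast
  have d_le: "d \<le> deg \<alpha>" if "\<alpha> \<in> ?P" "c \<alpha> \<noteq> 0" for \<alpha>
    unfolding d_def using that by (intro Least_le) blast
  \<comment> \<open>As 0 ^ 0 = 1, the extra factor is 1 in minimal degree \<open>d\<close> and 0
    above it; it is the limit of \<open>t ^ (deg \<alpha> - d)\<close> at t = 0. Truncated
    subtraction does no harm, since degrees below \<open>d\<close> occur only with coefficient
    0.\<close>
  define c' where "c' \<alpha> = c \<alpha> * 0 ^ (deg \<alpha> - d)" for \<alpha>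
  have "\<exists>\<alpha>\<in>?P. c' \<alpha> \<noteq> 0" using \<alpha>0 by (intro bexI[of _ \<alpha>0]) (auto simp: c'_def)
  from monomials_independent[OF assms(1) this] obtain v
    where v: "(\<Sum>\<alpha>\<in>?P. c' \<alpha> * (\<Prod>i\<in>I. v i ^ \<alpha> i)) \<noteq> 0" by blast
  let ?f = "\<lambda>t. \<Sum>\<alpha>\<in>?P. c \<alpha> * (\<Prod>i\<in>I. \<psi> i (line x0 v t) ^ \<alpha> i)"
  have "((\<lambda>t. \<Sum>\<alpha>\<in>?P. c \<alpha> * t ^ (deg \<alpha> - d) * (\<Prod>i\<in>I. (\<psi> i (line x0 v t) / t) ^ \<alpha> i))
      \<longlongrightarrow> (\<Sum>\<alpha>\<in>?P. c \<alpha> * 0 ^ (deg \<alpha> - d) * (\<Prod>i\<in>I. v i ^ \<alpha> i))) (at 0)"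
    by (intro tendsto_sum tendsto_mult tendsto_prod tendsto_power tendsto_const tendsto_ident_at deriv)
  then have "\<forall>\<^sub>F t in at 0.
      (\<Sum>\<alpha>\<in>?P. c \<alpha> * t ^ (deg \<alpha> - d) * (\<Prod>i\<in>I. (\<psi> i (line x0 v t) / t) ^ \<alpha> i)) \<noteq> 0"
    using v unfolding c'_def by (rule tendsto_imp_eventually_ne)
  moreover have "\<forall>\<^sub>F t :: real in at 0. t \<noteq> 0" by (simp add: eventually_at_filter)
  ultimately have "\<forall>\<^sub>F t in at 0. line x0 v t \<in> U \<and> ?f t \<noteq> 0"
    using near[of v]
  proof eventually_elim
    case (elim t)
    have "c \<alpha> * (\<Prod>i\<in>I. \<psi> i (line x0 v t) ^ \<alpha> i)
      = t ^ d * (c \<alpha> * t ^ (deg \<alpha> - d) * (\<Prod>i\<in>I. (\<psi> i (line x0 v t) / t) ^ \<alpha> i))"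
      if "\<alpha> \<in> ?P" for \<alpha>
    proof (cases "c \<alpha> = 0")
      case False
      have "(\<Prod>i\<in>I. \<psi> i (line x0 v t) ^ \<alpha> i) = t ^ deg \<alpha> * (\<Prod>i\<in>I. (\<psi> i (line x0 v t) / t) ^ \<alpha> i)"
        using elim(2) unfolding deg_def power_sum prod.distrib[symmetric]
        by (intro prod.cong) (auto simp: power_divide)
      moreover have "t ^ deg \<alpha> = t ^ d * t ^ (deg \<alpha> - d)"
        using d_le[OF that False] by (simp flip: power_add)
      ultimately show ?thesis by simp
    qed simp
    then have "?f t = t ^ d * (\<Sum>\<alpha>\<in>?P. c \<alpha> * t ^ (deg \<alpha> - d) * (\<Prod>i\<in>I. (\<psi> i (line x0 v t) / t) ^ \<alpha> i))"
      unfolding sum_distrib_left by (rule sum.cong[OF refl])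
    with elim show ?case by simp
  qed
  then show ?thesis by (auto dest!: eventually_happens)
qed

section \<open>Algebraic relations by counting, and finite fibres\<close>

text \<open>Coordinate \<open>e\<close> and the functions \<psi> are n + 1 functions of n variables,
  hence algebraically dependent. Read as a polynomial in coordinate \<open>e\<close>, the relation
  has coefficients that depend on \<psi> alone and so are constant on fibres. Where one of them is
  nonzero, the values of coordinate \<open>e\<close> on the fibre are roots of one nonzero
  polynomial. The witness \<open>g\<close> is such a coefficient with denominators cleared.\<close>

lemma finite_fibre_coordinate:
  fixes \<psi> :: "'i \<Rightarrow> ('i \<Rightarrow> real) \<Rightarrow> real"
  assumes fin: "finite I" and rat: "\<And>i. i \<in> I \<Longrightarrow> ratfun I D (\<psi> i)" and e: "e \<in> I"
    and near: "\<And>v. \<forall>\<^sub>F t in at 0. line x0 v t \<in> U" and sub: "U \<subseteq> D"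
    and deriv: "\<And>v i. i \<in> I \<Longrightarrow> ((\<lambda>t. \<psi> i (line x0 v t) / t) \<longlongrightarrow> v i) (at 0)"
  shows "\<exists>g\<in>polyfun I. (\<exists>x\<in>U. g x \<noteq> 0) \<and>
    (\<forall>x\<in>D. g x \<noteq> 0 \<longrightarrow> finite {y e | y. y \<in> D \<and> (\<forall>i\<in>I. \<psi> i y = \<psi> i x)})"
proof -
  obtain den num where den: "den \<in> polyfun I" and num: "\<And>i. i \<in> I \<Longrightarrow> num i \<in> polyfun I"
    and den0: "\<And>x. x \<in> D \<Longrightarrow> den x \<noteq> 0"
    and frac: "\<And>i x. i \<in> I \<Longrightarrow> x \<in> D \<Longrightarrow> \<psi> i x * den x = num i x"
    by (rule ratfun_common_denominator[OF fin, of I D \<psi>, OF rat]) (assumption, rule that)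
  have "\<exists>d. \<forall>f\<in>insert den (num ` I). coord_degree_le I d f"
  proof -
    have "\<exists>d. \<forall>f\<in>S. coord_degree_le I d f" if "finite S" "S \<subseteq> polyfun I" for S
      using that
    proof induction
      case (insert f S)
      then obtain d d' where "\<forall>g\<in>S. coord_degree_le I d g" "coord_degree_le I d' f"
        using polyfun_coord_degree[of f I] by auto
      then show ?case
        by (intro exI[of _ "max d d'"]) (auto intro: coord_degree_le_mono)
    qed simp
    from this[of "insert den (num ` I)"] show ?thesis using fin den num by blast
  qed
  then obtain d where d: "coord_degree_le I d den" "\<And>i. i \<in> I \<Longrightarrow> coord_degree_le I d (num i)"
    by auto
  define n where "n = card I"
  \<comment> \<open>This s makes the (s + 1) ^ (n + 1) products F outnumber the (N + 1) ^ n grid points on which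
    polynomials of degree at most N in each coordinate are determined.\<close>
  define s where "s = (d * n + 1) ^ n"
  define N where "N = s + n * s * d"
  let ?P = "PiE I (\<lambda>_. {..s})"
  let ?A = "{..s} \<times> ?P"
  let ?G = "PiE I (\<lambda>_. real ` {..N})"
  \<comment> \<open>Padding with \<open>den ^ (s - \<alpha> i)\<close> makes
    \<open>M \<alpha>\<close> a polynomial that differs from the monomial in \<psi> by
    \<open>den ^ (n * s)\<close>, a factor independent of \<alpha>. A linear relation among the
    products \<open>F\<close> is therefore one among monomials.\<close>
  define M where "M \<alpha> x = (\<Prod>i\<in>I. num i x ^ \<alpha> i * den x ^ (s - \<alpha> i))" for \<alpha> x
  define F where "F a x = x e ^ fst a * M (snd a) x" for a and x :: "'i \<Rightarrow> real"
  have finP: "finite ?P" by (intro finite_PiE fin) auto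
  have Mpoly: "(\<lambda>x. M \<alpha> x) \<in> polyfun I" for \<alpha>
    unfolding M_def by (intro polyfun_prod polyfun.mult polyfun_power num den)
  have Fpoly: "F a \<in> polyfun I" for a
    unfolding F_def by (intro polyfun.mult polyfun_power polyfun.coord e Mpoly)
  have Mdeg: "coord_degree_le I (n * s * d) (M \<alpha>)" if "\<alpha> \<in> ?P" for \<alpha>
  proof -
    have "coord_degree_le I (\<Sum>i\<in>I. \<alpha> i * d + (s - \<alpha> i) * d) (\<lambda>x. M \<alpha> x)"
      unfolding M_def by (intro coord_degree_le_prod coord_degree_le_mult coord_degree_le_power d)
    moreover have "(\<Sum>i\<in>I. \<alpha> i * d + (s - \<alpha> i) * d) = (\<Sum>i\<in>I. s * d)"
      using that by (intro sum.cong refl) (force simp flip: distrib_right)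
    ultimately show ?thesis by (simp add: n_def mult.assoc)
  qed
  have Fdeg: "coord_degree_le I N (F a)" if "a \<in> ?A" for a
  proof -
    have "coord_degree_le I (fst a * 1 + n * s * d) (F a)"
      unfolding F_def using that
      by (intro coord_degree_le_mult coord_degree_le_power coord_degree_le_coord Mdeg) auto
    then show ?thesis using that unfolding N_def by (elim coord_degree_le_mono) auto
  qed
  have "card ?G = (N + 1) ^ n"
    by (subst card_PiE[OF fin]) (simp_all add: n_def card_image inj_on_def)
  also have "\<dots> \<le> ((s + 1) * (d * n + 1)) ^ n"
    unfolding N_def by (intro power_mono) (simp_all add: algebra_simps)
  also have "\<dots> = (s + 1) ^ n * s" by (simp only: power_mult_distrib s_def)
  also have "\<dots> < (s + 1) ^ n * (s + 1)" by simp
  also have "\<dots> = card ?A"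
    by (simp add: card_cartesian_product card_PiE[OF fin] n_def)
  finally have "card ?G < card ?A" .
  moreover have "finite ?G" by (intro finite_PiE fin) auto
  moreover have "finite ?A" using finP by simp
  ultimately obtain c
    where c: "\<exists>a\<in>?A. c a \<noteq> 0" "\<forall>x\<in>?G. (\<Sum>a\<in>?A. c a * F a x) = 0"
    using homogeneous_system_nontrivial[of ?G ?A F] by blast
  have vanish: "(\<Sum>a\<in>?A. c a * F a x) = 0" for x
  proof (rule polynomial_vanishing_on_grid[of I N "\<lambda>x. \<Sum>a\<in>?A. c a * F a x", OF fin])
    show "coord_degree_le I N (\<lambda>x. \<Sum>a\<in>?A. c a * F a x)"
      using coord_degree_le_mult[OF coord_degree_le_const[of I 0] Fdeg]
      by (intro coord_degree_le_sum) simp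
    fix x :: "'i \<Rightarrow> real" assume x: "\<And>i. i \<in> I \<Longrightarrow> x i \<in> real ` {..N}"
    \<comment> \<open>The linear system was solved only at extensional grid points. Restricting
      \<open>x\<close> loses nothing, as a polynomial depends only on the coordinates in
      \<open>I\<close>.\<close>
    have "(\<Sum>a\<in>?A. c a * F a x) = (\<Sum>a\<in>?A. c a * F a (restrict x I))"
      by (intro sum.cong refl arg_cong2[where f = "(*)"] polyfun_cong[OF Fpoly]) simp
    also have "\<dots> = 0" using c(2) x by (simp add: restrict_PiE_iff)
    finally show "(\<Sum>a\<in>?A. c a * F a x) = 0" .
  qed
  define Q where "Q j x = (\<Sum>\<alpha>\<in>?P. c (j, \<alpha>) * (\<Prod>i\<in>I. \<psi> i x ^ \<alpha> i))" for j x
  have M_eq: "M \<alpha> x = (\<Prod>i\<in>I. \<psi> i x ^ \<alpha> i) * den x ^ (n * s)" if "x \<in> D" "\<alpha> \<in> ?P" for x \<alpha>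
  proof -
    have "M \<alpha> x = (\<Prod>i\<in>I. \<psi> i x ^ \<alpha> i * den x ^ s)"
      unfolding M_def
    proof (intro prod.cong refl)
      fix i assume "i \<in> I"
      then have "\<alpha> i \<le> s" using that by auto
      then show "num i x ^ \<alpha> i * den x ^ (s - \<alpha> i) = \<psi> i x ^ \<alpha> i * den x ^ s"
        unfolding frac[OF \<open>i \<in> I\<close> that(1), symmetric]
        by (simp add: power_mult_distrib mult.assoc flip: power_add)
    qed
    then show ?thesis by (simp add: prod.distrib n_def power_mult mult.commute)
  qed
  have relation: "(\<Sum>j\<le>s. x e ^ j * Q j x) = 0" if "x \<in> D" for x
  proof -
    have "0 = (\<Sum>(j, \<alpha>)\<in>?A. c (j, \<alpha>) * (x e ^ j * M \<alpha> x))"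
      using vanish[of x] by (simp add: F_def case_prod_unfold)
    also have "\<dots> = (\<Sum>j\<le>s. \<Sum>\<alpha>\<in>?P. c (j, \<alpha>) * (x e ^ j * M \<alpha> x))"
      by (rule sum.cartesian_product[symmetric])
    also have "\<dots> = (\<Sum>j\<le>s. x e ^ j * Q j x) * den x ^ (n * s)"
      unfolding Q_def sum_distrib_right sum_distrib_left
      by (intro sum.cong refl) (simp add: M_eq[OF that])
    finally show ?thesis using den0[OF that] by simp
  qed
  \<comment> \<open>Some power of coordinate \<open>e\<close> has a coefficient that is not formally
    zero. The power may be 0: a nonzero constant term makes the polynomial \<open>q\<close> below
    nonzero just as well.\<close>
  obtain j0 where j0: "j0 \<le> s" "\<exists>\<alpha>\<in>?P. c (j0, \<alpha>) \<noteq> 0" using c(1) by auto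
  define g where "g x = (\<Sum>\<alpha>\<in>?P. c (j0, \<alpha>) * M \<alpha> x)" for x
  have g_eq: "g x = Q j0 x * den x ^ (n * s)" if "x \<in> D" for x
    unfolding g_def Q_def sum_distrib_right by (intro sum.cong refl) (simp add: M_eq[OF that])
  show ?thesis
  proof (intro bexI[of _ g] conjI ballI impI)
    show "g \<in> polyfun I" unfolding g_def by (intro polyfun_sum polyfun.mult polyfun.const Mpoly)
    from near_identity_independent[OF fin j0(2) near deriv]
    obtain x where "x \<in> U" "Q j0 x \<noteq> 0" unfolding Q_def by blast
    then show "\<exists>x\<in>U. g x \<noteq> 0" using sub den0[of x] g_eq[of x] by (intro bexI[of _ x]) auto
    fix x assume x: "x \<in> D" "g x \<noteq> 0"
    define q where "q = (\<Sum>j\<le>s. monom (Q j x) j)"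
    have "coeff q j0 \<noteq> 0" using x g_eq[of x] j0(1) by (simp add: q_def coeff_sum)
    then have "q \<noteq> 0" by auto
    moreover have "poly q (y e) = 0" if "y \<in> D" "\<forall>i\<in>I. \<psi> i y = \<psi> i x" for y
    proof -
      have "Q j y = Q j x" for j unfolding Q_def using that by simp
      then show ?thesis using relation[OF that(1)] by (simp add: q_def poly_sum poly_monom mult.commute)
    qed
    ultimately show "finite {y e | y. y \<in> D \<and> (\<forall>i\<in>I. \<psi> i y = \<psi> i x)}"
      by (intro finite_subset[OF _ poly_roots_finite[of q]]) auto
  qed
qed

text \<open>Where the polynomials of all coordinates are nonzero, a fibre lies in the product of
  finitely many finite value sets. The restriction to \<open>I\<close> is there because points of
  the function space are unconstrained outside \<open>I\<close>.\<close>

lemma generically_finite_fibres: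
  fixes \<psi> :: "'i \<Rightarrow> ('i \<Rightarrow> real) \<Rightarrow> real"
  assumes fin: "finite I" and rat: "\<And>i. i \<in> I \<Longrightarrow> ratfun I D (\<psi> i)"
    and near: "\<And>v. \<forall>\<^sub>F t in at 0. line x0 v t \<in> U" and sub: "U \<subseteq> D" and "x0 \<in> U"
    and conv: "\<And>x y t. x \<in> U \<Longrightarrow> y \<in> U \<Longrightarrow> 0 < t \<Longrightarrow> t < 1 \<Longrightarrow> line x (\<lambda>i. y i - x i) t \<in> U"
    and deriv: "\<And>v i. i \<in> I \<Longrightarrow> ((\<lambda>t. \<psi> i (line x0 v t) / t) \<longlongrightarrow> v i) (at 0)"
  shows "\<exists>g\<in>polyfun I. (\<exists>x\<in>U. g x \<noteq> 0) \<and> (\<forall>x\<in>D. g x \<noteq> 0 \<longrightarrow>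
    finite ((\<lambda>y. restrict y I) ` {y \<in> D. \<forall>i\<in>I. \<psi> i y = \<psi> i x}))"
proof -
  have "\<forall>e\<in>I. \<exists>g. g \<in> polyfun I \<and> (\<exists>x\<in>U. g x \<noteq> 0) \<and>
    (\<forall>x\<in>D. g x \<noteq> 0 \<longrightarrow> finite {y e | y. y \<in> D \<and> (\<forall>i\<in>I. \<psi> i y = \<psi> i x)})"
    using finite_fibre_coordinate[OF fin rat _ near sub deriv] by blast
  from bchoice[OF this] obtain g where g: "\<And>e. e \<in> I \<Longrightarrow> g e \<in> polyfun I"
    "\<And>e. e \<in> I \<Longrightarrow> \<exists>x\<in>U. g e x \<noteq> 0"
    "\<And>e x. e \<in> I \<Longrightarrow> x \<in> D \<Longrightarrow> g e x \<noteq> 0 \<Longrightarrow>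
      finite {y e | y. y \<in> D \<and> (\<forall>i\<in>I. \<psi> i y = \<psi> i x)}" by auto
  show ?thesis
  proof (intro bexI[of _ "\<lambda>x. \<Prod>e\<in>I. g e x"] conjI ballI impI)
    show "\<exists>x\<in>U. (\<Prod>e\<in>I. g e x) \<noteq> 0"
      using polyfun_prod_nonzero[of I g I U, OF fin g(1,2) _ conv] \<open>x0 \<in> U\<close> by blast
    show "(\<lambda>x. \<Prod>e\<in>I. g e x) \<in> polyfun I" by (intro polyfun_prod g)
    fix x assume x: "x \<in> D" "(\<Prod>e\<in>I. g e x) \<noteq> 0"
    have "(\<lambda>y. restrict y I) ` {y \<in> D. \<forall>i\<in>I. \<psi> i y = \<psi> i x} \<subseteq>
      PiE I (\<lambda>e. {y e | y. y \<in> D \<and> (\<forall>i\<in>I. \<psi> i y = \<psi> i x)})" by auto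
    moreover have "finite \<dots>" using g(3)[OF _ x(1)] x(2) fin by (intro finite_PiE) auto
    ultimately show "finite ((\<lambda>y. restrict y I) ` {y \<in> D. \<forall>i\<in>I. \<psi> i y = \<psi> i x})"
      by (rule finite_subset)
  qed
qed

section \<open>Matrices with trivial kernel\<close>

text \<open>For the matrix F with rows \<open>J\<close> and \<open>n\<close> columns this is F^T F,
  which is square however many rows F has. Its determinant turns full column rank into the
  nonvanishing of a single function.\<close>

definition gram :: "'j set \<Rightarrow> nat \<Rightarrow> ('j \<Rightarrow> nat \<Rightarrow> real) \<Rightarrow> real mat" where
  "gram J n f = mat n n (\<lambda>(a, b). \<Sum>j\<in>J. f j a * f j b)"

lemma gram_carrier [simp]: "gram J n f \<in> carrier_mat n n"
  by (simp add: gram_def)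

lemma gram_mult_vec:
  assumes "v \<in> carrier_vec n" "a < n"
  shows "(gram J n f *\<^sub>v v) $ a = (\<Sum>j\<in>J. f j a * (\<Sum>b<n. f j b * v $ b))"
proof -
  have "(gram J n f *\<^sub>v v) $ a = (\<Sum>b<n. (\<Sum>j\<in>J. f j a * f j b) * v $ b)"
    using assms by (simp add: gram_def scalar_prod_def atLeast0LessThan)
  also have "\<dots> = (\<Sum>j\<in>J. f j a * (\<Sum>b<n. f j b * v $ b))"
    unfolding sum_distrib_left sum_distrib_right
    by (subst sum.swap) (simp add: mult.assoc)
  finally show ?thesis .
qed

text \<open>Over the reals, v^T F^T F v is the sum of the squares of the entries of F v, so F^T F
  and F have the same kernel.\<close>

lemma gram_det_nonzero_iff:
  assumes "finite J"
  shows "det (gram J n f) \<noteq> 0 \<longleftrightarrow>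
    (\<forall>v. (\<forall>j\<in>J. (\<Sum>a<n. f j a * v a) = 0) \<longrightarrow> (\<forall>a<n. v a = 0))"
proof
  assume det: "det (gram J n f) \<noteq> 0"
  show "\<forall>v. (\<forall>j\<in>J. (\<Sum>a<n. f j a * v a) = 0) \<longrightarrow> (\<forall>a<n. v a = 0)"
  proof (intro allI impI)
    fix v a assume v: "\<forall>j\<in>J. (\<Sum>a<n. f j a * v a) = 0" and "a < n"
    have "gram J n f *\<^sub>v vec n v = 0\<^sub>v n"
    proof (rule eq_vecI)
      fix b assume "b < dim_vec (0\<^sub>v n :: real vec)"
      then show "(gram J n f *\<^sub>v vec n v) $ b = 0\<^sub>v n $ b"
        using v by (subst gram_mult_vec) auto
    qed (simp add: gram_def)
    with det have "vec n v = 0\<^sub>v n"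
      using det_0_iff_vec_prod_zero[OF gram_carrier] by (metis vec_carrier)
    then show "v a = 0" using \<open>a < n\<close> by (metis index_vec index_zero_vec(1))
  qed
next
  assume inj: "\<forall>v. (\<forall>j\<in>J. (\<Sum>a<n. f j a * v a) = 0) \<longrightarrow> (\<forall>a<n. v a = 0)"
  show "det (gram J n f) \<noteq> 0"
  proof
    assume "det (gram J n f) = 0"
    then obtain v where v: "v \<in> carrier_vec n" "v \<noteq> 0\<^sub>v n" "gram J n f *\<^sub>v v = 0\<^sub>v n"
      using det_0_iff_vec_prod_zero[OF gram_carrier] by blast
    have "0 = (\<Sum>a<n. v $ a * (gram J n f *\<^sub>v v) $ a)" by (simp add: v(3))
    also have "\<dots> = (\<Sum>a<n. \<Sum>j\<in>J. v $ a * (f j a * (\<Sum>b<n. f j b * v $ b)))"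
      by (intro sum.cong refl) (simp add: gram_mult_vec[OF v(1)] sum_distrib_left)
    also have "\<dots> = (\<Sum>j\<in>J. (\<Sum>b<n. f j b * v $ b)\<^sup>2)"
      unfolding power2_eq_square
      by (subst sum.swap) (simp add: sum_distrib_right mult_ac)
    finally have "\<forall>j\<in>J. (\<Sum>b<n. f j b * v $ b) = 0"
      using assms by (subst (asm) eq_commute, subst (asm) sum_nonneg_eq_0_iff) auto
    with inj have "\<forall>a<n. v $ a = 0" by blast
    then have "v = 0\<^sub>v n" using v(1) by (intro eq_vecI) auto
    with v(2) show False by simp
  qed
qed

text \<open>The left inverse is (F^T F)^(-1) F^T. The bijection \<open>h\<close> numbers
  \<open>I\<close> so that the Gram matrix can be formed.\<close>

lemma left_inverse_exists:
  fixes g :: "'j \<Rightarrow> 'i \<Rightarrow> real"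
  assumes "finite I" "finite J"
    and inj: "\<And>v i. (\<And>j. j \<in> J \<Longrightarrow> (\<Sum>i\<in>I. g j i * v i) = 0) \<Longrightarrow> i \<in> I \<Longrightarrow> v i = 0"
  shows "\<exists>L. \<forall>i\<in>I. \<forall>k\<in>I. (\<Sum>j\<in>J. L i j * g j k) = (if i = k then 1 else 0)"
proof -
  define n where "n = card I"
  obtain h where h: "bij_betw h {..<n} I"
    using ex_bij_betw_nat_finite[OF assms(1)] by (auto simp: n_def atLeast0LessThan)
  define h' where "h' = inv_into {..<n} h"
  have h': "h' i < n" "h (h' i) = i" if "i \<in> I" for i
    using h that unfolding h'_def
    by (auto simp: bij_betw_def f_inv_into_f intro!: inv_into_into[of _ h "{..<n}", simplified])
  have hI: "h a \<in> I" if "a < n" for a using h that by (auto simp: bij_betw_def)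
  have h'h: "h' (h a) = a" if "a < n" for a
    using h that unfolding h'_def by (auto simp: bij_betw_def)
  let ?G = "gram J n (\<lambda>j a. g j (h a))"
  have "det ?G \<noteq> 0"
    unfolding gram_det_nonzero_iff[OF assms(2)]
  proof (intro allI impI)
    fix v :: "nat \<Rightarrow> real" and a assume v: "\<forall>j\<in>J. (\<Sum>a<n. g j (h a) * v a) = 0" and "a < n"
    have "(\<Sum>i\<in>I. g j i * v (h' i)) = (\<Sum>a<n. g j (h a) * v a)" for j
      by (subst sum.reindex_bij_betw[OF h, symmetric]) (intro sum.cong refl, simp add: h'h)
    then have "v (h' (h a)) = 0" using inj[of "\<lambda>i. v (h' i)" "h a"] v hI \<open>a < n\<close> by simp
    then show "v a = 0" using h'h \<open>a < n\<close> by simp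
  qed
  then obtain B where B: "B \<in> carrier_mat n n" "B * ?G = 1\<^sub>m n"
    using det_non_zero_imp_unit[OF gram_carrier, of J n _ "()"]
    unfolding Units_def ring_mat_def by auto
  show ?thesis
  proof (intro exI[of _ "\<lambda>i j. \<Sum>b<n. B $$ (h' i, b) * g j (h b)"] ballI)
    fix i k assume ik: "i \<in> I" "k \<in> I"
    have "(\<Sum>j\<in>J. (\<Sum>b<n. B $$ (h' i, b) * g j (h b)) * g j k)
      = (\<Sum>b<n. B $$ (h' i, b) * (\<Sum>j\<in>J. g j (h b) * g j k))"
      unfolding sum_distrib_left sum_distrib_right by (subst sum.swap) (simp add: mult_ac)
    also have "\<dots> = (B * ?G) $$ (h' i, h' k)"
      using B(1) h'[OF ik(1)] h'[OF ik(2)]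
      by (simp add: scalar_prod_def gram_def atLeast0LessThan)
    also have "\<dots> = (if i = k then 1 else 0)"
      unfolding B(2) using h'[OF ik(1)] h'[OF ik(2)] by (metis index_one_mat(1))
    finally show "(\<Sum>j\<in>J. (\<Sum>b<n. B $$ (h' i, b) * g j (h b)) * g j k)
      = (if i = k then 1 else 0)" .
  qed
qed

lemma mat_rank_eq_dim_col:
  assumes M: "M \<in> carrier_mat nr nc"
    and inj: "\<And>v c. (\<And>r. r < nr \<Longrightarrow> (\<Sum>c<nc. M $$ (r, c) * v c) = 0) \<Longrightarrow> c < nc \<Longrightarrow> v c = 0"
  shows "mat_rank M = nc"
proof -
  interpret vec_space "TYPE(real)" nr .
  have ker: "v = 0\<^sub>v nc" if v: "v \<in> carrier_vec nc" "M *\<^sub>v v = 0\<^sub>v nr" for v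
  proof -
    have "(\<Sum>c<nc. M $$ (r, c) * v $ c) = 0" if "r < nr" for r
    proof -
      have "(M *\<^sub>v v) $ r = 0" using v(2) that by simp
      then show ?thesis using M v(1) that by (simp add: scalar_prod_def atLeast0LessThan)
    qed
    from inj[OF this] show ?thesis using v(1) by (intro eq_vecI) auto
  qed
  \<comment> \<open>Linear independence concerns the set of columns and does not notice repetitions.
    Two equal columns would put a difference of unit vectors into the kernel.\<close>
  have "distinct (cols M)"
    unfolding distinct_conv_nth
  proof (intro allI impI notI)
    fix i j assume ij: "i < length (cols M)" "j < length (cols M)" "i \<noteq> j" "cols M ! i = cols M ! j"
    then have ij': "i < nc" "j < nc" "col M i = col M j" using M by auto
    have "(\<Sum>c<nc. M $$ (r, c) * (of_bool (c = i) - of_bool (c = j))) = 0" if "r < nr" for r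
    proof -
      have "(\<Sum>c<nc. M $$ (r, c) * (of_bool (c = i) - of_bool (c = j))) = M $$ (r, i) - M $$ (r, j)"
        using ij' by (simp add: right_diff_distrib sum_subtractf)
      moreover have "M $$ (r, i) = M $$ (r, j)"
      proof -
        have "M $$ (r, i) = col M i $ r" using M ij'(1) that by simp
        also have "\<dots> = M $$ (r, j)" using M ij'(2) that unfolding ij'(3) by simp
        finally show ?thesis .
      qed
      ultimately show ?thesis by simp
    qed
    from inj[OF this ij'(1)] ij(3) show False by simp
  qed
  then have "lin_indpt (set (cols M))" using lin_depE[OF M] ker by blast
  then show ?thesis
    using lin_indpt_full_rank[OF M \<open>distinct (cols M)\<close>] M by (simp add: mat_rank_def)
qed

lemma tendsto_det:
  fixes M :: "'a \<Rightarrow> real mat"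
  assumes "\<And>t. M t \<in> carrier_mat n n" "L \<in> carrier_mat n n"
    and "\<And>i j. i < n \<Longrightarrow> j < n \<Longrightarrow> ((\<lambda>t. M t $$ (i, j)) \<longlongrightarrow> L $$ (i, j)) F"
  shows "((\<lambda>t. det (M t)) \<longlongrightarrow> det L) F"
  unfolding det_def'[OF assms(1)] det_def'[OF assms(2)]
  by (intro tendsto_sum tendsto_mult tendsto_prod tendsto_const assms(3))
    (auto dest: permutes_in_image)

lemma polyfun_det:
  assumes "\<And>x. M x \<in> carrier_mat n n"
    and "\<And>i j. i < n \<Longrightarrow> j < n \<Longrightarrow> (\<lambda>x. M x $$ (i, j)) \<in> polyfun I"
  shows "(\<lambda>x. det (M x)) \<in> polyfun I"
  unfolding det_def'[OF assms(1)]
  by (intro polyfun_sum polyfun.mult polyfun_prod polyfun.const assms(2))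
    (auto dest: permutes_in_image)

lemma ratfun_det:
  assumes "\<And>x. M x \<in> carrier_mat n n"
    and "\<And>i j. i < n \<Longrightarrow> j < n \<Longrightarrow> ratfun I D (\<lambda>x. M x $$ (i, j))"
  shows "ratfun I D (\<lambda>x. det (M x))"
  unfolding det_def'[OF assms(1)]
  by (intro ratfun_sum ratfun_mult ratfun_prod ratfun_const assms(2))
    (auto dest: permutes_in_image)

text \<open>Injectivity is an open condition because the Gram determinant is continuous in the
  entries.\<close>

lemma eventually_trivial_kernel:
  fixes f :: "'t \<Rightarrow> 'j \<Rightarrow> nat \<Rightarrow> real"
  assumes "finite J" and lim: "\<And>j a. j \<in> J \<Longrightarrow> a < n \<Longrightarrow> ((\<lambda>t. f t j a) \<longlongrightarrow> l j a) F"
    and inj: "\<And>v a. (\<And>j. j \<in> J \<Longrightarrow> (\<Sum>a<n. l j a * v a) = 0) \<Longrightarrow> a < n \<Longrightarrow> v a = 0"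
  shows "\<forall>\<^sub>F t in F. \<forall>v. (\<forall>j\<in>J. (\<Sum>a<n. f t j a * v a) = 0) \<longrightarrow> (\<forall>a<n. v a = 0)"
proof -
  have "((\<lambda>t. det (gram J n (f t))) \<longlongrightarrow> det (gram J n l)) F"
    by (rule tendsto_det[OF gram_carrier gram_carrier])
      (auto simp: gram_def intro!: tendsto_sum tendsto_mult lim)
  moreover have "det (gram J n l) \<noteq> 0"
    unfolding gram_det_nonzero_iff[OF assms(1)] using inj by blast
  ultimately have "\<forall>\<^sub>F t in F. det (gram J n (f t)) \<noteq> 0" by (rule tendsto_imp_eventually_ne)
  then show ?thesis unfolding gram_det_nonzero_iff[OF assms(1)] .
qed

section \<open>Kronecker powers\<close>

text \<open>Digits are numbered from the least significant one, so entry k of a tuple of length m is the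
  digit m - 1 - k of its index.\<close>

definition dig :: "nat \<Rightarrow> nat \<Rightarrow> nat \<Rightarrow> nat" where
  "dig p q k = q div p ^ k mod p"

lemma dig_less: "0 < p \<Longrightarrow> dig p q k < p"
  by (simp add: dig_def)

lemma dig_div: "dig p (q div p ^ l) k = dig p q (l + k)"
  by (simp add: dig_def div_mult2_eq power_add)

lemma dig_mod: "k < l \<Longrightarrow> dig p (q mod p ^ l) k = dig p q k"
proof -
  assume "k < l"
  then have l: "p ^ l = p ^ k * p ^ (l - k)" by (simp flip: power_add)
  have "q mod p ^ l div p ^ k = q div p ^ k mod p ^ (l - k)"
    unfolding l mod_mult2_eq by (cases "p = 0"; cases k) auto
  moreover have "p dvd p ^ (l - k)" using \<open>k < l\<close> by simp
  ultimately show ?thesis by (simp add: dig_def mod_mod_cancel)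
qed

lemma dig_eqI:
  assumes "q < p ^ m" "r < p ^ m" "\<And>k. k < m \<Longrightarrow> dig p q k = dig p r k"
  shows "q = r"
  using assms
proof (induction m arbitrary: q r)
  case (Suc m)
  have "q div p < p ^ m" "r div p < p ^ m"
    using Suc.prems by (simp_all add: less_mult_imp_div_less mult.commute)
  moreover have "dig p (q div p) k = dig p (r div p) k" if "k < m" for k
    using Suc.prems(3)[of "Suc k"] that dig_div[of p _ 1 k] by simp
  ultimately have "q div p = r div p" by (rule Suc.IH)
  moreover have "q mod p = r mod p" using Suc.prems(3)[of 0] by (simp add: dig_def)
  ultimately show ?case by (metis div_mult_mod_eq)
qed simp

lemma tuple_index_snoc: "tuple_index p (t @ [x]) = tuple_index p t * p + x"
  by (simp add: tuple_index_def)

lemma tuple_index_less: "set t \<subseteq> {..<p} \<Longrightarrow> tuple_index p t < p ^ length t"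
proof (induction t rule: rev_induct)
  case Nil
  then show ?case by (simp add: tuple_index_def)
next
  case (snoc x t)
  then have "tuple_index p t + 1 \<le> p ^ length t" "x < p" by auto
  then have "(tuple_index p t + 1) * p \<le> p ^ length t * p" by (intro mult_right_mono) auto
  then show ?case using \<open>x < p\<close> by (simp add: tuple_index_snoc mult.commute)
qed

lemma dig_tuple_index:
  "set t \<subseteq> {..<p} \<Longrightarrow> k < length t \<Longrightarrow> dig p (tuple_index p t) k = t ! (length t - 1 - k)"
proof (induction t arbitrary: k rule: rev_induct)
  case (snoc x t)
  then have x: "x < p" by simp
  show ?case
  proof (cases k)
    case 0
    then show ?thesis using x by (simp add: dig_def tuple_index_snoc)
  next
    case (Suc j)
    have "dig p (tuple_index p (t @ [x])) k = dig p (tuple_index p (t @ [x]) div p ^ 1) j"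
      unfolding dig_div by (simp add: Suc)
    also have "tuple_index p (t @ [x]) div p ^ 1 = tuple_index p t"
      using x by (simp add: tuple_index_snoc)
    moreover have "length t - Suc j < length t" using Suc snoc.prems by simp
    ultimately show ?thesis using snoc Suc by (simp add: nth_append)
  qed
qed simp

section \<open>Kronecker powers digit by digit\<close>

lemma kron_carrier:
  "A \<in> carrier_mat a a' \<Longrightarrow> B \<in> carrier_mat b b' \<Longrightarrow> kron A B \<in> carrier_mat (a * b) (a' * b')"
  by (auto simp: kron_def)

lemma kron_index:
  assumes "A \<in> carrier_mat a a'" "B \<in> carrier_mat b b'" "q < a * b" "r < a' * b'"
  shows "kron A B $$ (q, r) = A $$ (q div b, r div b') * B $$ (q mod b, r mod b')"
  using assms by (simp add: kron_def)

lemma kron_pow_carrier: "A \<in> carrier_mat p p \<Longrightarrow> kron_pow A m \<in> carrier_mat (p ^ m) (p ^ m)"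
  by (induction m) (auto dest: kron_carrier)

lemma kron_pow_index:
  assumes "A \<in> carrier_mat p p" "q < p ^ m" "r < p ^ m"
  shows "kron_pow A m $$ (q, r) = (\<Prod>k<m. A $$ (dig p q k, dig p r k))"
  using assms(2,3)
proof (induction m arbitrary: q r)
  case (Suc m)
  have p: "0 < p" using Suc.prems by (cases p) auto
  have qr: "q div p ^ m = dig p q m" "r div p ^ m = dig p r m"
    using Suc.prems by (simp_all add: dig_def less_mult_imp_div_less)
  have "kron_pow A (Suc m) $$ (q, r)
      = A $$ (dig p q m, dig p r m) * kron_pow A m $$ (q mod p ^ m, r mod p ^ m)"
    using kron_index[OF assms(1) kron_pow_carrier[OF assms(1)], of q m r] Suc.prems by (simp add: qr)
  also have "kron_pow A m $$ (q mod p ^ m, r mod p ^ m) = (\<Prod>k<m. A $$ (dig p q k, dig p r k))"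
    using Suc.IH[of "q mod p ^ m" "r mod p ^ m"] p by (simp add: dig_mod)
  finally show ?case by (simp add: mult.commute)
qed simp

text \<open>In each summand of the product rule one digit \<open>l\<close> is governed by the unit
  matrix and all other digits by \<open>A\<close>.\<close>

lemma kron_pow_deriv_index:
  assumes A: "A \<in> carrier_mat p p" and q: "q < p ^ m" and r: "r < p ^ m"
  shows "kron_pow_deriv p A m (a, b) $$ (q, r) =
    (\<Sum>l<m. of_bool (dig p q l = b \<and> dig p r l = a) *
      (\<Prod>k\<in>{..<m} - {l}. A $$ (dig p q k, dig p r k)))"
proof (cases "m = 0")
  case False
  then have p: "0 < p" using q by (cases p) (auto simp: power_0_left)
  have "kron_pow_deriv p A m (a, b) $$ (q, r) =
    (\<Sum>k = 1..m. kron (kron_pow A (k - 1)) (kron (unit_mat p b a) (kron_pow A (m - k))) $$ (q, r))"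
    using q r by (simp add: kron_pow_deriv_def)
  \<comment> \<open>The factor at place \<open>k\<close> from the left acts on digit
    \<open>m - k\<close>, since digits are counted from the right.\<close>
  also have "\<dots> = (\<Sum>l<m. kron (kron_pow A (m - 1 - l)) (kron (unit_mat p b a) (kron_pow A l)) $$ (q, r))"
    by (rule sum.reindex_bij_witness[of _ "\<lambda>l. m - l" "\<lambda>k. m - k"]) auto
  also have "\<dots> = (\<Sum>l<m. of_bool (dig p q l = b \<and> dig p r l = a) *
      (\<Prod>k\<in>{..<m} - {l}. A $$ (dig p q k, dig p r k)))"
  proof (intro sum.cong refl)
    fix l assume "l \<in> {..<m}"
    then have l: "l < m" by simp
    have U: "unit_mat p b a \<in> carrier_mat p p" by (simp add: unit_mat_def)
    \<comment> \<open>Division by \<open>N\<close> separates the digits above \<open>l\<close> from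
      the rest; within the rest, division by \<open>p ^ l\<close> separates digit \<open>l\<close>
      from those below it.\<close>
    define N where "N = p ^ Suc l"
    have N: "N = p * p ^ l" by (simp add: N_def)
    have UK: "kron (unit_mat p b a) (kron_pow A l) \<in> carrier_mat N N"
      using kron_carrier[OF U kron_pow_carrier[OF A]] by (simp add: N)
    have "m - 1 - l + Suc l = m" using l by simp
    then have m: "p ^ m = p ^ (m - 1 - l) * N"
      unfolding N_def by (metis power_add)
    have N0: "0 < N" using p by (simp add: N)
    have lt: "s div N < p ^ (m - 1 - l)" "s mod N < p * p ^ l" "s mod N mod p ^ l < p ^ l"
      if "s < p ^ m" for s
      using that p N0 by (simp_all add: m less_mult_imp_div_less N)
    have dg: "s mod N div p ^ l = dig p s l" if "s < p ^ m" for s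
      using lt(2)[OF that] dig_mod[of l "Suc l" p s]
      by (simp add: dig_def less_mult_imp_div_less N)
    have dm: "dig p (s mod N mod p ^ l) k = dig p s k" if "k < l" for s k
      by (simp only: dig_mod[OF that] N_def dig_mod[OF less_SucI[OF that]])
    have "kron (kron_pow A (m - 1 - l)) (kron (unit_mat p b a) (kron_pow A l)) $$ (q, r)
      = kron_pow A (m - 1 - l) $$ (q div N, r div N) *
        kron (unit_mat p b a) (kron_pow A l) $$ (q mod N, r mod N)"
      using kron_index[OF kron_pow_carrier[OF A] UK] q r unfolding m by blast
    also have "kron_pow A (m - 1 - l) $$ (q div N, r div N)
      = (\<Prod>k<m - 1 - l. A $$ (dig p q (Suc l + k), dig p r (Suc l + k)))"
      using kron_pow_index[OF A lt(1)[OF q] lt(1)[OF r]] unfolding N_def dig_div .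
    also have "kron (unit_mat p b a) (kron_pow A l) $$ (q mod N, r mod N)
      = unit_mat p b a $$ (dig p q l, dig p r l) *
        kron_pow A l $$ (q mod N mod p ^ l, r mod N mod p ^ l)"
      using kron_index[OF U kron_pow_carrier[OF A] lt(2)[OF q] lt(2)[OF r]]
      unfolding dg[OF q] dg[OF r] .
    also have "unit_mat p b a $$ (dig p q l, dig p r l) = of_bool (dig p q l = b \<and> dig p r l = a)"
      using dig_less[OF p] by (simp add: unit_mat_def)
    also have "kron_pow A l $$ (q mod N mod p ^ l, r mod N mod p ^ l)
      = (\<Prod>k<l. A $$ (dig p q k, dig p r k))"
      unfolding kron_pow_index[OF A lt(3)[OF q] lt(3)[OF r]] by (intro prod.cong refl) (simp add: dm)
    also have "(\<Prod>k<m - 1 - l. A $$ (dig p q (Suc l + k), dig p r (Suc l + k)))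
      = (\<Prod>k\<in>{Suc l..<m}. A $$ (dig p q k, dig p r k))"
      by (rule prod.reindex_bij_witness[of _ "\<lambda>k. k - Suc l" "\<lambda>k. Suc l + k"]) (use l in auto)
    also have "\<dots> * (of_bool (dig p q l = b \<and> dig p r l = a) * (\<Prod>k<l. A $$ (dig p q k, dig p r k)))
      = of_bool (dig p q l = b \<and> dig p r l = a) *
        ((\<Prod>k<l. A $$ (dig p q k, dig p r k)) * (\<Prod>k\<in>{Suc l..<m}. A $$ (dig p q k, dig p r k)))"
      by (simp add: mult_ac)
    also have "(\<Prod>k<l. A $$ (dig p q k, dig p r k)) * (\<Prod>k\<in>{Suc l..<m}. A $$ (dig p q k, dig p r k))
      = (\<Prod>k\<in>{..<m} - {l}. A $$ (dig p q k, dig p r k))"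
    proof -
      have *: "{..<m} - {l} = {..<l} \<union> {Suc l..<m}" using l by auto
      show ?thesis unfolding * by (rule prod.union_disjoint[symmetric]) auto
    qed
    finally show "kron (kron_pow A (m - 1 - l)) (kron (unit_mat p b a) (kron_pow A l)) $$ (q, r)
      = of_bool (dig p q l = b \<and> dig p r l = a) * (\<Prod>k\<in>{..<m} - {l}. A $$ (dig p q k, dig p r k))" .
  qed
  finally show ?thesis .
qed (use q r in \<open>simp add: kron_pow_deriv_def\<close>)

lemma sum_div_mod:
  fixes f :: "nat \<Rightarrow> nat \<Rightarrow> 'a::comm_monoid_add"
  shows "(\<Sum>r<a * b. f (r div b) (r mod b)) = (\<Sum>i<a. \<Sum>j<b. f i j)"
proof -
  have "(\<Sum>r<a * b. f (r div b) (r mod b)) = (\<Sum>i<a. \<Sum>r\<in>{i * b..<i * b + b}. f (r div b) (r mod b))"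
    by (rule sum.nat_group[symmetric])
  also have "\<dots> = (\<Sum>i<a. \<Sum>j<b. f i j)"
  proof (rule sum.cong[OF refl])
    fix i
    have "(\<Sum>r\<in>{i * b..<i * b + b}. f (r div b) (r mod b))
      = (\<Sum>j\<in>{0..<b}. f ((j + i * b) div b) ((j + i * b) mod b))"
      using sum.shift_bounds_nat_ivl[of "\<lambda>r. f (r div b) (r mod b)" 0 "i * b" b]
      by (simp add: add.commute)
    also have "\<dots> = (\<Sum>j<b. f i j)" by (rule sum.cong) auto
    finally show "(\<Sum>r\<in>{i * b..<i * b + b}. f (r div b) (r mod b)) = (\<Sum>j<b. f i j)" .
  qed
  finally show ?thesis .
qed

section \<open>Multiplicativity of Kronecker products and powers\<close>

lemma kron_mult:
  fixes A B C D :: "'a::comm_semiring_1 mat"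
  assumes "A \<in> carrier_mat a a" "B \<in> carrier_mat a a" "C \<in> carrier_mat b b" "D \<in> carrier_mat b b"
  shows "kron (A * B) (C * D) = kron A C * kron B D"
proof (rule eq_matI)
  note KC = kron_carrier[OF assms(1,3)] kron_carrier[OF assms(2,4)]
  fix q r assume "q < dim_row (kron A C * kron B D)" "r < dim_col (kron A C * kron B D)"
  then have qr: "q < a * b" "r < a * b" using KC by auto
  then have b: "0 < b" by (cases b) auto
  have lt: "q div b < a" "q mod b < b" "r div b < a" "r mod b < b"
    using qr b by (simp_all add: less_mult_imp_div_less)
  have "(kron A C * kron B D) $$ (q, r) = (\<Sum>s<a * b. kron A C $$ (q, s) * kron B D $$ (s, r))"
    using KC qr by (simp add: scalar_prod_def atLeast0LessThan)
  also have "\<dots> = (\<Sum>s<a * b. (A $$ (q div b, s div b) * C $$ (q mod b, s mod b)) *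
      (B $$ (s div b, r div b) * D $$ (s mod b, r mod b)))"
    using kron_index[OF assms(1,3) qr(1)] kron_index[OF assms(2,4) _ qr(2)] by simp
  also have "\<dots> = (\<Sum>i<a. \<Sum>j<b. (A $$ (q div b, i) * C $$ (q mod b, j)) *
      (B $$ (i, r div b) * D $$ (j, r mod b)))"
    by (rule sum_div_mod)
  also have "\<dots> = (A * B) $$ (q div b, r div b) * (C * D) $$ (q mod b, r mod b)"
    using assms lt by (simp add: scalar_prod_def atLeast0LessThan sum_product mult_ac)
  also have "\<dots> = kron (A * B) (C * D) $$ (q, r)"
    using kron_index[OF mult_carrier_mat[OF assms(1,2)] mult_carrier_mat[OF assms(3,4)] qr] by simp
  finally show "kron (A * B) (C * D) $$ (q, r) = (kron A C * kron B D) $$ (q, r)" by simp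
qed (use assms in \<open>auto simp: kron_def\<close>)

lemma kron_pow_mult:
  fixes A B :: "'a::comm_semiring_1 mat"
  assumes "A \<in> carrier_mat p p" "B \<in> carrier_mat p p"
  shows "kron_pow (A * B) m = kron_pow A m * kron_pow B m"
proof (induction m)
  case (Suc m)
  then show ?case
    using kron_mult[OF assms kron_pow_carrier[OF assms(1), of m] kron_pow_carrier[OF assms(2), of m]]
    by simp
qed simp

lemma kron_pow_one: "kron_pow (1\<^sub>m p) m = (1\<^sub>m (p ^ m) :: 'a::comm_semiring_1 mat)"
proof (rule eq_matI)
  fix q r assume "q < dim_row (1\<^sub>m (p ^ m) :: 'a mat)" "r < dim_col (1\<^sub>m (p ^ m) :: 'a mat)"
  then have qr: "q < p ^ m" "r < p ^ m" by auto
  then have p: "0 < p" if "m \<noteq> 0" using that by (cases p) (auto simp: power_0_left)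
  show "kron_pow (1\<^sub>m p) m $$ (q, r) = (1\<^sub>m (p ^ m) :: 'a mat) $$ (q, r)"
  proof (cases "q = r")
    case True
    then show ?thesis
      using qr dig_less[OF p] by (cases "m = 0") (auto simp: kron_pow_index[OF one_carrier_mat])
  next
    case False
    then obtain k where k: "k < m" "dig p q k \<noteq> dig p r k" using dig_eqI[OF qr] by blast
    then have "(1\<^sub>m p :: 'a mat) $$ (dig p q k, dig p r k) = 0" using dig_less[OF p] by simp
    then show ?thesis
      using k qr False unfolding kron_pow_index[OF one_carrier_mat qr]
      by (auto intro!: prod_zero)
  qed
qed (use kron_pow_carrier[of "1\<^sub>m p" p m] in auto)

lemma kron_pow_pow:
  fixes A :: "'a::comm_semiring_1 mat"
  assumes "A \<in> carrier_mat p p"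
  shows "kron_pow (A ^\<^sub>m n) m = kron_pow A m ^\<^sub>m n"
proof (induction n)
  case 0
  then show ?case using assms kron_pow_carrier[OF assms, of m] by (simp add: kron_pow_one)
next
  case (Suc n)
  then show ?case by (simp add: kron_pow_mult[OF pow_carrier_mat[OF assms] assms])
qed

section \<open>Schur stability\<close>

lemma smult_pow_mat:
  fixes A :: "'a::comm_semiring_1 mat"
  assumes "A \<in> carrier_mat n n"
  shows "(c \<cdot>\<^sub>m A) ^\<^sub>m k = c ^ k \<cdot>\<^sub>m (A ^\<^sub>m k)"
proof (induction k)
  case 0
  then show ?case using assms by (intro eq_matI) auto
next
  case (Suc k)
  then show ?case
    using assms pow_carrier_mat[OF assms, of k]
    by (intro eq_matI) (auto simp: scalar_prod_def sum_distrib_left mult_ac intro!: sum.cong)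
qed

text \<open>The Jordan normal form yields bounded powers for spectral radius below 1. Applied to A /
  \<rho>, with \<rho> strictly between the spectral radius of A and 1, it bounds the entries of A^k
  by a constant times \<rho>^k.\<close>

lemma schur_stable_powers_tendsto_0:
  assumes A: "A \<in> carrier_mat p p" and stable: "schur_stable A" and ij: "i < p" "j < p"
  shows "(\<lambda>k. (A ^\<^sub>m k) $$ (i, j)) \<longlonglongrightarrow> 0"
proof -
  let ?A = "map_mat complex_of_real A"
  have Ac: "?A \<in> carrier_mat p p" using A by simp
  have p: "0 < p" using ij by simp
  define s where "s = spectral_radius ?A"
  obtain k where "eigenvalue ?A k" "s = cmod k"
    using spectral_radius_mem_max(1)[OF Ac p] by (auto simp: s_def spectrum_def)
  then have s: "0 \<le> s" "s < 1" using stable by (auto simp: schur_stable_def)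
  define \<rho> where "\<rho> = (1 + s) / 2"
  have \<rho>: "0 < \<rho>" "\<rho> < 1" "s < \<rho>" using s by (auto simp: \<rho>_def)
  let ?B = "complex_of_real (1 / \<rho>) \<cdot>\<^sub>m ?A"
  have B: "?B \<in> carrier_mat p p" using Ac by simp
  obtain l where l: "eigenvalue ?B l" "spectral_radius ?B = cmod l"
    using spectral_radius_mem_max(1)[OF B p] by (auto simp: spectrum_def)
  then obtain v where v: "v \<in> carrier_vec p" "v \<noteq> 0\<^sub>v p" "?B *\<^sub>v v = l \<cdot>\<^sub>v v"
    using A by (auto simp: eigenvalue_def eigenvector_def)
  have "?A *\<^sub>v v = (complex_of_real \<rho> * l) \<cdot>\<^sub>v v"
  proof -
    have "complex_of_real (1 / \<rho>) \<cdot>\<^sub>v (?A *\<^sub>v v) = l \<cdot>\<^sub>v v"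
    proof -
      have "complex_of_real (1 / \<rho>) \<cdot>\<^sub>v (?A *\<^sub>v v) = ?B *\<^sub>v v"
        using A v(1) by (intro eq_vecI) (auto simp: scalar_prod_def sum_distrib_left)
      then show ?thesis using v(3) by simp
    qed
    then have "complex_of_real \<rho> \<cdot>\<^sub>v (complex_of_real (1 / \<rho>) \<cdot>\<^sub>v (?A *\<^sub>v v))
      = complex_of_real \<rho> \<cdot>\<^sub>v (l \<cdot>\<^sub>v v)" by simp
    then show ?thesis using \<rho> by (simp add: smult_smult_assoc)
  qed
  then have "eigenvalue ?A (complex_of_real \<rho> * l)"
    using v A unfolding eigenvalue_def eigenvector_def by (intro exI[of _ v]) simp
  then have "cmod (complex_of_real \<rho> * l) \<le> s"
    unfolding s_def by (intro spectral_radius_mem_max(2)[OF Ac p]) (simp add: spectrum_def)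
  then have "\<rho> * cmod l \<le> s" using \<rho> by (simp add: norm_mult)
  then have "cmod l < 1" using \<rho> mult_less_cancel_left_pos[of \<rho> "cmod l" 1] by linarith
  then have "spectral_radius ?B < 1" using l by simp
  moreover have "\<exists>n_as. jordan_nf ?B n_as"
    using char_poly_factorized[OF B] jordan_nf_exists[OF B] by blast
  ultimately obtain c where c: "\<And>k. norm_bound (?B ^\<^sub>m k) c"
    using spectral_radius_jnf_norm_bound_less_1[OF B] by blast
  have bound: "norm ((A ^\<^sub>m k) $$ (i, j)) \<le> c * \<rho> ^ k" for k
  proof -
    have "?B ^\<^sub>m k = complex_of_real (1 / \<rho>) ^ k \<cdot>\<^sub>m map_mat complex_of_real (A ^\<^sub>m k)"
      by (simp add: smult_pow_mat[OF Ac] of_real_hom.mat_hom_pow[OF A])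
    then have "cmod (complex_of_real (1 / \<rho>) ^ k * complex_of_real ((A ^\<^sub>m k) $$ (i, j))) \<le> c"
      using c[of k] ij A pow_carrier_mat[OF A, of k] by (simp add: norm_bound_def)
    then have "(1 / \<rho>) ^ k * norm ((A ^\<^sub>m k) $$ (i, j)) \<le> c"
      using \<rho> by (simp add: norm_mult norm_power norm_divide power_divide)
    then show ?thesis using \<rho> by (simp add: field_simps)
  qed
  have "(\<lambda>k. c * \<rho> ^ k) \<longlonglongrightarrow> c * 0"
    using \<rho> by (intro tendsto_mult tendsto_const LIMSEQ_power_zero) auto
  then have "(\<lambda>k. c * \<rho> ^ k) \<longlonglongrightarrow> 0" by simp
  then show ?thesis 
  proof (rule tendsto_0_le[where K = 1])
    show "\<forall>\<^sub>F k in sequentially. norm ((A ^\<^sub>m k) $$ (i, j)) \<le> norm (c * \<rho> ^ k) * 1"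
      using order_trans[OF bound abs_ge_self] by simp
  qed
qed

text \<open>A kernel vector is fixed by the Kronecker power of A, hence by the Kronecker power of
  every A^k. The entries of the latter are products of \<open>m\<close> entries that tend to 0 with
  k, so the vector is 0. For m = 0 these products would be empty and stay 1.\<close>

lemma schur_stable_det_nonzero:
  assumes A: "A \<in> carrier_mat p p" and stable: "schur_stable A" and "0 < m"
  shows "det (1\<^sub>m (p ^ m) - kron_pow A m) \<noteq> 0"
proof
  let ?K = "kron_pow A m" let ?n = "p ^ m"
  have K: "?K \<in> carrier_mat ?n ?n" by (rule kron_pow_carrier[OF A])
  assume "det (1\<^sub>m ?n - ?K) = 0"
  moreover have "1\<^sub>m ?n - ?K \<in> carrier_mat ?n ?n" using K by (simp add: minus_carrier_mat)
  ultimately obtain v where v: "v \<in> carrier_vec ?n" "v \<noteq> 0\<^sub>v ?n" "(1\<^sub>m ?n - ?K) *\<^sub>v v = 0\<^sub>v ?n"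
    using det_0_iff_vec_prod_zero by blast
  have "v - ?K *\<^sub>v v = 0\<^sub>v ?n"
    using v(3) minus_mult_distrib_mat_vec[OF one_carrier_mat K v(1)] v(1) by simp
  have Kv: "?K *\<^sub>v v = v"
  proof (rule eq_vecI)
    fix q assume "q < dim_vec v"
    then have "(v - ?K *\<^sub>v v) $ q = 0" using v(1) \<open>v - ?K *\<^sub>v v = 0\<^sub>v ?n\<close> by simp
    then show "(?K *\<^sub>v v) $ q = v $ q" using \<open>q < dim_vec v\<close> v(1) K by simp
  qed (use v K in auto)
  have Kkv: "?K ^\<^sub>m k *\<^sub>v v = v" for k
  proof (induction k)
    case 0
    then show ?case using v(1) K by simp
  next
    case (Suc k)
    then show ?case using assoc_mult_mat_vec[OF pow_carrier_mat[OF K] K v(1)] Kv by simp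
  qed
  have "v $ q = 0" if q: "q < ?n" for q
  proof -
    have p: "0 < p" using q \<open>0 < m\<close> by (cases p) (auto simp: power_0_left)
    have "v $ q = (\<Sum>r<?n. (\<Prod>l<m. (A ^\<^sub>m k) $$ (dig p q l, dig p r l)) * v $ r)" for k
    proof -
      have "v $ q = (kron_pow (A ^\<^sub>m k) m *\<^sub>v v) $ q" by (simp add: kron_pow_pow[OF A] Kkv)
      also have "\<dots> = (\<Sum>r<?n. kron_pow (A ^\<^sub>m k) m $$ (q, r) * v $ r)"
        using kron_pow_carrier[OF pow_carrier_mat[OF A], of k m] v(1) q
        by (simp add: scalar_prod_def atLeast0LessThan)
      finally show ?thesis using kron_pow_index[OF pow_carrier_mat[OF A] q] by simp
    qed
    moreover have "(\<lambda>k. \<Sum>r<?n. (\<Prod>l<m. (A ^\<^sub>m k) $$ (dig p q l, dig p r l)) * v $ r)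
      \<longlonglongrightarrow> (\<Sum>r<?n. (\<Prod>l<m. 0) * v $ r)"
      by (intro tendsto_sum tendsto_mult tendsto_prod tendsto_const
          schur_stable_powers_tendsto_0[OF A stable] dig_less p)
    ultimately have "(\<lambda>k. v $ q) \<longlonglongrightarrow> 0" using \<open>0 < m\<close> by (simp add: power_0_left)
    then show ?thesis by (simp add: LIMSEQ_const_iff)
  qed
  then have "v = 0\<^sub>v ?n" using v(1) by (intro eq_vecI) auto
  with v(2) show False by simp
qed

text \<open>At a coordinate where the eigenvector has maximal modulus, the eigenvalue equation
  bounds the eigenvalue by the absolute row sum.\<close>

lemma schur_stable_of_row_sums:
  assumes A: "A \<in> carrier_mat p p" and row: "\<And>i. i < p \<Longrightarrow> (\<Sum>j<p. \<bar>A $$ (i, j)\<bar>) < 1"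
  shows "schur_stable A"
  unfolding schur_stable_def
proof (intro allI impI)
  fix k assume "eigenvalue (map_mat complex_of_real A) k"
  then obtain v where v: "v \<in> carrier_vec p" "v \<noteq> 0\<^sub>v p"
    "map_mat complex_of_real A *\<^sub>v v = k \<cdot>\<^sub>v v"
    using A by (auto simp: eigenvalue_def eigenvector_def)
  have "p \<noteq> 0" using v by (intro notI) auto
  then obtain i where i: "i < p" "\<And>j. j < p \<Longrightarrow> cmod (v $ j) \<le> cmod (v $ i)"
  proof -
    let ?S = "(\<lambda>j. cmod (v $ j)) ` {..<p}"
    have "Max ?S \<in> ?S" using \<open>p \<noteq> 0\<close> by (intro Max_in) auto
    then obtain i where "i < p" "Max ?S = cmod (v $ i)" by auto
    then show ?thesis using that[of i] Max_ge[of ?S] by auto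
  qed
  have "v $ i \<noteq> 0"
  proof
    assume "v $ i = 0"
    then have "v = 0\<^sub>v p" using v(1) i(2) by (intro eq_vecI) auto
    with v(2) show False by simp
  qed
  have "k * v $ i = (\<Sum>j<p. complex_of_real (A $$ (i, j)) * v $ j)"
    using arg_cong[OF v(3), of "\<lambda>w. w $ i"] A i(1) v(1)
    by (simp add: scalar_prod_def atLeast0LessThan)
  then have "cmod k * cmod (v $ i) \<le> (\<Sum>j<p. \<bar>A $$ (i, j)\<bar> * cmod (v $ j))"
    by (metis (no_types, lifting) norm_mult norm_of_real norm_sum sum.cong)
  also have "\<dots> \<le> (\<Sum>j<p. \<bar>A $$ (i, j)\<bar> * cmod (v $ i))"
    by (intro sum_mono mult_left_mono i(2)) auto
  also have "\<dots> = (\<Sum>j<p. \<bar>A $$ (i, j)\<bar>) * cmod (v $ i)" by (simp add: sum_distrib_right)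
  also have "\<dots> < 1 * cmod (v $ i)" using row[OF i(1)] \<open>v $ i \<noteq> 0\<close> by (intro mult_strict_right_mono) auto
  finally show "cmod k < 1" using \<open>v $ i \<noteq> 0\<close> by simp
qed

section \<open>The model in coordinates\<close>

text \<open>A common index type for edge entries and noise turns a parameter into a real function,
  to which the general results on polynomial functions apply. \<open>Noise m i\<close> is the i-th
  diagonal entry of the tensor of order m.\<close>

datatype coord = Entry nat nat | Noise nat nat

definition coord_of :: "param \<Rightarrow> coord \<Rightarrow> real" where
  "coord_of \<theta> = (case \<theta> of (A, w2, w3, w4) \<Rightarrow> (\<lambda>c. case c of
     Entry i j \<Rightarrow> A $$ (j, i)
   | Noise m i \<Rightarrow> (if m = 2 then w2 else if m = 3 then w3 else w4) $ i))"

definition const_index :: "nat \<Rightarrow> nat \<Rightarrow> nat \<Rightarrow> nat" where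
  "const_index p m l = tuple_index p (replicate m l)"

lemma const_index_less: "l < p \<Longrightarrow> const_index p m l < p ^ m"
  using tuple_index_less[of "replicate m l" p]
  by (simp add: const_index_def set_replicate_conv_if split: if_splits)

lemma dig_const_index: "l < p \<Longrightarrow> k < m \<Longrightarrow> dig p (const_index p m l) k = l"
  using dig_tuple_index[of "replicate m l" p k] by (auto simp: const_index_def)

lemma diag_tensor_index:
  "q < p ^ m \<Longrightarrow> diag_tensor p m w $ q = (\<Sum>i<p. if q = const_index p m i then w $ i else 0)"
  by (simp add: diag_tensor_def const_index_def)

lemma diag_tensor_const_index:
  assumes "0 < m" "l < p"
  shows "diag_tensor p m w $ const_index p m l = w $ l"
proof -
  have "const_index p m l = const_index p m i \<longleftrightarrow> i = l" if "i < p" for i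
  proof
    assume eq: "const_index p m l = const_index p m i"
    show "i = l"
      using dig_const_index[OF assms(2,1)] dig_const_index[OF that assms(1)] unfolding eq by simp
  qed simp
  then have "(\<Sum>i<p. if const_index p m l = const_index p m i then w $ i else 0)
    = (\<Sum>i<p. if i = l then w $ i else 0)"
    by (intro sum.cong) auto
  then show ?thesis using assms const_index_less by (simp add: diag_tensor_index)
qed

lemma diag_tensor_off_diagonal:
  assumes "q < p ^ m" "k < m" "k' < m" "dig p q k \<noteq> dig p q k'"
  shows "diag_tensor p m w $ q = 0"
  unfolding diag_tensor_index[OF assms(1)]
proof (intro sum.neutral ballI)
  fix i assume "i \<in> {..<p}"
  then have "q \<noteq> const_index p m i" using assms(2-) by (auto simp: dig_const_index)
  then show "(if q = const_index p m i then w $ i else 0) = 0" by simp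
qed

locale lyapunov_graph =
  fixes p :: nat and E :: "(nat \<times> nat) set"
  assumes two_nodes: "2 \<le> p"
    and edges: "E \<subseteq> {0..<p} \<times> {0..<p}"
    and self_loops: "\<forall>i<p. (i, i) \<in> E"
    and no_isolated: "\<forall>i<p. \<not> isolated p E i"
begin

lemma p_pos: "0 < p"
  using two_nodes by simp

lemma edge_less: "(i, j) \<in> E \<Longrightarrow> i < p \<and> j < p"
  using edges by auto

lemma finite_E: "finite E"
  using edges by (rule finite_subset) simp

definition coords :: "coord set" where
  "coords = (\<lambda>(i, j). Entry i j) ` E \<union> (\<lambda>(m, i). Noise m i) ` ({2, 3, 4} \<times> {..<p})"

definition cmat :: "(coord \<Rightarrow> real) \<Rightarrow> real mat" where
  "cmat x = mat p p (\<lambda>(j, i). if (i, j) \<in> E then x (Entry i j) else 0)"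

definition cvec :: "nat \<Rightarrow> (coord \<Rightarrow> real) \<Rightarrow> real vec" where
  "cvec m x = vec p (\<lambda>i. x (Noise m i))"

definition param :: "(coord \<Rightarrow> real) \<Rightarrow> param" where
  "param x = (cmat x, cvec 2 x, cvec 3 x, cvec 4 x)"

definition dom :: "(coord \<Rightarrow> real) set" where
  "dom = {x. param x \<in> param_space p E}"

lemma finite_coords: "finite coords"
  using finite_E by (simp add: coords_def)

lemma Entry_coords [simp]: "Entry i j \<in> coords \<longleftrightarrow> (i, j) \<in> E"
  by (auto simp: coords_def)

lemma Noise_coords [simp]: "Noise m i \<in> coords \<longleftrightarrow> m \<in> {2, 3, 4} \<and> i < p"
  by (auto simp: coords_def)

lemma cmat_carrier [simp]: "cmat x \<in> carrier_mat p p"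
  by (simp add: cmat_def)

lemma param_coord_of: "\<theta> \<in> param_space p E \<Longrightarrow> param (coord_of \<theta>) = \<theta>"
  by (cases \<theta>)
    (auto simp: param_space_def edge_mats_def param_def cmat_def cvec_def coord_of_def
      intro!: eq_matI eq_vecI)

lemma coord_of_param: "c \<in> coords \<Longrightarrow> coord_of (param x) c = x c"
  using edge_less by (auto simp: coords_def param_def cmat_def cvec_def coord_of_def)

lemma param_cong: "(\<And>c. c \<in> coords \<Longrightarrow> x c = y c) \<Longrightarrow> param x = param y"
  by (auto simp: param_def cmat_def cvec_def intro!: eq_matI eq_vecI)

lemma polyfun_param_polys: "g \<in> polyfun coords \<Longrightarrow> (\<lambda>\<theta>. g (coord_of \<theta>)) \<in> param_polys p E"
proof (induction rule: polyfun.induct)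
  case (coord c)
  then consider (Entry) i j where "c = Entry i j" "(i, j) \<in> E"
    | (Noise) m i where "c = Noise m i" "m \<in> {2, 3, 4}" "i < p"
    by (cases c) auto
  then show ?case
  proof cases
    case Entry
    then show ?thesis using param_polys.edge[of i j E p] by (simp add: coord_of_def case_prod_unfold)
  next
    case Noise
    then show ?thesis
      using param_polys.diag2[of i p E] param_polys.diag3[of i p E] param_polys.diag4[of i p E]
      by (auto simp: coord_of_def case_prod_unfold)
  qed
qed (auto intro: param_polys.intros)

text \<open>The zero set of the one polynomial \<open>g\<close> serves as exceptional set, and the
  point \<open>x\<close> shows that it is proper.\<close>

lemma genericallyI:
  assumes g: "g \<in> polyfun coords" and x: "x \<in> dom" "g x \<noteq> 0"
    and P: "\<And>y. y \<in> dom \<Longrightarrow> g y \<noteq> 0 \<Longrightarrow> P (param y)"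
  shows "generically p E P"
proof -
  let ?f = "\<lambda>\<theta>. g (coord_of \<theta>)"
  let ?Z = "{\<theta> \<in> param_space p E. \<forall>f\<in>{?f}. f \<theta> = 0}"
  have "g (coord_of (param x)) = g x" by (rule polyfun_cong[OF g coord_of_param])
  then have "param x \<in> param_space p E" "param x \<notin> ?Z" using x by (auto simp: dom_def)
  then have "proper_algebraic_subset p E ?Z"
    unfolding proper_algebraic_subset_def using polyfun_param_polys[OF g]
    by (intro conjI exI[of _ "{?f}"]) auto
  moreover have "\<forall>\<theta>\<in>param_space p E - ?Z. P \<theta>"
  proof
    fix \<theta> assume \<theta>: "\<theta> \<in> param_space p E - ?Z"
    then have "coord_of \<theta> \<in> dom" by (simp add: dom_def param_coord_of)
    with P[of "coord_of \<theta>"] \<theta> show "P \<theta>" by (simp add: param_coord_of)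
  qed
  ultimately show ?thesis unfolding generically_def by blast
qed

lemma polyfun_cmat: "i < p \<Longrightarrow> j < p \<Longrightarrow> (\<lambda>x. cmat x $$ (j, i)) \<in> polyfun coords"
  by (cases "(i, j) \<in> E") (auto simp: cmat_def intro: polyfun.intros)

section \<open>Entries of Kronecker powers and cumulants as functions of the coordinates\<close>

definition K :: "nat \<Rightarrow> (coord \<Rightarrow> real) \<Rightarrow> nat \<Rightarrow> nat \<Rightarrow> real" where
  "K m x q r = kron_pow (cmat x) m $$ (q, r)"

definition T :: "nat \<Rightarrow> (coord \<Rightarrow> real) \<Rightarrow> nat \<Rightarrow> real" where
  "T m x q = cumulant p m (cmat x) (cvec m x) $ q"

definition D :: "nat \<Rightarrow> (coord \<Rightarrow> real) \<Rightarrow> nat \<Rightarrow> real" where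
  "D m x q = diag_tensor p m (cvec m x) $ q"

definition KD :: "nat \<Rightarrow> (coord \<Rightarrow> real) \<Rightarrow> nat \<times> nat \<Rightarrow> nat \<Rightarrow> nat \<Rightarrow> real" where
  "KD m x e q r = kron_pow_deriv p (cmat x) m e $$ (q, r)"

lemma K_eq: "q < p ^ m \<Longrightarrow> r < p ^ m \<Longrightarrow> K m x q r = (\<Prod>k<m. cmat x $$ (dig p q k, dig p r k))"
  by (simp add: K_def kron_pow_index[OF cmat_carrier])

lemma KD_eq: "q < p ^ m \<Longrightarrow> r < p ^ m \<Longrightarrow> KD m x (a, b) q r =
    (\<Sum>l<m. of_bool (dig p q l = b \<and> dig p r l = a) *
      (\<Prod>k\<in>{..<m} - {l}. cmat x $$ (dig p q k, dig p r k)))"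
  by (simp add: KD_def kron_pow_deriv_index[OF cmat_carrier])

lemma polyfun_K: "q < p ^ m \<Longrightarrow> r < p ^ m \<Longrightarrow> (\<lambda>x. K m x q r) \<in> polyfun coords"
  unfolding K_eq by (intro polyfun_prod polyfun_cmat dig_less p_pos)

lemma polyfun_KD: "q < p ^ m \<Longrightarrow> r < p ^ m \<Longrightarrow> (\<lambda>x. KD m x e q r) \<in> polyfun coords"
  by (cases e, simp only: KD_eq)
    (intro polyfun_sum polyfun.mult polyfun.const polyfun_prod polyfun_cmat dig_less p_pos)

lemma D_eq: "q < p ^ m \<Longrightarrow> D m x q = (\<Sum>i<p. of_bool (q = const_index p m i) * x (Noise m i))"
  unfolding D_def by (subst diag_tensor_index) (auto simp: cvec_def simp del: sum_of_bool_mult_eq intro!: sum.cong)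

lemma polyfun_D: "q < p ^ m \<Longrightarrow> m \<in> {2, 3, 4} \<Longrightarrow> (\<lambda>x. D m x q) \<in> polyfun coords"
  unfolding D_eq by (intro polyfun_sum polyfun.mult polyfun.const polyfun.coord) simp

lemma dom_schur_stable: "x \<in> dom \<Longrightarrow> schur_stable (cmat x)"
  by (simp add: dom_def param_space_def param_def)

abbreviation IK :: "nat \<Rightarrow> (coord \<Rightarrow> real) \<Rightarrow> real mat" where
  "IK m x \<equiv> 1\<^sub>m (p ^ m) - kron_pow (cmat x) m"

lemma IK_carrier [simp]: "IK m x \<in> carrier_mat (p ^ m) (p ^ m)"
  using kron_pow_carrier[OF cmat_carrier, of x m] by (simp add: minus_carrier_mat)

lemma kron_pow_cmat_dim [simp]:
  "dim_row (kron_pow (cmat x) m) = p ^ m" "dim_col (kron_pow (cmat x) m) = p ^ m"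
  using kron_pow_carrier[OF cmat_carrier, of x m] by auto

lemma polyfun_IK: "q < p ^ m \<Longrightarrow> r < p ^ m \<Longrightarrow> (\<lambda>x. IK m x $$ (q, r)) \<in> polyfun coords"
proof -
  assume qr: "q < p ^ m" "r < p ^ m"
  have "IK m x $$ (q, r) = of_bool (q = r) - K m x q r" for x
    using qr kron_pow_carrier[OF cmat_carrier, of x m] by (simp add: K_def)
  then show ?thesis using polyfun_diff[OF polyfun.const polyfun_K[OF qr]] by simp
qed

lemma polyfun_det_IK: "(\<lambda>x. det (IK m x)) \<in> polyfun coords"
  by (rule polyfun_det[OF IK_carrier polyfun_IK])

lemma det_IK_nonzero: "x \<in> dom \<Longrightarrow> 0 < m \<Longrightarrow> det (IK m x) \<noteq> 0"
  by (rule schur_stable_det_nonzero[OF cmat_carrier dom_schur_stable])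

lemma diag_tensor_carrier: "diag_tensor p m w \<in> carrier_vec (p ^ m)"
  by (simp add: diag_tensor_def)

text \<open>Stability makes the determinant nonzero, so the inverse in the definition of the
  cumulant really exists.\<close>

lemma cumulant_equation:
  assumes "x \<in> dom" "0 < m"
  shows "cumulant p m (cmat x) w \<in> carrier_vec (p ^ m)"
    and "IK m x *\<^sub>v cumulant p m (cmat x) w = diag_tensor p m w"
proof -
  have "IK m x \<in> Units (ring_mat TYPE(real) (p ^ m) ())"
    by (rule det_non_zero_imp_unit[OF IK_carrier det_IK_nonzero[OF assms]])
  then obtain B where B: "mat_inverse (IK m x) = Some B"
    using mat_inverse(1)[OF IK_carrier, of m x "()"] by (cases "mat_inverse (IK m x)") auto
  note BI = mat_inverse(2)[OF IK_carrier B]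
  have cum: "cumulant p m (cmat x) w = B *\<^sub>v diag_tensor p m w"
    by (simp add: cumulant_def B)
  show "cumulant p m (cmat x) w \<in> carrier_vec (p ^ m)"
    unfolding cum using BI by (intro mult_mat_vec_carrier[OF _ diag_tensor_carrier]) auto
  have "IK m x *\<^sub>v (B *\<^sub>v diag_tensor p m w) = (IK m x * B) *\<^sub>v diag_tensor p m w"
    by (rule assoc_mult_mat_vec[OF IK_carrier _ diag_tensor_carrier, symmetric]) (use BI in blast)
  also have "\<dots> = diag_tensor p m w"
    using BI one_mult_mat_vec[OF diag_tensor_carrier[of m w]] by simp
  finally show "IK m x *\<^sub>v cumulant p m (cmat x) w = diag_tensor p m w" by (simp add: cum)
qed

lemma T_equation:
  assumes "x \<in> dom" "0 < m" "q < p ^ m"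
  shows "T m x q - (\<Sum>r<p ^ m. K m x q r * T m x r) = D m x q"
proof -
  note c = cumulant_equation[OF assms(1,2), of "cvec m x"]
  note k = kron_pow_carrier[OF cmat_carrier, of x m]
  have "D m x q = (IK m x *\<^sub>v cumulant p m (cmat x) (cvec m x)) $ q"
    by (simp add: D_def c(2))
  also have "\<dots> = (\<Sum>r<p ^ m. (of_bool (q = r) - K m x q r) * T m x r)"
    using c(1) k assms(3) by (simp add: scalar_prod_def atLeast0LessThan K_def T_def of_bool_def)
  also have "\<dots> = (\<Sum>r<p ^ m. of_bool (q = r) * T m x r) - (\<Sum>r<p ^ m. K m x q r * T m x r)"
    by (simp add: left_diff_distrib sum_subtractf del: sum_of_bool_mult_eq)
  also have "(\<Sum>r<p ^ m. of_bool (q = r) * T m x r) = (\<Sum>r<p ^ m. if r = q then T m x r else 0)"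
    by (intro sum.cong) auto
  also have "\<dots> = T m x q" using assms(3) by simp
  finally show ?thesis by simp
qed

text \<open>Cramer's rule: multiplying (I - K) T = D by the adjugate expresses det (I - K) T through
  polynomials, and this determinant has no zero on \<open>dom\<close>.\<close>

lemma ratfun_T:
  assumes m: "m \<in> {2, 3, 4}" and q: "q < p ^ m"
  shows "ratfun coords dom (\<lambda>x. T m x q)"
proof (rule ratfun_divide_polyfun[OF _ polyfun_det_IK[of m]])
  have m0: "0 < m" using m by auto
  have "(\<lambda>x. adj_mat (IK m x) $$ (q, r)) \<in> polyfun coords" if r: "r < p ^ m" for r
  proof -
    have "(\<lambda>x. det (mat_delete (IK m x) r q)) \<in> polyfun coords"
    proof (rule polyfun_det)
      show "mat_delete (IK m x) r q \<in> carrier_mat (p ^ m - 1) (p ^ m - 1)" for x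
        by (rule mat_delete_carrier) simp
      fix i j assume "i < p ^ m - 1" "j < p ^ m - 1"
      then show "(\<lambda>x. mat_delete (IK m x) r q $$ (i, j)) \<in> polyfun coords"
        by (auto simp: mat_delete_def simp del: index_minus_mat(1) intro!: polyfun_IK)
    qed
    then have "(\<lambda>x. (-1) ^ (r + q) * det (mat_delete (IK m x) r q)) \<in> polyfun coords"
      by (intro polyfun.mult polyfun.const)
    moreover have "adj_mat (IK m x) $$ (q, r) = (-1) ^ (r + q) * det (mat_delete (IK m x) r q)" for x
      using q r kron_pow_carrier[OF cmat_carrier, of x m] by (simp add: adj_mat_def cofactor_def)
    ultimately show ?thesis by simp
  qed
  then have "ratfun coords dom (\<lambda>x. \<Sum>r<p ^ m. adj_mat (IK m x) $$ (q, r) * D m x r)"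
    by (intro ratfun_polyfun polyfun_sum polyfun.mult polyfun_D m) auto
  moreover have "T m x q * det (IK m x) = (\<Sum>r<p ^ m. adj_mat (IK m x) $$ (q, r) * D m x r)"
    if "x \<in> dom" for x
  proof -
    let ?c = "cumulant p m (cmat x) (cvec m x)"
    note c = cumulant_equation[OF that m0, of "cvec m x"]
    note adj = adj_mat[OF IK_carrier[of m x]]
    have "adj_mat (IK m x) *\<^sub>v diag_tensor p m (cvec m x) = (adj_mat (IK m x) * IK m x) *\<^sub>v ?c"
      using assoc_mult_mat_vec[OF adj(1) IK_carrier c(1)] c(2) by simp
    also have "\<dots> = det (IK m x) \<cdot>\<^sub>v ?c"
      unfolding adj(3)
    proof (rule eq_vecI)
      fix i assume "i < dim_vec (det (IK m x) \<cdot>\<^sub>v ?c)"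
      then have i: "i < p ^ m" using c(1) by simp
      have "row (det (IK m x) \<cdot>\<^sub>m 1\<^sub>m (p ^ m)) i = det (IK m x) \<cdot>\<^sub>v unit_vec (p ^ m) i"
        using i by (intro eq_vecI) auto
      then show "(det (IK m x) \<cdot>\<^sub>m 1\<^sub>m (p ^ m) *\<^sub>v ?c) $ i = (det (IK m x) \<cdot>\<^sub>v ?c) $ i"
        using i c(1) smult_scalar_prod_distrib[OF unit_vec_carrier c(1)] by simp
    qed (use c(1) in simp)
    finally have "(adj_mat (IK m x) *\<^sub>v diag_tensor p m (cvec m x)) $ q = (det (IK m x) \<cdot>\<^sub>v ?c) $ q"
      by simp
    then show ?thesis
      using q adj(1) c(1) diag_tensor_carrier[of m "cvec m x"]
      by (simp add: scalar_prod_def atLeast0LessThan T_def D_def mult.commute)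
  qed
  ultimately show "ratfun coords dom (\<lambda>x. T m x q * det (IK m x))"
    using ratfun_cong[of dom "\<lambda>x. T m x q * det (IK m x)"] by simp
  show "det (IK m x) \<noteq> 0" if "x \<in> dom" for x by (rule det_IK_nonzero[OF that m0])
qed

section \<open>A convex set of stable parameters\<close>

text \<open>The domain is not convex, as third-order noise may have either sign; here it is
  positive. Entries below 1 / p keep absolute row sums below 1, which secures stability, and all
  inequalities are strict, so short steps along any line stay inside.\<close>

definition box :: "(coord \<Rightarrow> real) set" where
  "box = {x. (\<forall>(i, j)\<in>E. \<bar>x (Entry i j)\<bar> < 1 / p) \<and> (\<forall>m\<in>{2, 3, 4}. \<forall>i<p. 0 < x (Noise m i))}"

lemma box_dom: "box \<subseteq> dom"
proof
  fix x assume x: "x \<in> box"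
  have "schur_stable (cmat x)"
  proof (rule schur_stable_of_row_sums[OF cmat_carrier])
    fix i assume "i < p"
    have "(\<Sum>j<p. \<bar>cmat x $$ (i, j)\<bar>) < (\<Sum>j<p. 1 / p)"
      using x \<open>i < p\<close> p_pos by (intro sum_strict_mono) (auto simp: cmat_def box_def)
    then show "(\<Sum>j<p. \<bar>cmat x $$ (i, j)\<bar>) < 1" using p_pos by simp
  qed
  moreover have "cmat x \<in> edge_mats p E" by (auto simp: edge_mats_def cmat_def)
  ultimately show "x \<in> dom"
    using x by (auto simp: dom_def param_space_def param_def cvec_def box_def order_less_imp_not_eq2)
qed

lemma box_convex:
  assumes "x \<in> box" "y \<in> box" "0 < t" "t < 1"
  shows "line x (\<lambda>c. y c - x c) t \<in> box"
proof -
  have eq: "line x (\<lambda>c. y c - x c) t c = (1 - t) * x c + t * y c" for c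
    by (simp add: line_def algebra_simps)
  have abs: "\<bar>(1 - t) * a + t * b\<bar> < c" if "\<bar>a\<bar> < c" "\<bar>b\<bar> < c" for a b c :: real
  proof -
    have "\<bar>(1 - t) * a + t * b\<bar> \<le> (1 - t) * \<bar>a\<bar> + t * \<bar>b\<bar>"
      using assms(3,4) abs_triangle_ineq[of "(1 - t) * a" "t * b"] by (simp add: abs_mult)
    also have "\<dots> < (1 - t) * c + t * c"
      using that assms(3,4) by (intro add_strict_mono mult_strict_left_mono) auto
    finally show ?thesis by (simp add: algebra_simps)
  qed
  show ?thesis
    using assms unfolding box_def eq by (auto intro!: abs add_pos_pos mult_pos_pos)
qed

lemma eventually_line_box:
  assumes "x \<in> box"
  shows "\<forall>\<^sub>F t in at 0. line x v t \<in> box"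
proof -
  have lim: "((\<lambda>t. line x v t c) \<longlongrightarrow> x c) (at 0)" for c
    unfolding line_def by (auto intro!: tendsto_eq_intros)
  have "\<forall>\<^sub>F t in at 0. \<forall>e\<in>E. \<bar>line x v t (Entry (fst e) (snd e))\<bar> < 1 / p"
    unfolding eventually_ball_finite_distrib[OF finite_E]
    using assms by (auto simp: box_def intro!: order_tendstoD(2)[OF tendsto_rabs[OF lim]])
  moreover have "\<forall>\<^sub>F t in at 0. \<forall>e\<in>{2, 3, 4} \<times> {..<p}. 0 < line x v t (Noise (fst e) (snd e))"
    using assms by (subst eventually_ball_finite_distrib)
      (auto simp: box_def intro!: order_tendstoD(1)[OF lim])
  ultimately show ?thesis by eventually_elim (auto simp: box_def)
qed

section \<open>Derivatives along lines\<close>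

lemma cmat_line: "i < p \<Longrightarrow> j < p \<Longrightarrow> cmat (line x v t) $$ (j, i) = cmat x $$ (j, i) + t * cmat v $$ (j, i)"
  by (simp add: cmat_def line_def)

lemma DERIV_prod_affine:
  fixes a b :: "'k \<Rightarrow> real"
  assumes "finite S"
  shows "((\<lambda>t. \<Prod>k\<in>S. a k + t * b k) has_real_derivative (\<Sum>l\<in>S. b l * (\<Prod>k\<in>S - {l}. a k))) (at 0)"
proof -
  have "((\<lambda>t. \<Prod>k\<in>S. a k + t * b k) has_derivative
      (\<lambda>y. \<Sum>l\<in>S. (y * b l) * (\<Prod>k\<in>S - {l}. a k + 0 * b k))) (at 0)"
    by (intro has_derivative_prod) (auto intro!: derivative_eq_intros)
  then show ?thesis
    unfolding has_field_derivative_def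
    by (rule has_derivative_eq_rhs) (auto simp: fun_eq_iff sum_distrib_left mult_ac)
qed

lemma DERIV_K:
  assumes "q < p ^ m" "r < p ^ m"
  shows "((\<lambda>t. K m (line x v t) q r) has_real_derivative
    (\<Sum>l<m. cmat v $$ (dig p q l, dig p r l) *
      (\<Prod>k\<in>{..<m} - {l}. cmat x $$ (dig p q k, dig p r k)))) (at 0)"
  unfolding K_eq[OF assms] by (simp only: cmat_line dig_less p_pos) (rule DERIV_prod_affine, simp)

text \<open>Both sides are the derivative of an entry of the Kronecker power along \<open>v\<close>,
  collected by edge on the left and by slot on the right. The left form contains the matrices that
  make up the modified Jacobian.\<close>

lemma sum_KD:
  assumes "q < p ^ m" "r < p ^ m"
  shows "(\<Sum>(i, j)\<in>E. v (Entry i j) * KD m x (i, j) q r)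
    = (\<Sum>l<m. cmat v $$ (dig p q l, dig p r l) *
      (\<Prod>k\<in>{..<m} - {l}. cmat x $$ (dig p q k, dig p r k)))"
proof -
  have "cmat v $$ (b, a) = (\<Sum>(i, j)\<in>E. v (Entry i j) * of_bool (b = j \<and> a = i))" if "a < p" "b < p" for a b
  proof -
    have "(\<Sum>(i, j)\<in>E. v (Entry i j) * of_bool (b = j \<and> a = i))
      = (\<Sum>e\<in>E. if e = (a, b) then v (Entry a b) else 0)"
      by (intro sum.cong) auto
    then show ?thesis using that finite_E by (simp add: cmat_def)
  qed
  then have "(\<Sum>l<m. cmat v $$ (dig p q l, dig p r l) *
      (\<Prod>k\<in>{..<m} - {l}. cmat x $$ (dig p q k, dig p r k)))
    = (\<Sum>l<m. \<Sum>(i, j)\<in>E. v (Entry i j) * (of_bool (dig p q l = j \<and> dig p r l = i) *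
      (\<Prod>k\<in>{..<m} - {l}. cmat x $$ (dig p q k, dig p r k))))"
    by (simp add: dig_less p_pos sum_distrib_right case_prod_unfold mult.assoc
        del: sum_of_bool_mult_eq sum_mult_of_bool_eq)
  also have "\<dots> = (\<Sum>(i, j)\<in>E. v (Entry i j) * KD m x (i, j) q r)"
    by (subst sum.swap) (simp add: KD_eq[OF assms] sum_distrib_left case_prod_unfold
        del: sum_of_bool_mult_eq sum_mult_of_bool_eq)
  finally show ?thesis by simp
qed

lemma D_line: "q < p ^ m \<Longrightarrow> D m (line x v t) q = D m x q + t * D m v q"
  by (simp add: D_eq line_def distrib_left sum.distrib sum_distrib_left mult_ac
      del: sum_of_bool_mult_eq sum_mult_of_bool_eq)

text \<open>This ties the modified Jacobian to the model: T - K T = D holds near \<open>x\<close>,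
  so T' - K' T - K T' = D' holds at \<open>x\<close>, and K' T combines the Jacobian columns with
  the edge components of \<open>v\<close> as weights. As D is linear in the noise, D' is
  \<open>D m v\<close>.\<close>

lemma differentiated_T_equation:
  assumes x: "x \<in> box" and m: "0 < m" and q: "q < p ^ m"
    and T': "\<And>r. r < p ^ m \<Longrightarrow> ((\<lambda>t. T m (line x v t) r) has_real_derivative T' r) (at 0)"
  shows "T' q - (\<Sum>r<p ^ m. (\<Sum>(i, j)\<in>E. v (Entry i j) * KD m x (i, j) q r) * T m x r + K m x q r * T' r)
    = D m v q"
proof -
  have 0: "line x v 0 = x" by (auto simp: line_def)
  have "((\<lambda>t. T m (line x v t) q - (\<Sum>r<p ^ m. K m (line x v t) q r * T m (line x v t) r))
    has_real_derivative
      T' q - (\<Sum>r<p ^ m. (\<Sum>(i, j)\<in>E. v (Entry i j) * KD m x (i, j) q r) * T m x r + K m x q r * T' r)) (at 0)"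
  proof (intro DERIV_diff DERIV_sum T' q)
    fix r assume "r \<in> {..<p ^ m}"
    then have r: "r < p ^ m" by simp
    show "((\<lambda>t. K m (line x v t) q r * T m (line x v t) r) has_real_derivative
      (\<Sum>(i, j)\<in>E. v (Entry i j) * KD m x (i, j) q r) * T m x r + K m x q r * T' r) (at 0)"
      using DERIV_mult[OF DERIV_K[OF q r, of x v] T'[OF r]] sum_KD[OF q r, of v x]
      by (simp add: 0 mult.commute)
  qed
  moreover have "((\<lambda>t. D m (line x v t) q) has_real_derivative D m v q) (at 0)"
    unfolding D_line[OF q] by (auto intro!: derivative_eq_intros)
  moreover have "\<forall>\<^sub>F t in nhds 0. line x v t \<in> box"
    using eventually_line_box[OF x, of v] x by (simp add: eventually_nhds_conv_at 0)
  then have "\<forall>\<^sub>F t in nhds 0. T m (line x v t) q -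
      (\<Sum>r<p ^ m. K m (line x v t) q r * T m (line x v t) r) = D m (line x v t) q"
    by eventually_elim (use box_dom T_equation m q in blast)
  from DERIV_cong_ev[OF refl this refl] calculation(2)
  have "((\<lambda>t. T m (line x v t) q - (\<Sum>r<p ^ m. K m (line x v t) q r * T m (line x v t) r))
    has_real_derivative D m v q) (at 0)" by simp
  ultimately show ?thesis by (elim DERIV_unique)
qed

end

section \<open>A base point with injective Jacobian\<close>

text \<open>Jacobian rows belong to sorted tuples, so the exceptional entry j of (i, ..., i, j) sits
  at the end that the order of i and j demands. Later arguments only use that it occupies some digit
  \<open>k0\<close>.\<close>

definition defect_tuple :: "nat \<Rightarrow> nat \<Rightarrow> nat \<Rightarrow> nat list" where
  "defect_tuple m i j = (if i < j then replicate (m - 1) i @ [j] else j # replicate (m - 1) i)"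

lemma length_defect_tuple: "0 < m \<Longrightarrow> length (defect_tuple m i j) = m"
  by (simp add: defect_tuple_def)

lemma sorted_defect_tuple: "sorted (defect_tuple m i j)"
  by (simp add: defect_tuple_def sorted_append)

lemma set_defect_tuple: "2 \<le> m \<Longrightarrow> set (defect_tuple m i j) = {i, j}"
  by (auto simp: defect_tuple_def set_replicate_conv_if)

lemma dig_defect_tuple:
  assumes "2 \<le> m" "i < p" "j < p"
  shows "\<exists>k0<m. \<forall>k<m. dig p (tuple_index p (defect_tuple m i j)) k = (if k = k0 then j else i)"
proof -
  let ?t = "defect_tuple m i j"
  have set: "set ?t \<subseteq> {..<p}" and len: "length ?t = m"
    using assms by (auto simp: set_defect_tuple length_defect_tuple)
  have dig: "dig p (tuple_index p ?t) k = ?t ! (m - 1 - k)" if "k < m" for k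
    using dig_tuple_index[OF set, of k] that len by simp
  show ?thesis
  proof (cases "i < j")
    case True
    then have "?t ! (m - 1 - k) = (if k = 0 then j else i)" if "k < m" for k
      using assms that by (auto simp: defect_tuple_def nth_append)
    then show ?thesis using assms dig by (intro exI[of _ 0]) simp
  next
    case False
    then have "?t ! (m - 1 - k) = (if k = m - 1 then j else i)" if "k < m" for k
      using assms that by (auto simp: defect_tuple_def nth_Cons')
    then show ?thesis using assms dig by (intro exI[of _ "m - 1"]) simp
  qed
qed

lemma prod_of_bool_power:
  fixes a :: real
  assumes "finite S"
  shows "(\<Prod>k\<in>S. a * of_bool (P k)) = a ^ card S * of_bool (\<forall>k\<in>S. P k)"
  using assms by (induction S) auto

text \<open>With at least three digits, deleting one other than the defect leaves both i and j. With
  two digits a single one remains, and it is trivially constant; this is how the reverse edge enters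
  in order 2 and in no other.\<close>

lemma single_defect_all_but_one:
  fixes k0 k m :: nat
  assumes "i \<noteq> j" "2 \<le> m" "k0 < m" "k < m" and d: "\<And>k. k < m \<Longrightarrow> d k = (if k = k0 then j else i)"
  shows "(\<forall>k'\<in>{..<m} - {k}. d k' = l) \<longleftrightarrow> k = k0 \<and> l = i \<or> k \<noteq> k0 \<and> m = 2 \<and> l = j"
proof (cases "k = k0")
  case True
  have "\<exists>k'<m. k' \<noteq> k0" using assms(2) by (intro exI[of _ "if k0 = 0 then 1 else 0"]) auto
  then show ?thesis using True d by auto
next
  case False
  show ?thesis
  proof (cases "m = 2")
    case True
    then have "{..<m} - {k} = {k0}" using False assms by auto
    then show ?thesis using False True d assms(3) by auto
  next
    case m: False
    have "(0 \<noteq> k \<and> 0 \<noteq> k0) \<or> (1 \<noteq> k \<and> 1 \<noteq> k0) \<or> (2 \<noteq> k \<and> 2 \<noteq> k0)" by arith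
    moreover have "0 < m" "1 < m" "2 < m" using assms(2) m by auto
    ultimately have "\<exists>k'. k' < m \<and> k' \<noteq> k \<and> k' \<noteq> k0" by blast
    then obtain k' where k': "k' < m" "k' \<noteq> k" "k' \<noteq> k0" by blast
    have "\<not> (\<forall>k'\<in>{..<m} - {k}. d k' = l)"
    proof
      assume "\<forall>k'\<in>{..<m} - {k}. d k' = l"
      then have "d k' = l" "d k0 = l" using k' False assms(3) by auto
      then show False using d[OF k'(1)] d[OF assms(3)] k'(3) assms(1) by simp
    qed
    then show ?thesis using False m by simp
  qed
qed

text \<open>This is the product rule at aI against the constant tuple of \<open>l\<close>: slot
  \<open>k\<close> is differentiated and every other slot demands the digit \<open>l\<close>. Only
  \<open>k = k0\<close> survives, and for m = 2 the other slot as well.\<close>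

lemma single_defect_sum:
  fixes a :: real
  assumes "i \<noteq> j" "2 \<le> m" "k0 < m" and d: "\<And>k. k < m \<Longrightarrow> d k = (if k = k0 then j else i)"
  shows "(\<Sum>k<m. \<phi> (d k) * (\<Prod>k'\<in>{..<m} - {k}. a * of_bool (d k' = l)))
    = a ^ (m - 1) * (\<phi> j * of_bool (l = i) + \<phi> i * of_bool (m = 2 \<and> l = j))"
proof -
  have "(\<Sum>k<m. \<phi> (d k) * (\<Prod>k'\<in>{..<m} - {k}. a * of_bool (d k' = l)))
    = (\<Sum>k<m. \<phi> (d k) * (a ^ (m - 1) * of_bool (k = k0 \<and> l = i \<or> k \<noteq> k0 \<and> m = 2 \<and> l = j)))"
  proof (intro sum.cong refl)
    fix k assume "k \<in> {..<m}"
    then have k: "k < m" by simp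
    show "\<phi> (d k) * (\<Prod>k'\<in>{..<m} - {k}. a * of_bool (d k' = l))
      = \<phi> (d k) * (a ^ (m - 1) * of_bool (k = k0 \<and> l = i \<or> k \<noteq> k0 \<and> m = 2 \<and> l = j))"
      using single_defect_all_but_one[OF assms(1-3) k d] k by (simp only: prod_of_bool_power finite_Diff finite_lessThan) simp
  qed
  also have "\<dots> = \<phi> (d k0) * (a ^ (m - 1) * of_bool (l = i))
      + (\<Sum>k\<in>{..<m} - {k0}. \<phi> i * (a ^ (m - 1) * of_bool (m = 2 \<and> l = j)))"
    using assms(3) by (subst sum.remove[of _ k0]) (auto simp: d intro!: sum.cong)
  also have "(\<Sum>k\<in>{..<m} - {k0}. \<phi> i * (a ^ (m - 1) * of_bool (m = 2 \<and> l = j)))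
      = \<phi> i * (a ^ (m - 1) * of_bool (m = 2 \<and> l = j))"
    using assms(3) by (cases "m = 2") auto
  finally show ?thesis using d[OF assms(3)] by (simp add: algebra_simps)
qed

text \<open>Second-order product rule at aI: slot \<open>k\<close> carries a self-loop and slot
  \<open>k'\<close> the perturbation. A slot with the self-loop differs from an untouched one by a
  missing factor a, so each of the m - 1 choices of \<open>k\<close> contributes 1 / a times the
  product with only \<open>k'\<close> deleted.\<close>

lemma double_deletion_sum:
  fixes a :: real and b :: "nat \<Rightarrow> real"
  assumes "a \<noteq> 0" "0 < m"
  shows "(\<Sum>k<m. of_bool (P k) * (\<Sum>k'\<in>{..<m} - {k}. b k' * (\<Prod>k''\<in>{..<m} - {k} - {k'}. a * of_bool (P k''))))
    = (real m - 1) / a * (\<Sum>k'<m. b k' * (\<Prod>k''\<in>{..<m} - {k'}. a * of_bool (P k'')))"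
proof -
  let ?Q = "\<lambda>k k'. \<Prod>k''\<in>{..<m} - {k} - {k'}. a * of_bool (P k'')"
  have set: "{k' \<in> {..<m}. k \<noteq> k'} = {..<m} - {k}" "{k' \<in> {..<m}. k' \<noteq> k} = {..<m} - {k}" for k
    by auto
  have "(\<Sum>k<m. of_bool (P k) * (\<Sum>k'\<in>{..<m} - {k}. b k' * ?Q k k'))
    = (\<Sum>k<m. \<Sum>k'\<in>{k' \<in> {..<m}. k \<noteq> k'}. of_bool (P k) * (b k' * ?Q k k'))"
    unfolding set sum_distrib_left by simp
  also have "\<dots> = (\<Sum>k'<m. \<Sum>k\<in>{k \<in> {..<m}. k \<noteq> k'}. of_bool (P k) * (b k' * ?Q k k'))"
    by (rule sum.swap_restrict) auto
  also have "\<dots> = (\<Sum>k'<m. \<Sum>k\<in>{..<m} - {k'}. b k' * (\<Prod>k''\<in>{..<m} - {k'}. a * of_bool (P k'')) / a)"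
    unfolding set
  proof (intro sum.cong[OF refl])
    fix k' k assume "k' \<in> {..<m}" "k \<in> {..<m} - {k'}"
    then have "(\<Prod>k''\<in>{..<m} - {k'}. a * of_bool (P k'')) = a * of_bool (P k) * ?Q k' k"
      by (subst prod.remove[of _ k]) auto
    moreover have "?Q k' k = ?Q k k'" by (rule prod.cong) auto
    ultimately show "of_bool (P k) * (b k' * ?Q k k')
      = b k' * (\<Prod>k''\<in>{..<m} - {k'}. a * of_bool (P k'')) / a"
      using assms(1) by simp
  qed
  also have "\<dots> = (real m - 1) / a * (\<Sum>k'<m. b k' * (\<Prod>k''\<in>{..<m} - {k'}. a * of_bool (P k'')))"
    using assms(2) by (simp add: sum_distrib_left of_nat_diff)
  finally show ?thesis .
qed

text \<open>\<open>W\<close> is the unknown of an edge from i to j, \<open>h\<close> and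
  \<open>g\<close> are those of the self-loops at i and j. Multiplied by a (1 - a^m), equation m is
  affine in m up to the term a^m (g - aW), which second differences isolate. Once g = aW, what is
  left is aW + (m - 1) h = 0 for several m.\<close>

lemma second_difference_kernel:
  fixes a W h g :: real
  assumes a: "0 < a" "a < 1"
    and eq: "\<And>m. m \<in> {2, 3, 4} \<Longrightarrow>
      W + (real m - 1) / a * h + a ^ (m - 1) / (1 - a ^ m) * ((real m - 1) * h + g) = 0"
  shows "W = 0" "h = 0" "g = 0"
proof -
  have lin: "a * W + (real m - 1) * h + a ^ m * (g - a * W) = 0" if "m \<in> {2, 3, 4}" for m
  proof -
    have "a ^ m < 1" using a that by (intro power_less_one_iff[THEN iffD2]) auto
    then have nz: "1 - a ^ m \<noteq> 0" by simp
    have am: "a * a ^ (m - 1) = a ^ m" using that by (cases m) auto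
    have "0 = a * (1 - a ^ m) * (W + (real m - 1) / a * h + a ^ (m - 1) / (1 - a ^ m) * ((real m - 1) * h + g))"
      using eq[OF that] by simp
    also have "\<dots> = a * W * (1 - a ^ m) + (real m - 1) * h * (1 - a ^ m)
        + (a * a ^ (m - 1)) * ((real m - 1) * h + g)"
      using nz a(1) by (simp add: field_simps)
    also have "\<dots> = a * W + (real m - 1) * h + a ^ m * (g - a * W)"
      unfolding am by (simp add: algebra_simps)
    finally show ?thesis by simp
  qed
  \<comment> \<open>Equations m = 2, 3, 4 combined with weights 1, -2, 1.\<close>
  have 2: "a * W + h + a ^ 2 * (g - a * W) = 0" using lin[of 2] by simp
  have 3: "a * W + 2 * h + a ^ 3 * (g - a * W) = 0" using lin[of 3] by simp
  have 4: "a * W + 3 * h + a ^ 4 * (g - a * W) = 0" using lin[of 4] by simp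
  have "a ^ 2 * (1 - a) ^ 2 * (g - a * W)
    = (a * W + h + a ^ 2 * (g - a * W)) - 2 * (a * W + 2 * h + a ^ 3 * (g - a * W))
      + (a * W + 3 * h + a ^ 4 * (g - a * W))"
    by (simp add: power2_eq_square power3_eq_cube power4_eq_xxxx algebra_simps)
  also have "\<dots> = 0" using 2 3 4 by simp
  finally have g: "g = a * W" using a by simp
  show "h = 0" using 2 3 unfolding g by simp
  then show "W = 0" using 2 a unfolding g by simp
  then show "g = 0" using g by simp
qed

context lyapunov_graph
begin

definition Jf :: "nat \<Rightarrow> (coord \<Rightarrow> real) \<Rightarrow> nat \<times> nat \<Rightarrow> nat \<Rightarrow> real" where
  "Jf m x e q = (\<Sum>r<p ^ m. KD m x e q r * T m x r)"

lemma ratfun_Jf: "m \<in> {2, 3, 4} \<Longrightarrow> q < p ^ m \<Longrightarrow> ratfun coords dom (\<lambda>x. Jf m x e q)"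
  unfolding Jf_def by (intro ratfun_sum ratfun_mult ratfun_polyfun polyfun_KD ratfun_T) auto

lemma T_has_gradient:
  assumes "x \<in> box" "m \<in> {2, 3, 4}"
  shows "\<exists>g. \<forall>q<p ^ m. \<forall>v. ((\<lambda>t. T m (line x v t) q) has_real_derivative (\<Sum>c\<in>coords. g q c * v c)) (at 0)"
proof -
  have near: "\<forall>\<^sub>F t in at 0. line x v t \<in> dom" for v
    using eventually_line_box[OF assms(1), of v] box_dom by (rule eventually_mono[OF _ subsetD])
  have "\<forall>q\<in>{..<p ^ m}. \<exists>g. \<forall>v. ((\<lambda>t. T m (line x v t) q) has_real_derivative (\<Sum>c\<in>coords. g c * v c)) (at 0)"
    using ratfun_has_gradient[OF finite_coords ratfun_T[OF assms(2)] near] assms(1) box_dom by auto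
  from bchoice[OF this] show ?thesis by (auto simp: lessThan_def)
qed

section \<open>The base point and the direction of perturbation\<close>

text \<open>Half of the bound 1 / p in \<open>box\<close>, so the base point satisfies the bound
  strictly.\<close>

definition diag_value :: real where
  "diag_value = 1 / (2 * p)"

abbreviation (input) "a \<equiv> diag_value"

text \<open>Only one direction of each pair of opposite edges is perturbed; the row of order 3 for the
  other direction then kills the unknown of the reverse edge on its own.\<close>

definition oriented :: "nat \<Rightarrow> nat \<Rightarrow> bool" where
  "oriented i j \<longleftrightarrow> (i, j) \<in> E \<and> i \<noteq> j \<and> (i < j \<or> (j, i) \<notin> E)"

definition base :: "coord \<Rightarrow> real" where
  "base = (\<lambda>c. case c of Entry i j \<Rightarrow> if i = j then a else 0 | Noise m i \<Rightarrow> 1)"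

definition direction :: "coord \<Rightarrow> real" where
  "direction = (\<lambda>c. case c of Entry i j \<Rightarrow> of_bool (oriented i j) | Noise m i \<Rightarrow> 0)"

lemma a_bounds: "0 < a" "a < 1" "a < 1 / p"
  using two_nodes by (auto simp: diag_value_def field_simps)

lemma a_power_less: "0 < m \<Longrightarrow> a ^ m < 1"
  using a_bounds by (intro power_less_one_iff[THEN iffD2]) auto

lemma base_box: "base \<in> box"
  using a_bounds p_pos by (auto simp: box_def base_def)

lemma cmat_base: "i < p \<Longrightarrow> j < p \<Longrightarrow> cmat base $$ (j, i) = a * of_bool (j = i)"
  using self_loops by (auto simp: cmat_def base_def)

lemma cmat_direction: "i < p \<Longrightarrow> j < p \<Longrightarrow> cmat direction $$ (j, i) = of_bool (oriented i j)"
  by (auto simp: cmat_def direction_def oriented_def)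

lemma K_base: "q < p ^ m \<Longrightarrow> r < p ^ m \<Longrightarrow> K m base q r = a ^ m * of_bool (q = r)"
proof -
  assume qr: "q < p ^ m" "r < p ^ m"
  have "K m base q r = (\<Prod>k<m. a * of_bool (dig p q k = dig p r k))"
    by (simp add: K_eq[OF qr] cmat_base dig_less p_pos)
  also have "\<dots> = a ^ m * of_bool (\<forall>k<m. dig p q k = dig p r k)"
    by (simp add: prod_of_bool_power del: of_bool_eq_iff) (auto simp: Ball_def)
  also have "(\<forall>k<m. dig p q k = dig p r k) \<longleftrightarrow> q = r" using dig_eqI[OF qr] by auto
  finally show ?thesis .
qed

text \<open>The cumulant of order m of a single node with coefficient a and unit noise; at the base
  point it is the value at every constant tuple.\<close>

definition t0 :: "nat \<Rightarrow> real" where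
  "t0 m = 1 / (1 - a ^ m)"

lemma t0_pos: "0 < m \<Longrightarrow> 0 < t0 m"
  using a_power_less[of m] by (simp add: t0_def)

lemma T_base:
  assumes "0 < m" "q < p ^ m"
  shows "T m base q = t0 m * (\<Sum>l<p. of_bool (q = const_index p m l))"
proof -
  have "(\<Sum>r<p ^ m. K m base q r * T m base r) = (\<Sum>r<p ^ m. if r = q then a ^ m * T m base r else 0)"
    by (intro sum.cong) (auto simp: K_base assms(2))
  then have "T m base q * (1 - a ^ m) = D m base q"
    using T_equation[of base m q] base_box box_dom assms by (auto simp: algebra_simps)
  then show ?thesis
    using a_power_less[OF assms(1)] by (simp add: D_eq[OF assms(2)] base_def t0_def field_simps)
qed

lemma sum_T_base:
  assumes "0 < m"
  shows "(\<Sum>r<p ^ m. F r * T m base r) = t0 m * (\<Sum>l<p. F (const_index p m l))"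
proof -
  have "(\<Sum>r<p ^ m. F r * T m base r)
    = (\<Sum>r<p ^ m. \<Sum>l<p. if r = const_index p m l then t0 m * F r else 0)"
  proof (rule sum.cong[OF refl])
    fix r assume "r \<in> {..<p ^ m}"
    then have r: "r < p ^ m" by simp
    show "F r * T m base r = (\<Sum>l<p. if r = const_index p m l then t0 m * F r else 0)"
      unfolding T_base[OF assms r] sum_distrib_left by (rule sum.cong[OF refl]) simp
  qed
  also have "\<dots> = (\<Sum>l<p. \<Sum>r<p ^ m. if r = const_index p m l then t0 m * F r else 0)"
    by (rule sum.swap)
  also have "\<dots> = (\<Sum>l<p. t0 m * F (const_index p m l))"
    by (intro sum.cong refl) (simp add: const_index_less)
  finally show ?thesis by (simp add: sum_distrib_left)
qed

lemma KD_base_const_index: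
  assumes "q < p ^ m" "l < p"
  shows "KD m base (\<alpha>, \<beta>) q (const_index p m l) = of_bool (l = \<alpha>) *
    (\<Sum>k<m. of_bool (dig p q k = \<beta>) * (\<Prod>k'\<in>{..<m} - {k}. a * of_bool (dig p q k' = l)))"
proof -
  have "(\<Prod>k'\<in>{..<m} - {k}. cmat base $$ (dig p q k', dig p (const_index p m l) k'))
    = (\<Prod>k'\<in>{..<m} - {k}. a * of_bool (dig p q k' = l))" for k
    by (intro prod.cong refl) (simp add: dig_const_index cmat_base dig_less p_pos assms)
  then have "KD m base (\<alpha>, \<beta>) q (const_index p m l) =
    (\<Sum>k<m. of_bool (dig p q k = \<beta> \<and> l = \<alpha>) * (\<Prod>k'\<in>{..<m} - {k}. a * of_bool (dig p q k' = l)))"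
    unfolding KD_eq[OF assms(1) const_index_less[OF assms(2)]]
    by (intro sum.cong refl) (simp add: dig_const_index assms)
  then show ?thesis
    by (cases "l = \<alpha>") (simp_all del: sum_of_bool_mult_eq)
qed

end

section \<open>A row (i, ..., i, j) at the base point and to first order\<close>

locale defect_row = lyapunov_graph +
  fixes m i j q k0 :: nat
  assumes m: "m \<in> {2, 3, 4}" and i: "i < p" and j: "j < p" and neq: "i \<noteq> j"
    and q: "q < p ^ m" and k0: "k0 < m"
    and dig: "\<And>k. k < m \<Longrightarrow> dig p q k = (if k = k0 then j else i)"
begin

lemma m2: "2 \<le> m" and m0: "0 < m"
  using m by auto

lemmas defect_sum = single_defect_sum[OF neq m2 k0 dig]

text \<open>Since \<open>i \<noteq> j\<close>, the right-hand side is 0 whenever \<alpha> = \<beta>: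
  self-loop columns vanish at the base point, and only their derivatives carry information.\<close>

lemma Jf_base:
  assumes "\<alpha> < p"
  shows "Jf m base (\<alpha>, \<beta>) q
    = t0 m * a ^ (m - 1) * (of_bool (\<alpha> = i \<and> \<beta> = j) + of_bool (m = 2) * of_bool (\<alpha> = j \<and> \<beta> = i))"
proof -
  have "Jf m base (\<alpha>, \<beta>) q = t0 m * (\<Sum>l<p. KD m base (\<alpha>, \<beta>) q (const_index p m l))"
    unfolding Jf_def by (rule sum_T_base[OF m0])
  also have "(\<Sum>l<p. KD m base (\<alpha>, \<beta>) q (const_index p m l))
    = (\<Sum>l<p. if l = \<alpha> then (\<Sum>k<m. of_bool (dig p q k = \<beta>) *
        (\<Prod>k'\<in>{..<m} - {k}. a * of_bool (dig p q k' = l))) else 0)"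
    by (intro sum.cong refl) (simp add: KD_base_const_index q del: sum_of_bool_mult_eq)
  also have "\<dots> = (\<Sum>k<m. of_bool (dig p q k = \<beta>) * (\<Prod>k'\<in>{..<m} - {k}. a * of_bool (dig p q k' = \<alpha>)))"
    using assms by (simp del: sum_of_bool_mult_eq)
  also have "\<dots> = a ^ (m - 1) * (of_bool (j = \<beta>) * of_bool (\<alpha> = i) + of_bool (i = \<beta>) * of_bool (m = 2 \<and> \<alpha> = j))"
    by (rule defect_sum[where \<phi> = "\<lambda>b. of_bool (b = \<beta>)"])
  finally show ?thesis by (simp only: of_bool_conj eq_commute[of \<beta>] mult_ac)
qed

definition arcs :: real where
  "arcs = of_bool (oriented i j) + of_bool (m = 2) * of_bool (oriented j i)"

text \<open>The direction leaves the noise fixed, so the differentiated equation at \<open>q\<close>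
  reads (1 - a^m) T' = K' T. One factor \<open>t0 m\<close> comes from T, the other from solving for
  T'.\<close>

lemma T_derivative_base:
  assumes T': "\<And>r. r < p ^ m \<Longrightarrow> ((\<lambda>t. T m (line base direction t) r) has_real_derivative T' r) (at 0)"
  shows "T' q = t0 m * t0 m * a ^ (m - 1) * arcs"
proof -
  let ?K' = "\<lambda>r. \<Sum>(i, j)\<in>E. direction (Entry i j) * KD m base (i, j) q r"
  have "(\<Sum>l<p. ?K' (const_index p m l)) = a ^ (m - 1) * arcs"
  proof -
    have "?K' (const_index p m l)
      = a ^ (m - 1) * (of_bool (oriented l j) * of_bool (l = i) + of_bool (oriented l i) * of_bool (m = 2 \<and> l = j))"
      if "l < p" for l
    proof -
      have "?K' (const_index p m l) = (\<Sum>k<m. cmat direction $$ (dig p q k, l) *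
          (\<Prod>k'\<in>{..<m} - {k}. a * of_bool (dig p q k' = l)))"
        unfolding sum_KD[OF q const_index_less[OF that]]
        by (intro sum.cong prod.cong arg_cong2[where f = "(*)"] refl)
          (simp_all add: dig_const_index cmat_base dig_less p_pos that)
      also have "\<dots> = a ^ (m - 1) * (cmat direction $$ (j, l) * of_bool (l = i)
          + cmat direction $$ (i, l) * of_bool (m = 2 \<and> l = j))"
        by (rule defect_sum[where \<phi> = "\<lambda>b. cmat direction $$ (b, l)"])
      finally show ?thesis by (simp only: cmat_direction that i j)
    qed
    then have "(\<Sum>l<p. ?K' (const_index p m l))
      = a ^ (m - 1) * ((\<Sum>l<p. if l = i then of_bool (oriented i j) else 0)
        + (\<Sum>l<p. if l = j then of_bool (oriented j i) * of_bool (m = 2) else 0))"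
      unfolding distrib_left sum_distrib_left sum.distrib[symmetric] by (intro sum.cong) auto
    then show ?thesis using i j by (simp add: arcs_def mult.commute)
  qed
  then have "(\<Sum>r<p ^ m. ?K' r * T m base r) = t0 m * (a ^ (m - 1) * arcs)"
    by (simp only: sum_T_base[OF m0])
  moreover have "(\<Sum>r<p ^ m. K m base q r * T' r) = a ^ m * T' q"
  proof -
    have "(\<Sum>r<p ^ m. K m base q r * T' r) = (\<Sum>r<p ^ m. if r = q then a ^ m * T' r else 0)"
      by (intro sum.cong) (auto simp: K_base q)
    then show ?thesis using q by simp
  qed
  moreover have "D m direction q = 0" by (simp add: D_eq[OF q] direction_def)
  ultimately have "T' q * (1 - a ^ m) = t0 m * (a ^ (m - 1) * arcs)"
    using differentiated_T_equation[OF base_box m0 q, of direction T', OF T']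
    by (simp add: sum.distrib algebra_simps)
  then have "T' q = t0 m * (a ^ (m - 1) * arcs) / (1 - a ^ m)"
    using a_power_less[OF m0] by (simp add: field_simps)
  then show ?thesis by (simp add: t0_def)
qed

text \<open>A self-loop derivative of the Kronecker power of aI is diagonal, with a^(m-1) times the
  number of digits equal to \<open>l\<close> on the diagonal; of the digits of \<open>q\<close>, m -
  1 are i and one is j.\<close>

lemma KD_base_diag:
  assumes "r < p ^ m"
  shows "KD m base (l, l) q r = a ^ (m - 1) * of_bool (r = q) * ((real m - 1) * of_bool (l = i) + of_bool (l = j))"
proof -
  have "KD m base (l, l) q r = (\<Sum>k<m. of_bool (dig p q k = l) * (a ^ (m - 1) * of_bool (r = q)))"
    unfolding KD_eq[OF q assms]
  proof (intro sum.cong refl)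
    fix k assume "k \<in> {..<m}"
    then have "(\<Prod>k'\<in>{..<m} - {k}. cmat base $$ (dig p q k', dig p r k'))
      = a ^ (m - 1) * of_bool (\<forall>k'\<in>{..<m} - {k}. dig p q k' = dig p r k')"
      by (simp only: cmat_base dig_less p_pos prod_of_bool_power finite_Diff finite_lessThan) simp
    moreover have "r = q" if "\<forall>k'\<in>{..<m} - {k}. dig p q k' = dig p r k'" "dig p q k = l" "dig p r k = l"
    proof (rule dig_eqI[OF assms q])
      fix k' assume "k' < m"
      then show "dig p r k' = dig p q k'" using that by (cases "k' = k") simp_all
    qed
    ultimately show "of_bool (dig p q k = l \<and> dig p r k = l) *
        (\<Prod>k'\<in>{..<m} - {k}. cmat base $$ (dig p q k', dig p r k'))
      = of_bool (dig p q k = l) * (a ^ (m - 1) * of_bool (r = q))"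
      by (cases "r = q") (auto simp del: mult_eq_0_iff)
  qed
  also have "\<dots> = (\<Sum>k<m. of_bool (dig p q k = l)) * (a ^ (m - 1) * of_bool (r = q))"
    by (simp only: sum_distrib_right)
  also have "(\<Sum>k<m. of_bool (dig p q k = l)) = (real m - 1) * of_bool (l = i) + of_bool (l = j)"
  proof -
    have "(\<Sum>k<m. of_bool (dig p q k = l) :: real)
      = of_bool (dig p q k0 = l) + (\<Sum>k\<in>{..<m} - {k0}. of_bool (dig p q k = l))"
      using k0 by (subst sum.remove[of _ k0]) auto
    also have "(\<Sum>k\<in>{..<m} - {k0}. of_bool (dig p q k = l) :: real) = (\<Sum>k\<in>{..<m} - {k0}. of_bool (l = i))"
      by (intro sum.cong) (auto simp: dig)
    finally show ?thesis using k0 dig[OF k0] m0 by (auto simp: of_nat_diff)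
  qed
  finally show ?thesis by simp
qed

text \<open>Columns of proper edges enter with their value at the base point, self-loop columns with
  their derivative. In the latter, terms with 1 / a stem from the change of the Kronecker power and
  terms with \<open>arcs\<close> from the change of the cumulant.\<close>

definition limit_entry :: "nat \<times> nat \<Rightarrow> real" where
  "limit_entry e = t0 m * a ^ (m - 1) *
    (of_bool (e = (i, j)) + of_bool (m = 2) * of_bool (e = (j, i))
     + ((real m - 1) / a * of_bool (oriented i j) + (real m - 1) * (t0 m * a ^ (m - 1) * arcs)) * of_bool (e = (i, i))
     + ((real m - 1) / a * (of_bool (m = 2) * of_bool (oriented j i)) + t0 m * a ^ (m - 1) * arcs) * of_bool (e = (j, j)))"

lemma Jf_diag_derivative:
  assumes l: "l < p"
  shows "((\<lambda>t. Jf m (line base direction t) (l, l) q) has_real_derivative limit_entry (l, l)) (at 0)"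
proof -
  obtain g where "\<forall>q<p ^ m. \<forall>v. ((\<lambda>t. T m (line base v t) q) has_real_derivative (\<Sum>c\<in>coords. g q c * v c)) (at 0)"
    using T_has_gradient[OF base_box m] by (elim exE)
  then obtain T' where T': "\<And>r. r < p ^ m \<Longrightarrow> ((\<lambda>t. T m (line base direction t) r) has_real_derivative T' r) (at 0)"
    by (intro that[of "\<lambda>r. \<Sum>c\<in>coords. g r c * direction c"]) simp
  define KD' where "KD' r = (\<Sum>k<m. of_bool (dig p q k = l \<and> dig p r k = l) *
      (\<Sum>k'\<in>{..<m} - {k}. cmat direction $$ (dig p q k', dig p r k') *
        (\<Prod>k''\<in>{..<m} - {k} - {k'}. cmat base $$ (dig p q k'', dig p r k''))))" for r
  have KD': "((\<lambda>t. KD m (line base direction t) (l, l) q r) has_real_derivative KD' r) (at 0)"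
    if "r < p ^ m" for r
    unfolding KD_eq[OF q that] KD'_def
    by (simp only: cmat_line dig_less p_pos) (intro DERIV_sum DERIV_cmult DERIV_prod_affine finite_Diff finite_lessThan)
  have 0: "line base direction 0 = base" by (auto simp: line_def)
  have "((\<lambda>t. Jf m (line base direction t) (l, l) q) has_real_derivative
      (\<Sum>r<p ^ m. KD' r * T m base r + T' r * KD m base (l, l) q r)) (at 0)"
    unfolding Jf_def
  proof (intro DERIV_sum)
    fix r assume "r \<in> {..<p ^ m}"
    then have "r < p ^ m" by simp
    from DERIV_mult[OF KD'[OF this] T'[OF this]]
    show "((\<lambda>t. KD m (line base direction t) (l, l) q r * T m (line base direction t) r)
      has_real_derivative KD' r * T m base r + T' r * KD m base (l, l) q r) (at 0)"
      unfolding 0 .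
  qed
  moreover have "(\<Sum>r<p ^ m. KD' r * T m base r) = t0 m * ((real m - 1) / a * (a ^ (m - 1) *
      (of_bool (oriented i j) * of_bool (l = i) + of_bool (oriented j i) * of_bool (m = 2 \<and> l = j))))"
  proof -
    define V where "V = (real m - 1) / a * (a ^ (m - 1) *
      (of_bool (oriented i j) * of_bool (l = i) + of_bool (oriented j i) * of_bool (m = 2 \<and> l = j)))"
    have V: "KD' (const_index p m l') = (if l' = l then V else 0)" if "l' < p" for l'
    proof (cases "l' = l")
      case True
      have "KD' (const_index p m l) = (\<Sum>k<m. of_bool (dig p q k = l) *
        (\<Sum>k'\<in>{..<m} - {k}. cmat direction $$ (dig p q k', l) *
          (\<Prod>k''\<in>{..<m} - {k} - {k'}. a * of_bool (dig p q k'' = l))))"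
        unfolding KD'_def
        by (intro sum.cong prod.cong arg_cong2[where f = "(*)"] refl)
          (simp_all add: dig_const_index cmat_base dig_less p_pos l)
      also have "\<dots> = (real m - 1) / a * (\<Sum>k'<m. cmat direction $$ (dig p q k', l) *
          (\<Prod>k''\<in>{..<m} - {k'}. a * of_bool (dig p q k'' = l)))"
        using a_bounds m0 by (intro double_deletion_sum) auto
      also have "(\<Sum>k'<m. cmat direction $$ (dig p q k', l) *
          (\<Prod>k''\<in>{..<m} - {k'}. a * of_bool (dig p q k'' = l)))
        = a ^ (m - 1) * (cmat direction $$ (j, l) * of_bool (l = i)
          + cmat direction $$ (i, l) * of_bool (m = 2 \<and> l = j))"
        by (rule defect_sum[where \<phi> = "\<lambda>b. cmat direction $$ (b, l)"])
      also have "\<dots> = a ^ (m - 1) * (of_bool (oriented i j) * of_bool (l = i)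
          + of_bool (oriented j i) * of_bool (m = 2 \<and> l = j))"
        by (auto simp: cmat_direction i j)
      finally show ?thesis unfolding True V_def by (simp only: simp_thms if_True)
    next
      case False
      then have "KD' (const_index p m l') = 0"
        unfolding KD'_def by (intro sum.neutral) (auto simp: dig_const_index that)
      then show ?thesis using False by simp
    qed
    have "(\<Sum>l'<p. KD' (const_index p m l')) = (\<Sum>l'<p. if l' = l then V else 0)"
      by (intro sum.cong refl V) simp
    then show ?thesis using l unfolding sum_T_base[OF m0] V_def[symmetric] by simp
  qed
  moreover have "(\<Sum>r<p ^ m. T' r * KD m base (l, l) q r)
    = T' q * (a ^ (m - 1) * ((real m - 1) * of_bool (l = i) + of_bool (l = j)))"
  proof -
    have "(\<Sum>r<p ^ m. T' r * KD m base (l, l) q r)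
      = (\<Sum>r<p ^ m. if r = q then T' r * (a ^ (m - 1) * ((real m - 1) * of_bool (l = i) + of_bool (l = j))) else 0)"
      by (intro sum.cong) (auto simp: KD_base_diag)
    then show ?thesis using q by simp
  qed
  moreover have "T' q = t0 m * t0 m * a ^ (m - 1) * arcs" by (rule T_derivative_base[OF T'])
  ultimately have deriv: "((\<lambda>t. Jf m (line base direction t) (l, l) q) has_real_derivative
      t0 m * ((real m - 1) / a * (a ^ (m - 1) *
      (of_bool (oriented i j) * of_bool (l = i) + of_bool (oriented j i) * of_bool (m = 2 \<and> l = j))))
      + t0 m * t0 m * a ^ (m - 1) * arcs * (a ^ (m - 1) * ((real m - 1) * of_bool (l = i) + of_bool (l = j)))) (at 0)"
    by (simp only: sum.distrib)
  obtain n c where nc: "real m - 1 = n" "n / a = c" by simp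
  show ?thesis
    by (rule DERIV_cong[OF deriv]) (use neq in \<open>auto simp: limit_entry_def nc algebra_simps\<close>)
qed

lemma limit_row_sum:
  assumes w: "(\<Sum>e\<in>E. limit_entry e * w e) = 0"
  shows "of_bool ((i, j) \<in> E) * w (i, j) + of_bool (m = 2) * (of_bool ((j, i) \<in> E) * w (j, i))
     + ((real m - 1) / a * of_bool (oriented i j) + (real m - 1) * (t0 m * a ^ (m - 1) * arcs)) * w (i, i)
     + ((real m - 1) / a * (of_bool (m = 2) * of_bool (oriented j i)) + t0 m * a ^ (m - 1) * arcs) * w (j, j) = 0"
    (is "?lhs = 0")
proof -
  have delta: "(\<Sum>e\<in>E. of_bool (e = e') * w e) = of_bool (e' \<in> E) * w e'" for e'
  proof -
    have "(\<Sum>e\<in>E. of_bool (e = e') * w e) = (\<Sum>e\<in>E. if e = e' then w e else 0)"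
      by (intro sum.cong) auto
    then show ?thesis using finite_E by simp
  qed
  let ?c = "(real m - 1) / a * of_bool (oriented i j) + (real m - 1) * (t0 m * a ^ (m - 1) * arcs)"
  let ?d = "(real m - 1) / a * (of_bool (m = 2) * of_bool (oriented j i)) + t0 m * a ^ (m - 1) * arcs"
  have "(\<Sum>e\<in>E. limit_entry e * w e) = t0 m * a ^ (m - 1) *
    ((\<Sum>e\<in>E. of_bool (e = (i, j)) * w e) + of_bool (m = 2) * (\<Sum>e\<in>E. of_bool (e = (j, i)) * w e)
     + ?c * (\<Sum>e\<in>E. of_bool (e = (i, i)) * w e) + ?d * (\<Sum>e\<in>E. of_bool (e = (j, j)) * w e))"
    unfolding limit_entry_def sum_distrib_left sum.distrib[symmetric]
    by (intro sum.cong refl) (simp only: distrib_left distrib_right mult_ac)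
  also have "\<dots> = t0 m * a ^ (m - 1) * ?lhs"
    using self_loops i j unfolding delta by simp
  finally have "t0 m * a ^ (m - 1) * ?lhs = 0" using w by simp
  then show ?thesis using t0_pos[OF m0] a_bounds by simp
qed

end

section \<open>From the limit system to an injective Jacobian\<close>

context lyapunov_graph
begin

abbreviation "es \<equiv> edge_list p E"

lemma edge_list: "distinct es" "set es = E" "length es = card E"
proof -
  show *: "distinct es" by (simp add: edge_list_def distinct_product)
  show "set es = E" using edges by (auto simp: edge_list_def)
  then show "length es = card E" using distinct_card[OF *] by simp
qed

lemma sum_edge_list: "(\<Sum>c<card E. F (es ! c)) = (\<Sum>e\<in>E. F e)"
  by (rule sum.reindex_bij_betw[OF bij_betw_nth]) (auto simp: edge_list)

lemma edge_list_nth: "c < card E \<Longrightarrow> es ! c \<in> E"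
  using edge_list by (metis nth_mem)

lemma edge_list_exhaust: "e \<in> E \<Longrightarrow> \<exists>c<card E. e = es ! c"
  using edge_list by (metis in_set_conv_nth)

definition off_tuples :: "(nat \<times> nat list) set" where
  "off_tuples = (SIGMA m:{2, 3, 4}. {t \<in> set (sorted_tuples p m). 1 < card (set t)})"

lemma finite_off_tuples: "finite off_tuples"
  by (simp add: off_tuples_def)

lemma sorted_tuplesD: "t \<in> set (sorted_tuples p m) \<Longrightarrow> length t = m \<and> set t \<subseteq> {..<p}"
  by (auto simp: sorted_tuples_def set_n_lists)

lemma off_tuples_index_less:
  assumes "(m, t) \<in> off_tuples"
  shows "m \<in> {2, 3, 4} \<and> tuple_index p t < p ^ m"
proof -
  have "m \<in> {2, 3, 4}" "t \<in> set (sorted_tuples p m)" using assms by (auto simp: off_tuples_def)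
  then show ?thesis using sorted_tuplesD[of t m] tuple_index_less[of t p] by auto
qed

lemma defect_tuple_off_tuples:
  assumes "m \<in> {2, 3, 4}" "i < p" "j < p" "i \<noteq> j"
  shows "(m, defect_tuple m i j) \<in> off_tuples"
proof -
  have "2 \<le> m" using assms(1) by auto
  then show ?thesis
    using assms by (auto simp: off_tuples_def sorted_tuples_def set_n_lists set_defect_tuple
        length_defect_tuple sorted_defect_tuple)
qed

text \<open>The kernel condition is phrased over edges and tuples, independent of the layout of the
  stacked matrix, to which \<open>mat_rank_jacobian_off\<close> returns.\<close>

definition jacobian_injective :: "(coord \<Rightarrow> real) \<Rightarrow> bool" where
  "jacobian_injective x \<longleftrightarrow> (\<forall>w. (\<forall>(m, t)\<in>off_tuples. (\<Sum>e\<in>E. Jf m x e (tuple_index p t) * w e) = 0)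
     \<longrightarrow> (\<forall>e\<in>E. w e = 0))"

lemma jacobian_injectiveD:
  assumes "jacobian_injective x" "e \<in> E"
    and "\<And>m t. (m, t) \<in> off_tuples \<Longrightarrow> (\<Sum>e\<in>E. Jf m x e (tuple_index p t) * w e) = 0"
  shows "w e = 0"
  using assms(1)[unfolded jacobian_injective_def, THEN spec, of w] assms(2,3) by blast

lemma defect_row_exists:
  assumes "m \<in> {2, 3, 4}" "i < p" "j < p" "i \<noteq> j"
  shows "\<exists>k0. defect_row p E m i j (tuple_index p (defect_tuple m i j)) k0"
proof -
  have "2 \<le> m" using assms(1) by auto
  from dig_defect_tuple[OF this assms(2,3)] obtain k0 where
    "k0 < m" "\<forall>k<m. dig p (tuple_index p (defect_tuple m i j)) k = (if k = k0 then j else i)" by blast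
  then have "defect_row_axioms p m i j (tuple_index p (defect_tuple m i j)) k0"
    using assms off_tuples_index_less[OF defect_tuple_off_tuples[OF assms]]
    by unfold_locales auto
  then show ?thesis using lyapunov_graph_axioms unfolding defect_row_def by blast
qed

lemma oriented_cases:
  assumes "(i, j) \<in> E" "i \<noteq> j"
  shows "oriented i j \<or> oriented j i"
  using assms by (cases "i < j") (auto simp: oriented_def)

lemma oriented_antisym: "oriented i j \<Longrightarrow> \<not> oriented j i"
  by (auto simp: oriented_def)

lemma limit_injective:
  assumes rows: "\<And>m i j. m \<in> {2, 3, 4} \<Longrightarrow> i < p \<Longrightarrow> j < p \<Longrightarrow> i \<noteq> j \<Longrightarrow>
      (\<Sum>e\<in>E. defect_row.limit_entry p E m i j e * w e) = 0"
    and "e \<in> E"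
  shows "w e = 0"
proof -
  define W where "W i j = of_bool ((i, j) \<in> E) * w (i, j)" for i j
  have row: "W i j + of_bool (m = 2) * W j i
     + ((real m - 1) / a * of_bool (oriented i j)
        + (real m - 1) * (t0 m * a ^ (m - 1) * (of_bool (oriented i j) + of_bool (m = 2) * of_bool (oriented j i)))) * w (i, i)
     + ((real m - 1) / a * (of_bool (m = 2) * of_bool (oriented j i))
        + t0 m * a ^ (m - 1) * (of_bool (oriented i j) + of_bool (m = 2) * of_bool (oriented j i))) * w (j, j) = 0"
    if m: "m \<in> {2, 3, 4}" and ij: "i < p" "j < p" "i \<noteq> j" for m i j
  proof -
    obtain k0 where "defect_row p E m i j (tuple_index p (defect_tuple m i j)) k0"
      using defect_row_exists[OF m ij] by blast
    then interpret defect_row p E m i j "tuple_index p (defect_tuple m i j)" k0 .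
    show ?thesis using limit_row_sum[OF rows[OF m ij]] unfolding W_def arcs_def .
  qed
  have pair: "W i j = 0" "W j i = 0" "w (i, i) = 0" "w (j, j) = 0" if "oriented i j" for i j
  proof -
    have ij: "i < p" "j < p" "i \<noteq> j" using that edge_less by (auto simp: oriented_def)
    have ji: "\<not> oriented j i" using that by (rule oriented_antisym)
    \<comment> \<open>In the order 3 row (j, j, i) every term but the leading one carries an
      indicator of m = 2 or of the orientation from j to i, and both are false.\<close>
    show Wji: "W j i = 0" using row[of 3 j i] ij ji by simp
    have "W i j + (real m - 1) / a * w (i, i) + a ^ (m - 1) / (1 - a ^ m) * ((real m - 1) * w (i, i) + w (j, j)) = 0"
      if "m \<in> {2, 3, 4}" for m
    proof -
      have D: "a ^ (m - 1) / (1 - a ^ m) = t0 m * a ^ (m - 1)" by (simp add: t0_def)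
      obtain n c d where nc: "real m - 1 = n" "n / a = c" "t0 m * a ^ (m - 1) = d" by simp
      show ?thesis
        using row[OF that ij] ji \<open>oriented i j\<close> Wji unfolding D nc by (simp add: algebra_simps)
    qed
    from second_difference_kernel[OF a_bounds(1,2) this]
    show "W i j = 0" "w (i, i) = 0" "w (j, j) = 0" by blast+
  qed
  obtain i j where e: "e = (i, j)" by fastforce
  show ?thesis
  proof (cases "i = j")
    case True
    have "i < p" using assms(2) e edge_less by blast
    \<comment> \<open>Here the absence of isolated nodes enters: any neighbour yields an oriented
      edge at i, and its pair system kills the self-loops at both ends.\<close>
    then obtain k where "k \<noteq> i" "(i, k) \<in> E \<or> (k, i) \<in> E"
      using no_isolated unfolding isolated_def by blast
    then have "oriented i k \<or> oriented k i" using oriented_cases by blast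
    then show ?thesis using pair e True by blast
  next
    case False
    then have "oriented i j \<or> oriented j i" using oriented_cases assms(2) e by blast
    then have "W i j = 0" using pair by blast
    then show ?thesis using assms(2) e by (simp add: W_def)
  qed
qed

lemma jacobian_injective_point: "\<exists>x\<in>box. jacobian_injective x"
proof -
  define R :: "(nat \<times> nat \<times> nat) set" where
    "R = {2, 3, 4} \<times> {(i, j). i < p \<and> j < p \<and> i \<noteq> j}"
  define row where "row x r e = (case r of (m, i, j) \<Rightarrow> Jf m x e (tuple_index p (defect_tuple m i j)))"
    for x and r :: "nat \<times> nat \<times> nat" and e
  \<comment> \<open>Self-loop columns vanish at t = 0, so division by t turns their limit into a
    derivative, while the other columns converge by continuity.\<close>
  define f where "f t r c = row (line base direction t) r (es ! c) *
      (if fst (es ! c) = snd (es ! c) then 1 / t else 1)" for t r c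
  define l where "l r c = (case r of (m, i, j) \<Rightarrow> defect_row.limit_entry p E m i j (es ! c))"
    for r :: "nat \<times> nat \<times> nat" and c
  have base0: "line base direction 0 = base" by (auto simp: line_def)
  have finR: "finite R"
  proof -
    have "R \<subseteq> {2, 3, 4} \<times> ({..<p} \<times> {..<p})" by (auto simp: R_def)
    then show ?thesis by (rule finite_subset) simp
  qed
  have lim: "((\<lambda>t. f t r c) \<longlongrightarrow> l r c) (at 0)" if "r \<in> R" "c < card E" for r c
  proof -
    obtain m i j where mij: "r = (m, i, j)" by (cases r)
    then have r: "r = (m, i, j)" "m \<in> {2, 3, 4}" "i < p" "j < p" "i \<noteq> j"
      using that(1) by (simp_all add: R_def)
    let ?q = "tuple_index p (defect_tuple m i j)"
    obtain k0 where "defect_row p E m i j ?q k0" using defect_row_exists[OF r(2-)] by blast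
    then interpret defect_row p E m i j ?q k0 .
    obtain \<alpha> \<beta> where e: "es ! c = (\<alpha>, \<beta>)" by fastforce
    then have ab: "\<alpha> < p" "\<beta> < p" using edge_list_nth[OF that(2)] edge_less by auto
    show ?thesis
    proof (cases "\<alpha> = \<beta>")
      case True
      have "Jf m base (\<alpha>, \<alpha>) ?q = 0" using r(5) by (simp add: Jf_base[OF ab(1)])
      then show ?thesis
        using Jf_diag_derivative[OF ab(1)] True
        by (simp add: has_field_derivative_iff base0 f_def l_def row_def r(1) e)
    next
      case False
      obtain g where "\<forall>v. ((\<lambda>t. Jf m (line base v t) (\<alpha>, \<beta>) ?q) has_real_derivative (\<Sum>c\<in>coords. g c * v c)) (at 0)"
        using ratfun_has_gradient[OF finite_coords ratfun_Jf[OF m q], of base] base_box box_dom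
          eventually_mono[OF eventually_line_box[OF base_box] subsetD[OF box_dom]] by blast
      then have "isCont (\<lambda>t. Jf m (line base direction t) (\<alpha>, \<beta>) ?q) 0"
        using DERIV_isCont by blast
      then have "((\<lambda>t. Jf m (line base direction t) (\<alpha>, \<beta>) ?q) \<longlongrightarrow> Jf m base (\<alpha>, \<beta>) ?q) (at 0)"
        by (simp add: isCont_def base0)
      moreover have "Jf m base (\<alpha>, \<beta>) ?q = limit_entry (\<alpha>, \<beta>)"
        using False unfolding Jf_base[OF ab(1)] limit_entry_def by auto
      ultimately show ?thesis using False by (simp add: f_def l_def row_def r(1) e)
    qed
  qed
  have inj: "v c = 0" if v: "\<And>r. r \<in> R \<Longrightarrow> (\<Sum>c<card E. l r c * v c) = 0" and c: "c < card E" for v c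
  proof -
    define w where "w e = v (the_inv_into {..<card E} ((!) es) e)" for e
    have inj: "inj_on ((!) es) {..<card E}"
      using edge_list by (auto simp: inj_on_def nth_eq_iff_index_eq)
    have w: "w (es ! c) = v c" if "c < card E" for c
      using that unfolding w_def by (simp add: the_inv_into_f_f[OF inj])
    have "(\<Sum>e\<in>E. defect_row.limit_entry p E m i j e * w e) = 0"
      if "m \<in> {2, 3, 4}" "i < p" "j < p" "i \<noteq> j" for m i j
      using v[of "(m, i, j)"] that by (simp add: R_def l_def w flip: sum_edge_list)
    from limit_injective[OF this edge_list_nth[OF c]] show ?thesis using w[OF c] by simp
  qed
  have "\<forall>\<^sub>F t in at 0. \<forall>v. (\<forall>r\<in>R. (\<Sum>c<card E. f t r c * v c) = 0) \<longrightarrow> (\<forall>c<card E. v c = 0)"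
  proof (rule eventually_trivial_kernel[where f = f and l = l, OF finR])
    show "((\<lambda>t. f t r c) \<longlongrightarrow> l r c) (at 0)" if "r \<in> R" "c < card E" for r c
      by (rule lim[OF that])
    show "v c = 0" if "\<And>r. r \<in> R \<Longrightarrow> (\<Sum>c<card E. l r c * v c) = 0" "c < card E" for v c
      using that by (rule inj)
  qed
  moreover have "\<forall>\<^sub>F t :: real in at 0. t \<noteq> 0" by (simp add: eventually_at_filter)
  ultimately have "\<forall>\<^sub>F t in at 0. line base direction t \<in> box \<and> t \<noteq> 0 \<and>
      (\<forall>v. (\<forall>r\<in>R. (\<Sum>c<card E. f t r c * v c) = 0) \<longrightarrow> (\<forall>c<card E. v c = 0))"
    using eventually_line_box[OF base_box, of direction] by eventually_elim simp
  then obtain t where t: "line base direction t \<in> box" "t \<noteq> 0"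
    "\<And>v. (\<forall>r\<in>R. (\<Sum>c<card E. f t r c * v c) = 0) \<Longrightarrow> (\<forall>c<card E. v c = 0)"
    by (auto dest!: eventually_happens)
  have "jacobian_injective (line base direction t)"
    unfolding jacobian_injective_def
  proof (intro allI impI ballI)
    fix w e
    assume w: "\<forall>(m, s)\<in>off_tuples. (\<Sum>e\<in>E. Jf m (line base direction t) e (tuple_index p s) * w e) = 0"
      and e: "e \<in> E"
    \<comment> \<open>The factor t cancels the 1 / t in \<open>f\<close>, so a kernel vector of the
      actual rows gives one of the rescaled rows.\<close>
    define v where "v c = w (es ! c) * (if fst (es ! c) = snd (es ! c) then t else 1)" for c
    have "(\<Sum>c<card E. f t r c * v c) = 0" if "r \<in> R" for r
    proof -
      obtain m i j where mij: "r = (m, i, j)" by (cases r)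
      then have r: "r = (m, i, j)" "m \<in> {2, 3, 4}" "i < p" "j < p" "i \<noteq> j"
        using that by (simp_all add: R_def)
      have "(\<Sum>c<card E. f t r c * v c)
        = (\<Sum>c<card E. Jf m (line base direction t) (es ! c) (tuple_index p (defect_tuple m i j)) * w (es ! c))"
        using t(2) by (intro sum.cong) (auto simp: f_def v_def row_def r(1))
      also have "\<dots> = (\<Sum>e\<in>E. Jf m (line base direction t) e (tuple_index p (defect_tuple m i j)) * w e)"
        by (rule sum_edge_list)
      also have "\<dots> = 0" using w defect_tuple_off_tuples[OF r(2-)] by blast
      finally show ?thesis .
    qed
    then have v: "\<forall>c<card E. v c = 0" by (intro t(3)) blast
    obtain c where "c < card E" "e = es ! c" using edge_list_exhaust[OF e] by blast
    then show "w e = 0" using v t(2) by (auto simp: v_def split: if_splits)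
  qed
  with t(1) show ?thesis by blast
qed

section \<open>Generic rank and generically finite fibres\<close>

lemma Jf_eq:
  assumes "x \<in> dom" "0 < m" "q < p ^ m"
  shows "(kron_pow_deriv p (cmat x) m e *\<^sub>v cumulant p m (cmat x) (cvec m x)) $ q = Jf m x e q"
proof -
  have "kron_pow_deriv p (cmat x) m e \<in> carrier_mat (p ^ m) (p ^ m)"
    by (cases e) (simp add: kron_pow_deriv_def)
  then show ?thesis
    using assms(3) cumulant_equation(1)[OF assms(1,2), of "cvec m x"]
    by (simp add: Jf_def KD_def T_def scalar_prod_def atLeast0LessThan)
qed

lemma off_rows_entry:
  assumes x: "x \<in> dom" and mt: "(m, t) \<in> off_tuples"
  shows "\<exists>v\<in>set (off_rows p E (cmat x) m (cumulant p m (cmat x) (cvec m x))).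
    \<forall>c<card E. v $ c = Jf m x (es ! c) (tuple_index p t)"
proof -
  let ?J = "jacobian p E (cmat x) m (cumulant p m (cmat x) (cvec m x))"
  have m: "0 < m" using off_tuples_index_less[OF mt] by auto
  obtain r where r: "r < length (sorted_tuples p m)" "sorted_tuples p m ! r = t"
    using mt by (auto simp: off_tuples_def in_set_conv_nth)
  have "row ?J r \<in> set (off_rows p E (cmat x) m (cumulant p m (cmat x) (cvec m x)))"
    using r mt by (auto simp: off_rows_def off_tuples_def)
  moreover have "row ?J r $ c = Jf m x (es ! c) (tuple_index p t)" if "c < card E" for c
    using that r off_tuples_index_less[OF mt]
    by (simp add: jacobian_def edge_list Jf_eq[OF x m])
  ultimately show ?thesis by blast
qed

lemma mat_rank_jacobian_off:
  assumes x: "x \<in> dom" and inj: "jacobian_injective x"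
  shows "mat_rank (jacobian_off p E (fst (param x)) (cumulants p (param x))) = card E"
proof -
  let ?R = "\<lambda>m. off_rows p E (cmat x) m (cumulant p m (cmat x) (cvec m x))"
  let ?rows = "?R 2 @ ?R 3 @ ?R 4"
  have J: "jacobian_off p E (fst (param x)) (cumulants p (param x)) = mat_of_rows (card E) ?rows"
    by (simp add: jacobian_off_def param_def cumulants_def edge_list)
  show ?thesis
    unfolding J
  proof (rule mat_rank_eq_dim_col)
    show "mat_of_rows (card E) ?rows \<in> carrier_mat (length ?rows) (card E)" by (rule mat_of_rows_carrier)
    fix v c assume v: "\<And>r. r < length ?rows \<Longrightarrow> (\<Sum>c<card E. mat_of_rows (card E) ?rows $$ (r, c) * v c) = 0"
      and c: "c < card E"
    define w where "w e = v (the_inv_into {..<card E} ((!) es) e)" for e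
    have inj_es: "inj_on ((!) es) {..<card E}"
      using edge_list by (auto simp: inj_on_def nth_eq_iff_index_eq)
    have w: "w (es ! c) = v c" if "c < card E" for c
      using that unfolding w_def by (simp add: the_inv_into_f_f[OF inj_es])
    have "(\<Sum>e\<in>E. Jf m x e (tuple_index p t) * w e) = 0" if mt: "(m, t) \<in> off_tuples" for m t
    proof -
      obtain u where u: "u \<in> set (?R m)" "\<And>c. c < card E \<Longrightarrow> u $ c = Jf m x (es ! c) (tuple_index p t)"
        using off_rows_entry[OF x mt] by blast
      have "u \<in> set ?rows" using u(1) off_tuples_index_less[OF mt] by auto
      then obtain r where r: "r < length ?rows" "?rows ! r = u" by (metis in_set_conv_nth)
      have "(\<Sum>e\<in>E. Jf m x e (tuple_index p t) * w e)
        = (\<Sum>c<card E. mat_of_rows (card E) ?rows $$ (r, c) * v c)"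
        unfolding sum_edge_list[symmetric] using r u(2) w
        by (intro sum.cong) (auto simp: mat_of_rows_index)
      then show ?thesis using v[OF r(1)] by simp
    qed
    from jacobian_injectiveD[OF inj edge_list_nth[OF c] this] show "v c = 0" using w[OF c] by simp
  qed
qed

lemma jacobian_injective_iff_gram:
  "det (gram off_tuples (card E) (\<lambda>(m, t) c. Jf m x (es ! c) (tuple_index p t))) \<noteq> 0
    \<longleftrightarrow> jacobian_injective x" (is "det ?G \<noteq> 0 \<longleftrightarrow> _")
proof -
  have inj_es: "inj_on ((!) es) {..<card E}"
    using edge_list by (auto simp: inj_on_def nth_eq_iff_index_eq)
  have "(\<forall>v. (\<forall>(m, t)\<in>off_tuples. (\<Sum>c<card E. Jf m x (es ! c) (tuple_index p t) * v c) = 0)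
      \<longrightarrow> (\<forall>c<card E. v c = 0)) \<longleftrightarrow> jacobian_injective x"
  proof
    assume *: "\<forall>v. (\<forall>(m, t)\<in>off_tuples. (\<Sum>c<card E. Jf m x (es ! c) (tuple_index p t) * v c) = 0)
      \<longrightarrow> (\<forall>c<card E. v c = 0)"
    show "jacobian_injective x"
      unfolding jacobian_injective_def
    proof (intro allI impI ballI)
      fix w e assume "\<forall>(m, t)\<in>off_tuples. (\<Sum>e\<in>E. Jf m x e (tuple_index p t) * w e) = 0" "e \<in> E"
      then have "\<forall>c<card E. w (es ! c) = 0"
        unfolding sum_edge_list[symmetric] by (intro *[THEN spec, THEN mp])
      then show "w e = 0" using edge_list_exhaust[OF \<open>e \<in> E\<close>] by blast
    qed
  next
    assume inj: "jacobian_injective x"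
    show "\<forall>v. (\<forall>(m, t)\<in>off_tuples. (\<Sum>c<card E. Jf m x (es ! c) (tuple_index p t) * v c) = 0)
      \<longrightarrow> (\<forall>c<card E. v c = 0)"
    proof (intro allI impI)
      fix v c
      assume v: "\<forall>(m, t)\<in>off_tuples. (\<Sum>c<card E. Jf m x (es ! c) (tuple_index p t) * v c) = 0"
        and c: "c < card E"
      define w where "w e = v (the_inv_into {..<card E} ((!) es) e)" for e
      have w: "w (es ! c) = v c" if "c < card E" for c
        using that unfolding w_def by (simp add: the_inv_into_f_f[OF inj_es])
      have "\<forall>(m, t)\<in>off_tuples. (\<Sum>e\<in>E. Jf m x e (tuple_index p t) * w e) = 0"
        using v unfolding sum_edge_list[symmetric] by (simp add: w)
      then have "(\<Sum>e\<in>E. Jf m x e (tuple_index p t) * w e) = 0" if "(m, t) \<in> off_tuples" for m t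
        using that by blast
      from jacobian_injectiveD[OF inj edge_list_nth[OF c] this] show "v c = 0" using w[OF c] by simp
    qed
  qed
  then show ?thesis unfolding gram_det_nonzero_iff[OF finite_off_tuples] by (simp add: case_prod_unfold)
qed

lemma generic_full_rank:
  "generically p E (\<lambda>x. mat_rank (jacobian_off p E (fst x) (cumulants p x)) = card E)"
proof -
  let ?d = "\<lambda>x. det (gram off_tuples (card E) (\<lambda>(m, t) c. Jf m x (es ! c) (tuple_index p t)))"
  have "ratfun coords dom ?d"
  proof (rule ratfun_det)
    fix b c assume "b < card E" "c < card E"
    have "ratfun coords dom (\<lambda>x. \<Sum>(m, t)\<in>off_tuples. Jf m x (es ! b) (tuple_index p t) * Jf m x (es ! c) (tuple_index p t))"
      unfolding case_prod_unfold
      using off_tuples_index_less[OF prod.collapse[THEN ssubst[of _ _ "\<lambda>z. z \<in> off_tuples"]]]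
      by (intro ratfun_sum ratfun_mult ratfun_Jf) blast+
    then show "ratfun coords dom (\<lambda>x. gram off_tuples (card E)
        (\<lambda>(m, t) c. Jf m x (es ! c) (tuple_index p t)) $$ (b, c))"
      using \<open>b < card E\<close> \<open>c < card E\<close> by (simp add: gram_def case_prod_unfold)
  qed simp
  then obtain num den where nd: "num \<in> polyfun coords" "\<And>x. x \<in> dom \<Longrightarrow> den x \<noteq> 0"
    "\<And>x. x \<in> dom \<Longrightarrow> ?d x * den x = num x"
    unfolding ratfun_def by blast
  \<comment> \<open>The numerator of the Gram determinant vanishes on \<open>dom\<close> exactly
    where injectivity fails, so it cuts out the exceptional set.\<close>
  have iff: "num x \<noteq> 0 \<longleftrightarrow> jacobian_injective x" if "x \<in> dom" for x
    using nd(2)[OF that] nd(3)[OF that] jacobian_injective_iff_gram[of x] by auto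
  obtain x where "x \<in> box" "jacobian_injective x" using jacobian_injective_point by blast
  then have x: "x \<in> dom" "num x \<noteq> 0" using iff[of x] box_dom by blast+
  show ?thesis
    by (rule genericallyI[OF nd(1) x]) (simp add: iff mat_rank_jacobian_off)
qed

section \<open>From the Jacobian to finite fibres of the cumulant map\<close>

text \<open>If all cumulants are stationary along \<open>v\<close>, the differentiated equation
  equates the Jacobian combination with minus \<open>D m v\<close>. That tensor is diagonal, so the
  off-diagonal rows force the edge components to be 0. Consequently \<open>D m v\<close> vanishes
  too, and its diagonal consists of the noise components.\<close>

lemma cumulant_gradient_injective:
  assumes x: "x \<in> box" and inj: "jacobian_injective x"
    and g: "\<And>m q v. m \<in> {2, 3, 4} \<Longrightarrow> q < p ^ m \<Longrightarrow>
      ((\<lambda>t. T m (line x v t) q) has_real_derivative (\<Sum>c\<in>coords. g m q c * v c)) (at 0)"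
    and v: "\<And>m q. m \<in> {2, 3, 4} \<Longrightarrow> q < p ^ m \<Longrightarrow> (\<Sum>c\<in>coords. g m q c * v c) = 0"
    and c: "c \<in> coords"
  shows "v c = 0"
proof -
  have eq: "(\<Sum>e\<in>E. Jf m x e q * v (Entry (fst e) (snd e))) = - D m v q" if "m \<in> {2, 3, 4}" "q < p ^ m" for m q
  proof -
    have m0: "0 < m" using that by auto
    have "0 - (\<Sum>r<p ^ m. (\<Sum>(i, j)\<in>E. v (Entry i j) * KD m x (i, j) q r) * T m x r + K m x q r * 0) = D m v q"
      using g[OF that(1), of _ v] v[OF that(1)]
      by (intro differentiated_T_equation[where T' = "\<lambda>_. 0", OF x m0 that(2)]) simp
    moreover have "(\<Sum>r<p ^ m. (\<Sum>(i, j)\<in>E. v (Entry i j) * KD m x (i, j) q r) * T m x r)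
      = (\<Sum>e\<in>E. Jf m x e q * v (Entry (fst e) (snd e)))"
      unfolding Jf_def sum_distrib_right case_prod_unfold
      by (subst sum.swap) (simp add: mult_ac)
    ultimately show ?thesis by simp
  qed
  have "\<forall>e\<in>E. v (Entry (fst e) (snd e)) = 0"
  proof -
    have "(\<Sum>e\<in>E. Jf m x e (tuple_index p t) * v (Entry (fst e) (snd e))) = 0"
      if mt: "(m, t) \<in> off_tuples" for m t
    proof -
      note less = off_tuples_index_less[OF mt]
      have t: "length t = m" "set t \<subseteq> {..<p}" "1 < card (set t)"
        using mt sorted_tuplesD by (auto simp: off_tuples_def)
      have "\<exists>k<m. \<exists>k'<m. t ! k \<noteq> t ! k'"
      proof (rule ccontr)
        assume *: "\<not> (\<exists>k<m. \<exists>k'<m. t ! k \<noteq> t ! k')"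
        have "set t \<subseteq> {t ! 0}"
        proof
          fix y assume "y \<in> set t"
          then obtain k where k: "k < m" "y = t ! k" using t(1) by (auto simp: in_set_conv_nth)
          then have "0 < m" by simp
          then have "t ! k = t ! 0" using * k(1) by blast
          then show "y \<in> {t ! 0}" using k(2) by simp
        qed
        then have "card (set t) \<le> 1" using card_mono[of "{t ! 0}" "set t"] by simp
        with t(3) show False by simp
      qed
      then obtain k k' where k: "k < m" "k' < m" "t ! k \<noteq> t ! k'" by blast
      have "dig p (tuple_index p t) (m - 1 - k) \<noteq> dig p (tuple_index p t) (m - 1 - k')"
        using k dig_tuple_index[OF t(2), of "m - 1 - k"] dig_tuple_index[OF t(2), of "m - 1 - k'"] t(1)
        by simp
      then have "D m v (tuple_index p t) = 0"
        unfolding D_def using less k by (intro diag_tensor_off_diagonal[of _ _ _ "m - 1 - k" "m - 1 - k'"]) auto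
      then show ?thesis using eq less by simp
    qed
    from jacobian_injectiveD[OF inj _ this] show ?thesis by blast
  qed
  then have edge: "v (Entry i j) = 0" if "(i, j) \<in> E" for i j using that by force
  have noise: "v (Noise m i) = 0" if "m \<in> {2, 3, 4}" "i < p" for m i
  proof -
    have "D m v (const_index p m i) = 0"
      using eq[OF that(1) const_index_less[OF that(2)]] edge by (simp add: case_prod_unfold)
    then show ?thesis
      using diag_tensor_const_index[of m i p "cvec m v"] that by (auto simp: D_def cvec_def)
  qed
  show ?thesis using c edge noise by (cases c) auto
qed

lemma generic_finite_fibres: "locally_identifiable p E"
proof -
  obtain x0 where x0: "x0 \<in> box" "jacobian_injective x0" using jacobian_injective_point by blast
  have "\<forall>m\<in>{2, 3, 4}. \<exists>g. \<forall>q<p ^ m. \<forall>v.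
      ((\<lambda>t. T m (line x0 v t) q) has_real_derivative (\<Sum>c\<in>coords. g q c * v c)) (at 0)"
    using T_has_gradient[OF x0(1)] by blast
  from bchoice[OF this] obtain g where g': "\<forall>m\<in>{2, 3, 4}. \<forall>q<p ^ m. \<forall>v.
      ((\<lambda>t. T m (line x0 v t) q) has_real_derivative (\<Sum>c\<in>coords. g m q c * v c)) (at 0)" ..
  have g: "((\<lambda>t. T m (line x0 v t) q) has_real_derivative (\<Sum>c\<in>coords. g m q c * v c)) (at 0)"
    if "m \<in> {2, 3, 4}" "q < p ^ m" for m q v
    by (rule g'[rule_format, OF that])
  define J where "J = (SIGMA m:{2, 3, 4 :: nat}. {..<p ^ m})"
  have "\<exists>L. \<forall>i\<in>coords. \<forall>k\<in>coords. (\<Sum>j\<in>J. L i j * g (fst j) (snd j) k) = (if i = k then 1 else 0)"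
  proof (rule left_inverse_exists[OF finite_coords])
    show "finite J" by (simp add: J_def)
    fix v i assume v: "\<And>j. j \<in> J \<Longrightarrow> (\<Sum>i\<in>coords. g (fst j) (snd j) i * v i) = 0" and i: "i \<in> coords"
    show "v i = 0"
    proof (rule cumulant_gradient_injective[OF x0 g _ i])
      show "(\<Sum>c\<in>coords. g m q c * v c) = 0" if "m \<in> {2, 3, 4}" "q < p ^ m" for m q
        using v[of "(m, q)"] that by (auto simp: J_def)
    qed
  qed
  then obtain L where L: "\<And>i k. i \<in> coords \<Longrightarrow> k \<in> coords \<Longrightarrow>
      (\<Sum>j\<in>J. L i j * g (fst j) (snd j) k) = (if i = k then 1 else 0)" by blast
  \<comment> \<open>\<open>L\<close> cuts the cumulant entries down to one function per coordinate,
    with the identity as derivative at \<open>x0\<close>; subtracting the values at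
    \<open>x0\<close> makes these functions vanish there, as the quotient by t requires.\<close>
  define \<psi> where "\<psi> i x = (\<Sum>j\<in>J. L i j * (T (fst j) x (snd j) - T (fst j) x0 (snd j)))" for i x
  have rat: "ratfun coords dom (\<psi> i)" for i
    unfolding \<psi>_def by (intro ratfun_sum ratfun_mult ratfun_diff ratfun_const ratfun_T) (auto simp: J_def)
  have deriv: "((\<lambda>t. \<psi> i (line x0 v t) / t) \<longlongrightarrow> v i) (at 0)" if "i \<in> coords" for i v
  proof -
    have 0: "line x0 v 0 = x0" by (auto simp: line_def)
    have "((\<lambda>t. \<psi> i (line x0 v t)) has_real_derivative
        (\<Sum>j\<in>J. L i j * ((\<Sum>c\<in>coords. g (fst j) (snd j) c * v c) - 0))) (at 0)"
      unfolding \<psi>_def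
      by (intro DERIV_sum DERIV_cmult DERIV_diff DERIV_const g) (auto simp: J_def)
    also have "(\<Sum>j\<in>J. L i j * ((\<Sum>c\<in>coords. g (fst j) (snd j) c * v c) - 0))
      = (\<Sum>c\<in>coords. (\<Sum>j\<in>J. L i j * g (fst j) (snd j) c) * v c)"
      unfolding sum_distrib_right diff_zero sum_distrib_left
      by (subst sum.swap) (simp add: mult.assoc)
    also have "\<dots> = (\<Sum>c\<in>coords. if c = i then v c else 0)"
      by (intro sum.cong refl) (simp add: L[OF that])
    also have "\<dots> = v i" using that finite_coords by simp
    finally show ?thesis
      by (simp add: has_field_derivative_iff 0 \<psi>_def[of i x0])
  qed
  obtain h where h: "h \<in> polyfun coords" "\<exists>x\<in>box. h x \<noteq> 0"
    "\<And>x. x \<in> dom \<Longrightarrow> h x \<noteq> 0 \<Longrightarrow>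
      finite ((\<lambda>y. restrict y coords) ` {y \<in> dom. \<forall>i\<in>coords. \<psi> i y = \<psi> i x})"
    using generically_finite_fibres[OF finite_coords rat eventually_line_box[OF x0(1)] box_dom x0(1) box_convex deriv]
    by blast
  then obtain x1 where x1: "x1 \<in> dom" "h x1 \<noteq> 0" using box_dom by blast
  show ?thesis
    unfolding locally_identifiable_def
  proof (rule genericallyI[OF h(1) x1])
    fix x assume x: "x \<in> dom" "h x \<noteq> 0"
    \<comment> \<open>Equal cumulants give equal \<psi>, and a parameter is determined by its values
      on \<open>coords\<close>, so finiteness of the restricted fibre of \<psi> carries
      over.\<close>
    have "{y \<in> param_space p E. cumulants p y = cumulants p (param x)}
      \<subseteq> param ` (\<lambda>y. restrict y coords) ` {y \<in> dom. \<forall>i\<in>coords. \<psi> i y = \<psi> i x}"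
    proof
      fix \<theta> assume "\<theta> \<in> {y \<in> param_space p E. cumulants p y = cumulants p (param x)}"
      then have \<theta>: "param (coord_of \<theta>) = \<theta>" "\<theta> \<in> param_space p E"
        and cum: "cumulants p \<theta> = cumulants p (param x)" by (auto simp: param_coord_of)
      let ?y = "coord_of \<theta>"
      have y: "?y \<in> dom" using \<theta> by (simp add: dom_def)
      have "cumulants p (param ?y) = cumulants p (param x)" using cum \<theta>(1) by simp
      then have "T m ?y q = T m x q" if "m \<in> {2, 3, 4}" for m q
        using that by (auto simp: cumulants_def param_def T_def)
      then have "\<psi> i ?y = \<psi> i x" for i
        unfolding \<psi>_def by (intro sum.cong) (auto simp: J_def)
      then have "?y \<in> {y \<in> dom. \<forall>i\<in>coords. \<psi> i y = \<psi> i x}" using y by simp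
      moreover have "\<theta> = param (restrict ?y coords)"
        using param_cong[of "restrict ?y coords" ?y] \<theta>(1) by simp
      ultimately show "\<theta> \<in> param ` (\<lambda>y. restrict y coords) ` {y \<in> dom. \<forall>i\<in>coords. \<psi> i y = \<psi> i x}"
        by blast
    qed
    then show "finite {y \<in> param_space p E. cumulants p y = cumulants p (param x)}"
      by (rule finite_subset) (intro finite_imageI h(3) x)
  qed
qed

end

theorem corollary5p11:
  fixes p :: nat and E :: "(nat \<times> nat) set"
  assumes "2 \<le> p"
    and "E \<subseteq> {0..<p} \<times> {0..<p}"
    and "\<forall>i<p. (i, i) \<in> E"
    and "\<forall>i<p. \<not> isolated p E i"
  shows "generically p E (\<lambda>x. mat_rank (jacobian_off p E (fst x) (cumulants p x)) = card E)
    \<and> locally_identifiable p E"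
proof -
  interpret lyapunov_graph p E using assms by unfold_locales
  show ?thesis using generic_full_rank generic_finite_fibres by blast
qed

end
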